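(* Let $\delta>0$, let $(X,d,\mu)$ be an Ahlfors $\delta$-regular metric-measure space and let $\Delta_{\mathbb C}$ be its complex logarithmic Dirichlet Laplacian. Then the triple $(\operatorname{Din}_{\mathbb C}(X,d),L^2_{\mathbb C}(X,\mu),\Delta_{\mathbb C})$ is a $\operatorname{Li}$-summable spectral triple, where $\operatorname{Din}_{\mathbb C}(X,d)$, the algebra of complex-valued Dini continuous functions, acts on $L^2_{\mathbb C}(X,\mu)$ by multiplication operators.
   Context: A metric-measure space is a triple $(X,d,\mu)$ where $(X,d)$ is a locally compact second-countable metric space and $\mu$ is a finite Borel measure on $X$. It is Ahlfors $\delta$-regular ($\delta>0$) if there is $C\ge 1$ such that $C^{-1}r^\delta\le\mu(\overline B(x,r))\le Cr^\delta$ for all $x\in X$ and $0\le r<\operatorname{diam}X$; then $\operatorname{diam} X<\infty$. $L^2_{\mathbb C}(X,\mu)$ is the complex Hilbert space of complex-valued square-integrable functions. Let $$\operatorname{Dom}\mathcal E_{\mathbb C}=\Big\{f\in L^2_{\mathbb C}(X,\mu):\int_X\int_X\frac{|f(x)-f(y)|^2}{d(x,y)^\delta}\,d\mu(y)\,d\mu(x)<\infty\Big\},$$ $$\mathcal E_{\mathbb C}(f,g)=\frac12\int_X\int_X\frac{\overline{(f(x)-f(y))}(g(x)-g(y))}{d(x,y)^\delta}\,d\mu(y)\,d\mu(x),$$ the integrals being over the complement of the diagonal; this is a densely defined closed form. $\Delta_{\mathbb C}$ is the associated positive self-adjoint operator: if $R:L^2_{\mathbb C}(X,\mu)\to\operatorname{Dom}\mathcal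 E_{\mathbb C}$ is determined by $\langle Rf,g\rangle_{L^2}+\mathcal E_{\mathbb C}(Rf,g)=\langle f,g\rangle_{L^2}$ for all $g\in\operatorname{Dom}\mathcal E_{\mathbb C}$ (inner product conjugate-linear in the first variable), then $\operatorname{Dom}\Delta_{\mathbb C}=\operatorname{Im}R$ and $\Delta_{\mathbb C}Rf=f-Rf$. A bounded uniformly continuous function $h:X\to\mathbb C$ is Dini continuous if $\int_0^1\frac{\omega_h(t)}{t}\,dt<\infty$, where $\omega_h(t)=\sup\{|h(x)-h(y)|:d(x,y)\le t\operatorname{diam}(X)\}$ for $t\in[0,1]$. A spectral triple $(\mathcal A,H,D)$ consists of a complex unital $*$-algebra $\mathcal A$, a complex Hilbert space $H$ and a self-adjoint operator $D:\operatorname{Dom}D\to H$ such that (1) $\mathcal A\subset\mathbb B(H)$ (the bounded operators on $H$); (2) $D$ has compact resolvent; (3) every $a\in\mathcal A$ maps $\operatorname{Dom}D$ into $\operatorname{Dom}D$ and $[D,a]$ extends to a bounded operator. It is $\operatorname{Li}$-summable if for some $t>0$ the operator $e^{-t|D|}$ is trace class. *)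

theory Defs
  imports "HOL-Analysis.Analysis" "HOL-Library.FuncSet"
begin

section \<open>Complex Hilbert spaces\<close>

text \<open>The space of square-integrable functions depends on a measure, so it cannot be a type.
  Hilbert spaces are therefore records with an explicit carrier.\<close>

record 'v hspace =
  hcarrier :: "'v set"
  hzero :: 'v
  hadd :: "'v \<Rightarrow> 'v \<Rightarrow> 'v"
  hscale :: "complex \<Rightarrow> 'v \<Rightarrow> 'v"
  hinner :: "'v \<Rightarrow> 'v \<Rightarrow> complex"

definition hminus :: "'v hspace \<Rightarrow> 'v \<Rightarrow> 'v \<Rightarrow> 'v"
  where "hminus H u v = hadd H u (hscale H (- 1) v)"

definition hnorm :: "'v hspace \<Rightarrow> 'v \<Rightarrow> real"
  where "hnorm H u = sqrt (Re (hinner H u u))"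

text \<open>The value outside the carrier matters because the locale \<open>Metric_space\<close> requires symmetry
  and nonnegativity of the distance on the whole type.\<close>

definition hdist :: "'v hspace \<Rightarrow> 'v \<Rightarrow> 'v \<Rightarrow> real"
  where "hdist H u v = (if u \<in> hcarrier H \<and> v \<in> hcarrier H then hnorm H (hminus H u v) else 0)"

definition htopology :: "'v hspace \<Rightarrow> 'v topology"
  where "htopology H = Metric_space.mtopology (hcarrier H) (hdist H)"

locale complex_hilbert_space =
  fixes H :: "'v hspace"
  assumes zero_closed: "hzero H \<in> hcarrier H"
    and add_closed: "\<lbrakk>u \<in> hcarrier H; v \<in> hcarrier H\<rbrakk> \<Longrightarrow> hadd H u v \<in> hcarrier H"
    and scale_closed: "u \<in> hcarrier H \<Longrightarrow> hscale H a u \<in> hcarrier H"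
    and add_assoc: "\<lbrakk>u \<in> hcarrier H; v \<in> hcarrier H; w \<in> hcarrier H\<rbrakk>
      \<Longrightarrow> hadd H (hadd H u v) w = hadd H u (hadd H v w)"
    and add_commute: "\<lbrakk>u \<in> hcarrier H; v \<in> hcarrier H\<rbrakk> \<Longrightarrow> hadd H u v = hadd H v u"
    and add_zero: "u \<in> hcarrier H \<Longrightarrow> hadd H u (hzero H) = u"
    and add_inverse: "u \<in> hcarrier H \<Longrightarrow> hadd H u (hscale H (- 1) u) = hzero H"
    and scale_one: "u \<in> hcarrier H \<Longrightarrow> hscale H 1 u = u"
    and scale_scale: "u \<in> hcarrier H \<Longrightarrow> hscale H a (hscale H b u) = hscale H (a * b) u"
    and scale_add_right: "\<lbrakk>u \<in> hcarrier H; v \<in> hcarrier H\<rbrakk>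
      \<Longrightarrow> hscale H a (hadd H u v) = hadd H (hscale H a u) (hscale H a v)"
    and scale_add_left: "u \<in> hcarrier H
      \<Longrightarrow> hscale H (a + b) u = hadd H (hscale H a u) (hscale H b u)"
    and inner_add_right: "\<lbrakk>u \<in> hcarrier H; v \<in> hcarrier H; w \<in> hcarrier H\<rbrakk>
      \<Longrightarrow> hinner H u (hadd H v w) = hinner H u v + hinner H u w"
    and inner_scale_right: "\<lbrakk>u \<in> hcarrier H; v \<in> hcarrier H\<rbrakk>
      \<Longrightarrow> hinner H u (hscale H a v) = a * hinner H u v"
    and inner_commute: "\<lbrakk>u \<in> hcarrier H; v \<in> hcarrier H\<rbrakk> \<Longrightarrow> hinner H u v = cnj (hinner H v u)"
    and inner_nonneg: "u \<in> hcarrier H \<Longrightarrow> 0 \<le> Re (hinner H u u)"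
    and inner_definite: "\<lbrakk>u \<in> hcarrier H; hinner H u u = 0\<rbrakk> \<Longrightarrow> u = hzero H"
    and complete: "Metric_space.mcomplete (hcarrier H) (hdist H)"

definition orthonormal_basis :: "'v hspace \<Rightarrow> 'v set \<Rightarrow> bool"
  where "orthonormal_basis H B \<longleftrightarrow> B \<subseteq> hcarrier H
    \<and> (\<forall>e\<in>B. \<forall>e'\<in>B. hinner H e e' = (if e = e' then 1 else 0))
    \<and> (\<forall>u\<in>hcarrier H. (\<forall>e\<in>B. hinner H e u = 0) \<longrightarrow> u = hzero H)"


section \<open>Bounded operators\<close>

text \<open>Bounded operators are extensional functions on the carrier, so that equality of operators is
  equality in HOL and composition is \<open>compose (hcarrier H)\<close>.\<close>

definition bounded_ops :: "'v hspace \<Rightarrow> ('v \<Rightarrow> 'v) set"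
  where "bounded_ops H = {T \<in> hcarrier H \<rightarrow>\<^sub>E hcarrier H.
    (\<forall>u\<in>hcarrier H. \<forall>v\<in>hcarrier H. T (hadd H u v) = hadd H (T u) (T v))
    \<and> (\<forall>a. \<forall>u\<in>hcarrier H. T (hscale H a u) = hscale H a (T u))
    \<and> (\<exists>C. \<forall>u\<in>hcarrier H. hnorm H (T u) \<le> C * hnorm H u)}"

definition op_id :: "'v hspace \<Rightarrow> 'v \<Rightarrow> 'v"
  where "op_id H = (\<lambda>u\<in>hcarrier H. u)"

definition op_add :: "'v hspace \<Rightarrow> ('v \<Rightarrow> 'v) \<Rightarrow> ('v \<Rightarrow> 'v) \<Rightarrow> 'v \<Rightarrow> 'v"
  where "op_add H S T = (\<lambda>u\<in>hcarrier H. hadd H (S u) (T u))"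

definition op_scale :: "'v hspace \<Rightarrow> complex \<Rightarrow> ('v \<Rightarrow> 'v) \<Rightarrow> 'v \<Rightarrow> 'v"
  where "op_scale H a T = (\<lambda>u\<in>hcarrier H. hscale H a (T u))"

definition is_op_adjoint :: "'v hspace \<Rightarrow> ('v \<Rightarrow> 'v) \<Rightarrow> ('v \<Rightarrow> 'v) \<Rightarrow> bool"
  where "is_op_adjoint H T S \<longleftrightarrow>
    (\<forall>u\<in>hcarrier H. \<forall>v\<in>hcarrier H. hinner H (T u) v = hinner H u (S v))"

definition compact_op :: "'v hspace \<Rightarrow> ('v \<Rightarrow> 'v) \<Rightarrow> bool"
  where "compact_op H T \<longleftrightarrow> T \<in> bounded_ops H
    \<and> compactin (htopology H)
        (htopology H closure_of (T ` {u \<in> hcarrier H. hnorm H u \<le> 1}))"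

definition positive_op :: "'v hspace \<Rightarrow> ('v \<Rightarrow> 'v) \<Rightarrow> bool"
  where "positive_op H A \<longleftrightarrow> A \<in> bounded_ops H
    \<and> (\<forall>u\<in>hcarrier H. Im (hinner H u (A u)) = 0 \<and> 0 \<le> Re (hinner H u (A u)))"

text \<open>\<open>A\<close> is the positive square root of \<open>T\<^sup>* T\<close>.\<close>

definition is_op_abs :: "'v hspace \<Rightarrow> ('v \<Rightarrow> 'v) \<Rightarrow> ('v \<Rightarrow> 'v) \<Rightarrow> bool"
  where "is_op_abs H T A \<longleftrightarrow> positive_op H A
    \<and> (\<forall>u\<in>hcarrier H. \<forall>v\<in>hcarrier H. hinner H u (A (A v)) = hinner H (T u) (T v))"

text \<open>The trace of a positive operator does not depend on the orthonormal basis.\<close>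

definition trace_class :: "'v hspace \<Rightarrow> ('v \<Rightarrow> 'v) \<Rightarrow> bool"
  where "trace_class H T \<longleftrightarrow> T \<in> bounded_ops H
    \<and> (\<exists>A B. is_op_abs H T A \<and> orthonormal_basis H B
          \<and> (\<lambda>e. Re (hinner H e (A e))) summable_on B)"

definition unital_star_subalgebra :: "'v hspace \<Rightarrow> ('v \<Rightarrow> 'v) set \<Rightarrow> bool"
  where "unital_star_subalgebra H A \<longleftrightarrow> A \<subseteq> bounded_ops H \<and> op_id H \<in> A
    \<and> (\<forall>S\<in>A. \<forall>T\<in>A. op_add H S T \<in> A \<and> compose (hcarrier H) S T \<in> A)
    \<and> (\<forall>a. \<forall>T\<in>A. op_scale H a T \<in> A)
    \<and> (\<forall>T\<in>A. \<exists>S\<in>A. is_op_adjoint H T S)"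


section \<open>Unbounded operators\<close>

text \<open>An unbounded operator is a partial function \<open>D\<close> with domain \<open>dom D\<close>.\<close>

definition linear_operator :: "'v hspace \<Rightarrow> ('v \<rightharpoonup> 'v) \<Rightarrow> bool"
  where "linear_operator H D \<longleftrightarrow> dom D \<subseteq> hcarrier H \<and> ran D \<subseteq> hcarrier H \<and> hzero H \<in> dom D
    \<and> (\<forall>u\<in>dom D. \<forall>v\<in>dom D. D (hadd H u v) = Some (hadd H (the (D u)) (the (D v))))
    \<and> (\<forall>a. \<forall>u\<in>dom D. D (hscale H a u) = Some (hscale H a (the (D u))))"

definition densely_defined :: "'v hspace \<Rightarrow> ('v \<rightharpoonup> 'v) \<Rightarrow> bool"
  where "densely_defined H D \<longleftrightarrow> htopology H closure_of dom D = hcarrier H"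

text \<open>The vector chosen by \<open>THE\<close> is unique when \<open>D\<close> is densely defined.\<close>

definition adjoint_operator :: "'v hspace \<Rightarrow> ('v \<rightharpoonup> 'v) \<Rightarrow> ('v \<rightharpoonup> 'v)"
  where "adjoint_operator H D = (\<lambda>v.
    let represents = (\<lambda>w. w \<in> hcarrier H \<and> (\<forall>u\<in>dom D. hinner H v (the (D u)) = hinner H w u))
    in if v \<in> hcarrier H \<and> (\<exists>w. represents w) then Some (THE w. represents w) else None)"

definition self_adjoint :: "'v hspace \<Rightarrow> ('v \<rightharpoonup> 'v) \<Rightarrow> bool"
  where "self_adjoint H D \<longleftrightarrow>
    linear_operator H D \<and> densely_defined H D \<and> adjoint_operator H D = D"

text \<open>\<open>R\<close> is the bounded two-sided inverse of \<open>D - z\<close>.\<close>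

definition is_resolvent :: "'v hspace \<Rightarrow> ('v \<rightharpoonup> 'v) \<Rightarrow> complex \<Rightarrow> ('v \<Rightarrow> 'v) \<Rightarrow> bool"
  where "is_resolvent H D z R \<longleftrightarrow> R \<in> bounded_ops H
    \<and> (\<forall>u\<in>hcarrier H. R u \<in> dom D \<and> hminus H (the (D (R u))) (hscale H z (R u)) = u)
    \<and> (\<forall>u\<in>dom D. R (hminus H (the (D u)) (hscale H z u)) = u)"

text \<open>By the resolvent identity, compactness at one point of the resolvent set implies compactness
  at all of them.\<close>

definition compact_resolvent :: "'v hspace \<Rightarrow> ('v \<rightharpoonup> 'v) \<Rightarrow> bool"
  where "compact_resolvent H D \<longleftrightarrow> (\<exists>z R. is_resolvent H D z R \<and> compact_op H R)"


section \<open>Spectral measures and functional calculus\<close>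

definition projection_valued_measure :: "'v hspace \<Rightarrow> (real set \<Rightarrow> 'v \<Rightarrow> 'v) \<Rightarrow> bool"
  where "projection_valued_measure H E \<longleftrightarrow>
    (\<forall>B\<in>sets borel. E B \<in> bounded_ops H \<and> is_op_adjoint H (E B) (E B))
    \<and> E UNIV = op_id H
    \<and> (\<forall>B\<in>sets borel. \<forall>B'\<in>sets borel. E (B \<inter> B') = compose (hcarrier H) (E B) (E B'))
    \<and> (\<forall>u\<in>hcarrier H. \<forall>B :: nat \<Rightarrow> real set. range B \<subseteq> sets borel \<longrightarrow> disjoint_family B \<longrightarrow>
          (\<lambda>i. Re (hinner H u (E (B i) u))) sums Re (hinner H u (E (\<Union>i. B i) u)))"

text \<open>The finite positive measure mapping \<open>B\<close> to the inner product of \<open>u\<close> and \<open>E B u\<close>.\<close>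

definition scalar_measure :: "'v hspace \<Rightarrow> (real set \<Rightarrow> 'v \<Rightarrow> 'v) \<Rightarrow> 'v \<Rightarrow> real measure"
  where "scalar_measure H E u =
    measure_of UNIV (sets borel) (\<lambda>B. ennreal (Re (hinner H u (E B u))))"

text \<open>\<open>D\<close> is the integral of the identity function against \<open>E\<close>.  By polarization the diagonal
  values determine a linear, densely defined \<open>D\<close>.\<close>

definition is_spectral_measure :: "'v hspace \<Rightarrow> ('v \<rightharpoonup> 'v) \<Rightarrow> (real set \<Rightarrow> 'v \<Rightarrow> 'v) \<Rightarrow> bool"
  where "is_spectral_measure H D E \<longleftrightarrow> projection_valued_measure H E
    \<and> dom D = {u \<in> hcarrier H. integrable (scalar_measure H E u) (\<lambda>s. s\<^sup>2)}
    \<and> (\<forall>u\<in>dom D. hinner H u (the (D u)) = complex_of_real (LINT s|scalar_measure H E u. s))"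

text \<open>\<open>T\<close> is the bounded operator \<open>f(D)\<close>, for a self-adjoint \<open>D\<close> and a bounded Borel function
  \<open>f\<close>.\<close>

definition is_functional_calculus ::
    "'v hspace \<Rightarrow> ('v \<rightharpoonup> 'v) \<Rightarrow> (real \<Rightarrow> complex) \<Rightarrow> ('v \<Rightarrow> 'v) \<Rightarrow> bool"
  where "is_functional_calculus H D f T \<longleftrightarrow> T \<in> bounded_ops H
    \<and> (\<exists>E. is_spectral_measure H D E
          \<and> (\<forall>u\<in>hcarrier H. hinner H u (T u) = (LINT s|scalar_measure H E u. f s)))"


section \<open>Spectral triples\<close>

definition spectral_triple :: "('v \<Rightarrow> 'v) set \<Rightarrow> 'v hspace \<Rightarrow> ('v \<rightharpoonup> 'v) \<Rightarrow> bool"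
  where "spectral_triple A H D \<longleftrightarrow> complex_hilbert_space H
    \<and> unital_star_subalgebra H A
    \<and> self_adjoint H D
    \<and> compact_resolvent H D
    \<and> (\<forall>a\<in>A. a ` dom D \<subseteq> dom D
          \<and> (\<exists>T\<in>bounded_ops H. \<forall>u\<in>dom D. T u = hminus H (the (D (a u))) (a (the (D u)))))"

definition Li_summable :: "'v hspace \<Rightarrow> ('v \<rightharpoonup> 'v) \<Rightarrow> bool"
  where "Li_summable H D \<longleftrightarrow> (\<exists>t>0. \<exists>T.
    is_functional_calculus H D (\<lambda>s. complex_of_real (exp (- t * \<bar>s\<bar>))) T \<and> trace_class H T)"

text \<open>A set of functions which is a unital star-algebra under the pointwise operations, and a unital
  star-representation of it on \<open>H\<close>.\<close>

definition unital_star_representation ::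
    "('a \<Rightarrow> complex) set \<Rightarrow> 'v hspace \<Rightarrow> (('a \<Rightarrow> complex) \<Rightarrow> 'v \<Rightarrow> 'v) \<Rightarrow> bool"
  where "unital_star_representation A H \<pi> \<longleftrightarrow>
    (\<forall>f\<in>A. \<pi> f \<in> bounded_ops H)
    \<and> (\<lambda>x. 1) \<in> A \<and> \<pi> (\<lambda>x. 1) = op_id H
    \<and> (\<forall>f\<in>A. \<forall>g\<in>A. (\<lambda>x. f x + g x) \<in> A \<and> \<pi> (\<lambda>x. f x + g x) = op_add H (\<pi> f) (\<pi> g))
    \<and> (\<forall>f\<in>A. \<forall>g\<in>A. (\<lambda>x. f x * g x) \<in> A
          \<and> \<pi> (\<lambda>x. f x * g x) = compose (hcarrier H) (\<pi> f) (\<pi> g))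
    \<and> (\<forall>c. \<forall>f\<in>A. (\<lambda>x. c * f x) \<in> A \<and> \<pi> (\<lambda>x. c * f x) = op_scale H c (\<pi> f))
    \<and> (\<forall>f\<in>A. (\<lambda>x. cnj (f x)) \<in> A \<and> is_op_adjoint H (\<pi> f) (\<pi> (\<lambda>x. cnj (f x))))"


section \<open>The operator of a closed form\<close>

text \<open>\<open>W\<close> is \<open>R F\<close>, where \<open>R\<close> is the inverse of \<open>1 + \<Delta>\<close>; it exists and is unique by the Riesz
  representation theorem when the positive form \<open>q\<close> with domain \<open>Q\<close> is closed.\<close>

definition form_resolvent ::
    "'v hspace \<Rightarrow> 'v set \<Rightarrow> ('v \<Rightarrow> 'v \<Rightarrow> complex) \<Rightarrow> 'v \<Rightarrow> 'v"
  where "form_resolvent H Q q F =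
    (THE W. W \<in> Q \<and> (\<forall>G\<in>Q. hinner H W G + q W G = hinner H F G))"

text \<open>Since \<open>Q\<close> is dense, \<open>R\<close> is injective; the operator maps \<open>R F\<close> to \<open>F - R F\<close>.\<close>

definition form_operator ::
    "'v hspace \<Rightarrow> 'v set \<Rightarrow> ('v \<Rightarrow> 'v \<Rightarrow> complex) \<Rightarrow> ('v \<rightharpoonup> 'v)"
  where "form_operator H Q q = (\<lambda>W.
    let R = form_resolvent H Q q
    in if W \<in> R ` hcarrier H then Some (hminus H (inv_into (hcarrier H) R W) W) else None)"


section \<open>Square-integrable functions\<close>

definition L2_funs :: "'a measure \<Rightarrow> ('a \<Rightarrow> complex) set"
  where "L2_funs M = {f \<in> borel_measurable M. integrable M (\<lambda>x. (cmod (f x))\<^sup>2)}"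

definition ae_rel :: "'a measure \<Rightarrow> (('a \<Rightarrow> complex) \<times> ('a \<Rightarrow> complex)) set"
  where "ae_rel M = {(f, g). f \<in> L2_funs M \<and> g \<in> L2_funs M \<and> (AE x in M. f x = g x)}"

definition L2_class :: "'a measure \<Rightarrow> ('a \<Rightarrow> complex) \<Rightarrow> ('a \<Rightarrow> complex) set"
  where "L2_class M f = ae_rel M `` {f}"

text \<open>All operations below are independent of the chosen representative.\<close>

definition L2_rep :: "('a \<Rightarrow> complex) set \<Rightarrow> 'a \<Rightarrow> complex"
  where "L2_rep U = (SOME f. f \<in> U)"

definition L2_space :: "'a measure \<Rightarrow> ('a \<Rightarrow> complex) set hspace"
  where "L2_space M = \<lparr>
    hcarrier = L2_funs M // ae_rel M,
    hzero = L2_class M (\<lambda>x. 0),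
    hadd = (\<lambda>U V. L2_class M (\<lambda>x. L2_rep U x + L2_rep V x)),
    hscale = (\<lambda>c U. L2_class M (\<lambda>x. c * L2_rep U x)),
    hinner = (\<lambda>U V. LINT x|M. cnj (L2_rep U x) * L2_rep V x)\<rparr>"

definition mult_op :: "'a measure \<Rightarrow> ('a \<Rightarrow> complex) \<Rightarrow> ('a \<Rightarrow> complex) set \<Rightarrow> ('a \<Rightarrow> complex) set"
  where "mult_op M h = (\<lambda>U\<in>hcarrier (L2_space M). L2_class M (\<lambda>x. h x * L2_rep U x))"


section \<open>Metric-measure spaces and the logarithmic Dirichlet Laplacian\<close>

definition metric_measure_space ::
    "'a::{metric_space, second_countable_topology} measure \<Rightarrow> bool"
  where "metric_measure_space M \<longleftrightarrow>
    locally_compact_space (euclidean :: 'a topology) \<and> sets M = sets borel \<and> finite_measure M"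

text \<open>The diameter in the condition on \<open>r\<close> is taken in the extended reals, because
  \<open>diameter UNIV\<close> is meaningful only for a bounded space.\<close>

definition ahlfors_regular :: "'a::metric_space measure \<Rightarrow> real \<Rightarrow> bool"
  where "ahlfors_regular M \<delta> \<longleftrightarrow> (\<exists>C\<ge>1. \<forall>(x::'a) r.
    0 \<le> r \<longrightarrow> ereal r < (SUP (y, z) \<in> (UNIV :: ('a \<times> 'a) set). ereal (dist y z)) \<longrightarrow>
      r powr \<delta> / C \<le> measure M (cball x r) \<and> measure M (cball x r) \<le> C * r powr \<delta>)"

text \<open>In both integrals the diagonal contributes nothing, since the integrand is \<open>0 / 0 = 0\<close>
  there.\<close>

definition log_form_dom ::
    "'a::metric_space measure \<Rightarrow> real \<Rightarrow> ('a \<Rightarrow> complex) set set"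
  where "log_form_dom M \<delta> = {U \<in> hcarrier (L2_space M).
    (\<integral>\<^sup>+ x. \<integral>\<^sup>+ y. ennreal ((cmod (L2_rep U x - L2_rep U y))\<^sup>2 / dist x y powr \<delta>) \<partial>M \<partial>M) < \<infinity>}"

definition log_form ::
    "'a::metric_space measure \<Rightarrow> real \<Rightarrow> ('a \<Rightarrow> complex) set \<Rightarrow> ('a \<Rightarrow> complex) set \<Rightarrow> complex"
  where "log_form M \<delta> U V = 1 / 2 * (LINT x|M. LINT y|M.
    cnj (L2_rep U x - L2_rep U y) * (L2_rep V x - L2_rep V y)
      / complex_of_real (dist x y powr \<delta>))"

definition log_laplacian ::
    "'a::metric_space measure \<Rightarrow> real \<Rightarrow> (('a \<Rightarrow> complex) set \<rightharpoonup> ('a \<Rightarrow> complex) set)"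
  where "log_laplacian M \<delta> = form_operator (L2_space M) (log_form_dom M \<delta>) (log_form M \<delta>)"


section \<open>Dini continuous functions\<close>

definition dini_modulus :: "('a::metric_space \<Rightarrow> complex) \<Rightarrow> real \<Rightarrow> real"
  where "dini_modulus h t =
    Sup {cmod (h x - h y) | x y. dist x y \<le> t * diameter (UNIV :: 'a set)}"

definition dini :: "('a::metric_space \<Rightarrow> complex) set"
  where "dini = {h. bounded (range h) \<and> uniformly_continuous_on UNIV h
    \<and> (\<integral>\<^sup>+ t \<in> {0<..1}. ennreal (dini_modulus h t / t) \<partial>lborel) < \<infinity>}"

end

theory Submission
  imports Defs
begin

text \<open>
  The proof diagonalizes the Laplacian and reads off the operator-theoretic claims from its
  eigenvalues; Ahlfors regularity and the Dini condition enter through two estimates of the kernel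
  \<open>1 / dist x y powr \<delta>\<close>.

  \<^emph>\<open>Abstract part.\<close>  A closed positive form \<open>q\<close> with domain \<open>Q\<close> on a Hilbert space has a resolvent
  \<open>R\<close>, obtained from the Riesz representation theorem on \<open>Q\<close> with its form norm.  Assume that bounded
  energy and weak convergence to zero imply norm convergence to zero on \<open>Q\<close>.  Then \<open>R\<close> has an
  orthonormal basis of eigenvectors (\<open>eigenbasis_exists\<close>): on the complement of the eigenvectors
  found so far, a maximizing sequence for the quadratic form of \<open>R\<close> would otherwise converge weakly
  to zero while its quadratic form does not.  In this basis the operator of the form multiplies
  coefficients by the energies of the basis vectors (\<open>form_operator_diagonal\<close>).  For such a diagonal
  operator, self-adjointness, the spectral measure and the functional calculus are statements about
  square-summable coefficients, by Parseval's identity.  If \<open>exp (- t * \<lambda>)\<close> is summable over the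
  eigenvalues, the eigenvalues tend to infinity, so the resolvent is compact and \<open>exp (- t * \<bar>D\<bar>)\<close> is
  trace class (\<open>compact_resolvent_D\<close>, \<open>Li_summable_D\<close>).

  \<^emph>\<open>Eigenvalue growth.\<close>  Cutting the kernel off at distance \<open>r\<close> and expanding the square shows that
  the form dominates the multiplication operator by the integral of \<open>1 / dist x y powr \<delta>\<close> over
  \<open>dist x y > r\<close>, minus an integral operator with bounded kernel (\<open>form_ge_truncated\<close>).  By Ahlfors
  regularity every annulus with a fixed large ratio of radii contributes a definite amount to that
  integral, so it grows like \<open>ln (1 / r)\<close> (\<open>truncated_kernel\<close>), whereas the bound of the cut-off
  kernel grows like a power of \<open>1 / r\<close>.  Thus at level \<open>L\<close> the error kernel is bounded by a multiple
  of \<open>exp (b * L)\<close>.  A bounded kernel is a Hilbert-Schmidt kernel.  Hence it maps weakly null sequences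
  to norm null ones, which is the compactness required above, and Bessel's inequality bounds the
  number of orthonormal vectors of energy at most \<open>L\<close> by a multiple of \<open>exp (2 * b * L)\<close>
  (\<open>kernel_gap_count\<close>).  This gives the summability.

  \<^emph>\<open>Commutators.\<close>  Formally \<open>[\<Delta>, h]\<close> is the integral operator with kernel
  \<open>(h x - h y) / dist x y powr \<delta>\<close>.  On dyadic shells the volume bound cancels the singularity and
  leaves the dyadic sum of the modulus of continuity, which the Dini condition makes finite
  (\<open>dini_schur\<close>).  Schur's test then shows that the operator is bounded, and the weak form of the
  identity (\<open>form_commutator\<close>) shows both that \<open>h\<close> preserves the domain and that the commutator is
  this operator.  The same estimate places the Lipschitz functions in the form domain, which is
  therefore dense.
\<close>

section \<open>Complex inner product spaces\<close>

text \<open>Completeness is split off from the Hilbert space axioms so that it can be verified by means of the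
  norm in each of the three cases that occur below: square-integrable functions, closed subspaces,
  and the domain of a closed form with its form norm.\<close>

locale inner_space =
  fixes H :: "'v hspace"
  assumes zero_closed: "hzero H \<in> hcarrier H"
    and add_closed: "\<lbrakk>u \<in> hcarrier H; v \<in> hcarrier H\<rbrakk> \<Longrightarrow> hadd H u v \<in> hcarrier H"
    and scale_closed: "u \<in> hcarrier H \<Longrightarrow> hscale H a u \<in> hcarrier H"
    and add_assoc: "\<lbrakk>u \<in> hcarrier H; v \<in> hcarrier H; w \<in> hcarrier H\<rbrakk>
      \<Longrightarrow> hadd H (hadd H u v) w = hadd H u (hadd H v w)"
    and add_commute: "\<lbrakk>u \<in> hcarrier H; v \<in> hcarrier H\<rbrakk> \<Longrightarrow> hadd H u v = hadd H v u"
    and add_zero: "u \<in> hcarrier H \<Longrightarrow> hadd H u (hzero H) = u"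
    and add_inverse: "u \<in> hcarrier H \<Longrightarrow> hadd H u (hscale H (- 1) u) = hzero H"
    and scale_one: "u \<in> hcarrier H \<Longrightarrow> hscale H 1 u = u"
    and scale_scale: "u \<in> hcarrier H \<Longrightarrow> hscale H a (hscale H b u) = hscale H (a * b) u"
    and scale_add_right: "\<lbrakk>u \<in> hcarrier H; v \<in> hcarrier H\<rbrakk>
      \<Longrightarrow> hscale H a (hadd H u v) = hadd H (hscale H a u) (hscale H a v)"
    and scale_add_left: "u \<in> hcarrier H
      \<Longrightarrow> hscale H (a + b) u = hadd H (hscale H a u) (hscale H b u)"
    and inner_add_right: "\<lbrakk>u \<in> hcarrier H; v \<in> hcarrier H; w \<in> hcarrier H\<rbrakk>
      \<Longrightarrow> hinner H u (hadd H v w) = hinner H u v + hinner H u w"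
    and inner_scale_right: "\<lbrakk>u \<in> hcarrier H; v \<in> hcarrier H\<rbrakk>
      \<Longrightarrow> hinner H u (hscale H a v) = a * hinner H u v"
    and inner_commute: "\<lbrakk>u \<in> hcarrier H; v \<in> hcarrier H\<rbrakk> \<Longrightarrow> hinner H u v = cnj (hinner H v u)"
    and inner_nonneg: "u \<in> hcarrier H \<Longrightarrow> 0 \<le> Re (hinner H u u)"
    and inner_definite: "\<lbrakk>u \<in> hcarrier H; hinner H u u = 0\<rbrakk> \<Longrightarrow> u = hzero H"
begin

abbreviation "X \<equiv> hcarrier H"
abbreviation ip where "ip \<equiv> hinner H"
abbreviation nrm where "nrm \<equiv> hnorm H"
abbreviation mns where "mns \<equiv> hminus H"

lemma minus_closed: "u \<in> X \<Longrightarrow> v \<in> X \<Longrightarrow> mns u v \<in> X"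
  by (simp add: hminus_def add_closed scale_closed)

lemmas closed_simps [simp] = zero_closed add_closed scale_closed minus_closed

lemma add_left_commute:
  "\<lbrakk>u \<in> X; v \<in> X; w \<in> X\<rbrakk> \<Longrightarrow> hadd H v (hadd H u w) = hadd H u (hadd H v w)"
  by (metis add_assoc add_commute)

lemma inner_add_left: "\<lbrakk>u \<in> X; v \<in> X; w \<in> X\<rbrakk> \<Longrightarrow> ip (hadd H u v) w = ip u w + ip v w"
  using inner_commute[of "hadd H u v" w] inner_commute[of u w] inner_commute[of v w]
  by (simp add: inner_add_right)

lemma inner_scale_left: "\<lbrakk>u \<in> X; v \<in> X\<rbrakk> \<Longrightarrow> ip (hscale H a u) v = cnj a * ip u v"
  using inner_commute[of "hscale H a u" v] inner_commute[of u v]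
  by (simp add: inner_scale_right)

lemma inner_minus_right: "\<lbrakk>u \<in> X; v \<in> X; w \<in> X\<rbrakk> \<Longrightarrow> ip u (mns v w) = ip u v - ip u w"
  by (simp add: hminus_def inner_add_right inner_scale_right)

lemma inner_minus_left: "\<lbrakk>u \<in> X; v \<in> X; w \<in> X\<rbrakk> \<Longrightarrow> ip (mns u v) w = ip u w - ip v w"
  by (simp add: hminus_def inner_add_left inner_scale_left)

lemma inner_zero_right: "u \<in> X \<Longrightarrow> ip u (hzero H) = 0"
  using inner_add_right[of u "hzero H" "hzero H"] by (simp add: add_zero)

lemma inner_zero_left: "u \<in> X \<Longrightarrow> ip (hzero H) u = 0"
  using inner_commute[of "hzero H" u] by (simp add: inner_zero_right)

lemmas inner_simps [simp] = inner_add_right inner_add_left inner_scale_right inner_scale_left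
  inner_minus_right inner_minus_left inner_zero_right inner_zero_left

lemma inner_self: "u \<in> X \<Longrightarrow> ip u u = complex_of_real ((nrm u)\<^sup>2)"
  using inner_commute[of u u] inner_nonneg[of u]
  by (simp add: hnorm_def complex_eq_iff)

lemma nrm_nonneg [simp]: "u \<in> X \<Longrightarrow> 0 \<le> nrm u"
  by (simp add: hnorm_def inner_nonneg)

lemma nrm_sq: "u \<in> X \<Longrightarrow> (nrm u)\<^sup>2 = Re (ip u u)"
  by (simp add: inner_self)

lemma minus_eq_zero: assumes "u \<in> X" "v \<in> X" "mns u v = hzero H" shows "u = v"
proof -
  have "u = hadd H u (hadd H v (hscale H (-1) v))"
    using assms by (simp add: add_inverse add_zero)
  also have "\<dots> = hadd H v (hadd H u (hscale H (-1) v))"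
    using assms by (metis add_assoc add_commute scale_closed)
  also have "\<dots> = v" using assms(1,2) assms(3)[unfolded hminus_def] by (simp add: add_zero)
  finally show ?thesis .
qed

text \<open>Comparing inner products with all vectors turns an identity between vectors into one between
  complex numbers, where simplification is available.  Most vector identities below are proved in
  this way.\<close>

lemma inner_ext: assumes "u \<in> X" "v \<in> X" "\<And>w. w \<in> X \<Longrightarrow> ip w u = ip w v" shows "u = v"
  using assms minus_eq_zero[of u v] inner_definite[of "mns u v"] by simp

lemma inner_ext_left: assumes "u \<in> X" "v \<in> X" "\<And>w. w \<in> X \<Longrightarrow> ip u w = ip v w" shows "u = v"
  using assms inner_commute by (intro inner_ext) metis+

lemma nrm_eq_zero: "u \<in> X \<Longrightarrow> nrm u = 0 \<longleftrightarrow> u = hzero H"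
  using inner_definite[of u] inner_zero_right[OF zero_closed]
  by (auto simp: inner_self simp del: inner_simps)

lemma nrm_zero [simp]: "nrm (hzero H) = 0" by (simp add: nrm_eq_zero)

lemma nrm_scale: "u \<in> X \<Longrightarrow> nrm (hscale H a u) = cmod a * nrm u"
proof -
  assume u: "u \<in> X"
  have "(nrm (hscale H a u))\<^sup>2 = (cmod a * nrm u)\<^sup>2"
    using u inner_self[OF u] by (subst nrm_sq) (simp_all add: cmod_power2 power_mult_distrib
      power2_eq_square[of "Re a"] power2_eq_square[of "Im a"] algebra_simps)
  then show ?thesis using u by (simp add: power2_eq_iff_nonneg)
qed

lemma inner_Re_commute: "\<lbrakk>u \<in> X; v \<in> X\<rbrakk> \<Longrightarrow> Re (ip u v) = Re (ip v u)"
  by (subst inner_commute) simp_all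

lemma nrm_add_sq: "\<lbrakk>u \<in> X; v \<in> X\<rbrakk> \<Longrightarrow> (nrm (hadd H u v))\<^sup>2 = (nrm u)\<^sup>2 + 2 * Re (ip u v) + (nrm v)\<^sup>2"
  using arg_cong[OF inner_commute[of u v], of Re] by (simp add: nrm_sq)

lemma nrm_minus_sq: "\<lbrakk>u \<in> X; v \<in> X\<rbrakk> \<Longrightarrow> (nrm (mns u v))\<^sup>2 = (nrm u)\<^sup>2 - 2 * Re (ip u v) + (nrm v)\<^sup>2"
  using arg_cong[OF inner_commute[of u v], of Re] by (simp add: nrm_sq)

lemma Cauchy_Schwarz: assumes [simp]: "u \<in> X" "v \<in> X" shows "cmod (ip u v) \<le> nrm u * nrm v"
proof (cases "v = hzero H")
  case False
  then have v: "nrm v > 0"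
    by (metis assms(2) less_eq_real_def nrm_eq_zero nrm_nonneg)
  \<comment> \<open>The vector \<open>c v\<close> is the projection of \<open>u\<close> to the line spanned by \<open>v\<close>.\<close>
  define c where "c = ip v u / complex_of_real ((nrm v)\<^sup>2)"
  have c1: "c * ip u v = complex_of_real ((cmod (ip u v))\<^sup>2 / (nrm v)\<^sup>2)"
    using inner_commute[of v u] complex_norm_square[of "ip u v"]
    by (simp add: c_def mult.commute)
  have c2: "(cmod c)\<^sup>2 * (nrm v)\<^sup>2 = (cmod (ip u v))\<^sup>2 / (nrm v)\<^sup>2"
  proof -
    have "cmod c = cmod (ip u v) / (nrm v)\<^sup>2"
      using inner_commute[of v u] by (simp add: c_def norm_divide del: of_real_power)
    then show ?thesis using v by (simp add: power_divide field_simps power2_eq_square)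
  qed
  have "0 \<le> (nrm (mns u (hscale H c v)))\<^sup>2" by simp
  also have "\<dots> = (nrm u)\<^sup>2 - (cmod (ip u v))\<^sup>2 / (nrm v)\<^sup>2"
    using c1 c2 by (subst nrm_minus_sq) (simp_all add: nrm_scale power_mult_distrib)
  finally have "(cmod (ip u v))\<^sup>2 \<le> (nrm u * nrm v)\<^sup>2"
    using v by (simp add: field_simps power_mult_distrib)
  then show ?thesis by (rule power2_le_imp_le) (simp)
qed simp

lemma nrm_triangle: assumes [simp]: "u \<in> X" "v \<in> X" shows "nrm (hadd H u v) \<le> nrm u + nrm v"
proof -
  have "Re (ip u v) \<le> nrm u * nrm v"
    using Cauchy_Schwarz[of u v] complex_Re_le_cmod[of "ip u v"] by simp
  then have "(nrm (hadd H u v))\<^sup>2 \<le> (nrm u + nrm v)\<^sup>2"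
    by (simp add: nrm_add_sq power2_sum)
  then show ?thesis by (rule power2_le_imp_le) simp
qed

lemma nrm_minus_commute: "\<lbrakk>u \<in> X; v \<in> X\<rbrakk> \<Longrightarrow> nrm (mns u v) = nrm (mns v u)"
  by (rule power2_eq_imp_eq) (simp_all add: nrm_minus_sq inner_Re_commute[of u v])

lemma nrm_minus_triangle: assumes "u \<in> X" "v \<in> X" "w \<in> X"
  shows "nrm (mns u w) \<le> nrm (mns u v) + nrm (mns v w)"
proof -
  have "mns u w = hadd H (mns u v) (mns v w)" using assms by (intro inner_ext) simp_all
  then show ?thesis using nrm_triangle[of "mns u v" "mns v w"] assms by simp
qed

sublocale Metric_space X "hdist H"
proof
  show "0 \<le> hdist H x y" for x y by (simp add: hdist_def)
  show "hdist H x y = hdist H y x" for x y by (simp add: hdist_def nrm_minus_commute)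
  show "(hdist H x y = 0) = (x = y)" if "x \<in> X" "y \<in> X" for x y
    using that minus_eq_zero[of x y] by (auto simp: hdist_def nrm_eq_zero)
       (simp add: add_inverse hminus_def)
  show "hdist H x z \<le> hdist H x y + hdist H y z" if "x \<in> X" "y \<in> X" "z \<in> X" for x y z
    using that nrm_minus_triangle by (simp add: hdist_def)
qed

lemma htopology_eq: "htopology H = mtopology" by (simp add: htopology_def)

definition cauchy :: "(nat \<Rightarrow> 'v) \<Rightarrow> bool"
  where "cauchy u \<longleftrightarrow> (\<forall>n. u n \<in> X) \<and> (\<forall>\<epsilon>>0. \<exists>N. \<forall>m\<ge>N. \<forall>n\<ge>N. nrm (mns (u m) (u n)) < \<epsilon>)"

lemma MCauchy_iff: "MCauchy u \<longleftrightarrow> cauchy u"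
  by (auto simp: MCauchy_def cauchy_def hdist_def) (meson order_refl rangeI subsetD)+

lemma limit_iff: assumes "\<And>n. u n \<in> X"
  shows "limitin mtopology u l sequentially \<longleftrightarrow> l \<in> X \<and> (\<lambda>n. nrm (mns (u n) l)) \<longlonglongrightarrow> 0"
  using assms by (auto simp: limitin_metric tendsto_iff hdist_def)

lemma mcomplete_iff: "mcomplete \<longleftrightarrow>
    (\<forall>u. cauchy u \<longrightarrow> (\<exists>l\<in>X. (\<lambda>n. nrm (mns (u n) l)) \<longlonglongrightarrow> 0))"
  unfolding mcomplete_def MCauchy_iff by (metis cauchy_def limit_iff)

lemma inner_tendsto: assumes "\<And>n. u n \<in> X" "l \<in> X" "(\<lambda>n. nrm (mns (u n) l)) \<longlonglongrightarrow> 0" "w \<in> X"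
  shows "(\<lambda>n. ip (u n) w) \<longlonglongrightarrow> ip l w" "(\<lambda>n. ip w (u n)) \<longlonglongrightarrow> ip w l"
proof -
  have *: "(\<lambda>n. nrm (mns (u n) l) * nrm w) \<longlonglongrightarrow> 0" using tendsto_mult_left_zero[OF assms(3)] .
  have "(\<lambda>n. ip (u n) w - ip l w) \<longlonglongrightarrow> 0"
  proof (rule Lim_null_comparison[OF _ *], rule always_eventually, rule allI)
    fix n show "norm (ip (u n) w - ip l w) \<le> nrm (mns (u n) l) * nrm w"
      using Cauchy_Schwarz[of "mns (u n) l" w] assms by simp
  qed
  then show 1: "(\<lambda>n. ip (u n) w) \<longlonglongrightarrow> ip l w" by (simp add: LIM_zero_iff)
  have "(\<lambda>n. cnj (ip (u n) w)) \<longlonglongrightarrow> cnj (ip l w)" using 1 by (intro tendsto_cnj)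
  moreover have "cnj (ip (u n) w) = ip w (u n)" for n using assms inner_commute by metis
  moreover have "cnj (ip l w) = ip w l" using assms inner_commute by metis
  ultimately show "(\<lambda>n. ip w (u n)) \<longlonglongrightarrow> ip w l" by simp
qed

end

lemma complex_hilbert_spaceI:
  assumes "inner_space H" and
    "\<And>u. inner_space.cauchy H u \<Longrightarrow> \<exists>l\<in>hcarrier H. (\<lambda>n. hnorm H (hminus H (u n) l)) \<longlonglongrightarrow> 0"
  shows "complex_hilbert_space H"
proof -
  interpret inner_space H by fact
  show ?thesis
    by (unfold_locales) (simp_all add: add_assoc add_zero add_inverse scale_one scale_scale
        scale_add_right scale_add_left inner_nonneg inner_definite mcomplete_iff assms(2),
        simp_all add: add_commute inner_commute[symmetric])
qed

sublocale complex_hilbert_space \<subseteq> inner_space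
  by unfold_locales (fact zero_closed add_closed scale_closed add_assoc add_commute add_zero
    add_inverse scale_one scale_scale scale_add_right scale_add_left inner_add_right
    inner_scale_right inner_commute inner_nonneg inner_definite)+

context complex_hilbert_space
begin

lemma complete_seq: "cauchy u \<Longrightarrow> \<exists>l\<in>X. (\<lambda>n. nrm (mns (u n) l)) \<longlonglongrightarrow> 0"
  using complete mcomplete_iff by blast

end

section \<open>Riesz representation and orthonormal expansions\<close>

lemma quadratic_nonneg_imp_zero:
  fixes a b :: real
  assumes "b \<ge> 0" "\<And>t. 0 \<le> 2 * t * a + t\<^sup>2 * b"
  shows "a = 0"
proof (rule ccontr)
  assume "a \<noteq> 0"
  \<comment> \<open>The minimizer would be \<open>- a / b\<close>; enlarging the denominator covers \<open>b = 0\<close>.\<close>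
  define t where "t = - a / (b + 1)"
  have t: "t * (b + 1) = - a" using assms(1) by (simp add: t_def)
  have "(2 * t * a + t\<^sup>2 * b) * (b + 1)\<^sup>2 = 2 * (t * (b + 1)) * a * (b + 1) + (t * (b + 1))\<^sup>2 * b"
    by (simp add: power2_eq_square algebra_simps)
  also have "\<dots> = - (a\<^sup>2 * (b + 2))" unfolding t by (simp add: power2_eq_square algebra_simps)
  also have "\<dots> < 0" using \<open>a \<noteq> 0\<close> assms(1) by simp
  finally show False using assms(2)[of t] by (simp add: mult_less_0_iff not_less)
qed

lemma quadratic_lower_bound:
  fixes a K :: real assumes "0 \<le> a" shows "a\<^sup>2 - 2 * (K * a) \<ge> - K\<^sup>2"
  using zero_le_power2[of "a - K"] by (simp add: power2_diff algebra_simps)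

context complex_hilbert_space
begin

text \<open>A minimizing sequence of \<open>\<parallel>u\<parallel>\<^sup>2 - 2 Re (\<phi> u)\<close> is Cauchy by the parallelogram law.  The
  asserted identity is the vanishing of the first variation at its limit; it is obtained from the
  variations at the members of the sequence, where the functional is minimal up to \<open>1 / Suc n\<close>.\<close>

theorem riesz_representation:
  assumes add: "\<And>u v. u \<in> X \<Longrightarrow> v \<in> X \<Longrightarrow> \<phi> (hadd H u v) = \<phi> u + \<phi> v"
    and scale: "\<And>a u. u \<in> X \<Longrightarrow> \<phi> (hscale H a u) = a * \<phi> u"
    and bound: "\<And>u. u \<in> X \<Longrightarrow> cmod (\<phi> u) \<le> K * nrm u"
  shows "\<exists>w\<in>X. \<forall>u\<in>X. ip w u = \<phi> u"
proof -
  define J where "J u = (nrm u)\<^sup>2 - 2 * Re (\<phi> u)" for u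
  have J_low: "- K\<^sup>2 \<le> J u" if "u \<in> X" for u
    using quadratic_lower_bound[of "nrm u" K] bound[OF that] complex_Re_le_cmod[of "\<phi> u"] that
    by (simp add: J_def)
  define j where "j = Inf (J ` X)"
  have j_le: "j \<le> J u" if "u \<in> X" for u
    unfolding j_def using that J_low by (intro cInf_lower bdd_belowI2[of _ "- K\<^sup>2"]) auto
  have "\<exists>u\<in>X. J u < j + 1 / real (Suc n)" for n
  proof -
    have "Inf (J ` X) < j + 1 / real (Suc n)" by (simp add: j_def)
    moreover have "J ` X \<noteq> {}" using zero_closed by blast
    ultimately have "\<exists>y\<in>J ` X. y < j + 1 / real (Suc n)" by (intro cInf_lessD)
    then show ?thesis by auto
  qed
  then obtain u where u [simp]: "\<And>n. u n \<in> X" and Ju: "\<And>n. J (u n) < j + 1 / real (Suc n)"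
    by metis
  have par: "(nrm (mns v w))\<^sup>2 = 2 * J v + 2 * J w - 4 * J (hscale H (1/2) (hadd H v w))"
    if "v \<in> X" "w \<in> X" for v w
    using that by (simp add: J_def nrm_minus_sq nrm_scale nrm_add_sq scale add power_mult_distrib
        power_divide field_simps)
  have diff: "(nrm (mns (u m) (u n)))\<^sup>2 < 2 / real (Suc m) + 2 / real (Suc n)" for m n
    using par[of "u m" "u n"] Ju[of m] Ju[of n] j_le[of "hscale H (1/2) (hadd H (u m) (u n))"] by simp
  have "cauchy u"
    unfolding cauchy_def
  proof (intro conjI allI impI)
    fix \<epsilon> :: real assume e: "\<epsilon> > 0"
    obtain N where N: "4 / real (Suc N) < \<epsilon>\<^sup>2"
    proof -
      obtain N where "inverse (real (Suc N)) < \<epsilon>\<^sup>2 / 4" using e reals_Archimedean[of "\<epsilon>\<^sup>2 / 4"] by auto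
      then show ?thesis using that by (simp add: field_simps)
    qed
    show "\<exists>N. \<forall>m\<ge>N. \<forall>n\<ge>N. nrm (mns (u m) (u n)) < \<epsilon>"
    proof (intro exI allI impI)
      fix m n assume mn: "N \<le> m" "N \<le> n"
      have "2 / real (Suc m) \<le> 2 / real (Suc N)" "2 / real (Suc n) \<le> 2 / real (Suc N)"
        using mn by (auto intro!: divide_left_mono)
      then have "(nrm (mns (u m) (u n)))\<^sup>2 < \<epsilon>\<^sup>2" using diff[of m n] N by simp
      then show "nrm (mns (u m) (u n)) < \<epsilon>" by (rule power2_less_imp_less) (use e in simp)
    qed
  qed simp
  then obtain l where l [simp]: "l \<in> X" and lim: "(\<lambda>n. nrm (mns (u n) l)) \<longlonglongrightarrow> 0"
    using complete_seq by blast
  have re: "Re (ip l g) = Re (\<phi> g)" if g [simp]: "g \<in> X" for g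
  proof -
    have "0 \<le> 2 * t * (Re (ip l g) - Re (\<phi> g)) + t\<^sup>2 * (nrm g)\<^sup>2" for t
    proof -
      have "0 \<le> 1 / real (Suc n) + (2 * t * (Re (ip (u n) g) - Re (\<phi> g)) + t\<^sup>2 * (nrm g)\<^sup>2)" for n
      proof -
        have "J (hadd H (u n) (hscale H (complex_of_real t) g)) =
            J (u n) + (2 * t * (Re (ip (u n) g) - Re (\<phi> g)) + t\<^sup>2 * (nrm g)\<^sup>2)"
          by (simp add: J_def nrm_add_sq add scale nrm_scale power_mult_distrib algebra_simps)
        then show ?thesis using j_le[of "hadd H (u n) (hscale H (complex_of_real t) g)"] Ju[of n] by simp
      qed
      moreover have "(\<lambda>n. 1 / real (Suc n) + (2 * t * (Re (ip (u n) g) - Re (\<phi> g)) + t\<^sup>2 * (nrm g)\<^sup>2)) \<longlonglongrightarrow>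
           0 + (2 * t * (Re (ip l g) - Re (\<phi> g)) + t\<^sup>2 * (nrm g)\<^sup>2)"
        by (intro tendsto_intros inner_tendsto lim LIMSEQ_Suc[OF lim_1_over_n] u l g)
      ultimately show ?thesis using LIMSEQ_le_const by (smt (verit, best))
    qed
    from quadratic_nonneg_imp_zero[OF _ this] show ?thesis by simp
  qed
  have "ip l g = \<phi> g" if g: "g \<in> X" for g
    using re[OF g] re[OF scale_closed[OF g, of \<i>]] g by (simp add: scale complex_eq_iff)
  then show ?thesis using l by blast
qed

text \<open>Each vector \<open>b u\<close> of the dual space is represented by some \<open>T u\<close>, and the uniqueness of
  representing vectors makes \<open>T\<close> linear.\<close>

lemma bounded_sesquilinear_operator:
  assumes add2: "\<And>u v w. u \<in> X \<Longrightarrow> v \<in> X \<Longrightarrow> w \<in> X \<Longrightarrow> b u (hadd H v w) = b u v + b u w"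
    and scale2: "\<And>a u v. u \<in> X \<Longrightarrow> v \<in> X \<Longrightarrow> b u (hscale H a v) = a * b u v"
    and add1: "\<And>u v w. u \<in> X \<Longrightarrow> v \<in> X \<Longrightarrow> w \<in> X \<Longrightarrow> b (hadd H u v) w = b u w + b v w"
    and scale1: "\<And>a u v. u \<in> X \<Longrightarrow> v \<in> X \<Longrightarrow> b (hscale H a u) v = cnj a * b u v"
    and bound: "\<And>u v. u \<in> X \<Longrightarrow> v \<in> X \<Longrightarrow> cmod (b u v) \<le> K * nrm u * nrm v"
  shows "\<exists>T\<in>bounded_ops H. \<forall>u\<in>X. \<forall>v\<in>X. ip (T u) v = b u v"
proof -
  have "\<exists>w\<in>X. \<forall>v\<in>X. ip w v = b u v" if "u \<in> X" for u
    using that by (intro riesz_representation[where K = "K * nrm u"]) (auto simp: add2 scale2 bound)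
  then obtain T0 where T0: "\<And>u. u \<in> X \<Longrightarrow> T0 u \<in> X" "\<And>u v. u \<in> X \<Longrightarrow> v \<in> X \<Longrightarrow> ip (T0 u) v = b u v"
    by metis
  define T where "T = restrict T0 X"
  have T [simp]: "T u \<in> X" "v \<in> X \<Longrightarrow> ip (T u) v = b u v" if "u \<in> X" for u v
    using that T0 by (simp_all add: T_def)
  have "T \<in> bounded_ops H"
    unfolding bounded_ops_def
  proof (intro CollectI conjI ballI allI)
    show "T \<in> X \<rightarrow>\<^sub>E X" using T0 by (auto simp: T_def)
    show "T (hadd H u v) = hadd H (T u) (T v)" if "u \<in> X" "v \<in> X" for u v
      using that by (intro inner_ext_left) (simp_all add: add1)
    show "T (hscale H a u) = hscale H a (T u)" if "u \<in> X" for a u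
      using that by (intro inner_ext_left) (simp_all add: scale1)
    have "nrm (T u) \<le> K * nrm u" if u: "u \<in> X" for u
    proof (cases "nrm (T u) = 0")
      case True
      have "0 \<le> (K * nrm u) * nrm u" using bound[OF u u] norm_ge_zero order_trans by blast
      then have "0 \<le> K * nrm u" using nrm_nonneg[OF u] by (cases "nrm u = 0") (auto simp: zero_le_mult_iff)
      then show ?thesis using True by simp
    next
      case False
      have "(nrm (T u))\<^sup>2 = Re (b u (T u))" using u by (simp add: nrm_sq)
      also have "\<dots> \<le> K * nrm u * nrm (T u)" using bound[of u "T u"] u complex_Re_le_cmod[of "b u (T u)"] by simp
      finally have "nrm (T u) * nrm (T u) \<le> K * nrm u * nrm (T u)" by (simp add: power2_eq_square)
      moreover have "0 < nrm (T u)" using False u by (simp add: order_less_le)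
      ultimately show ?thesis by simp
    qed
    then show "\<exists>C. \<forall>u\<in>X. nrm (T u) \<le> C * nrm u" by blast
  qed
  then show ?thesis by (intro bexI[of _ T]) simp_all
qed

text \<open>A closed subspace is itself a Hilbert space; the vector \<open>v\<close> representing the restriction of
  \<open>ip w\<close> to it is the orthogonal projection of \<open>w\<close>.\<close>

lemma closed_subspace_projection:
  assumes V: "V \<subseteq> X" "hzero H \<in> V" "\<And>u v. u \<in> V \<Longrightarrow> v \<in> V \<Longrightarrow> hadd H u v \<in> V"
      "\<And>a u. u \<in> V \<Longrightarrow> hscale H a u \<in> V"
    and closed: "\<And>u l. \<lbrakk>\<And>n. u n \<in> V; l \<in> X; (\<lambda>n. nrm (mns (u n) l)) \<longlonglongrightarrow> 0\<rbrakk> \<Longrightarrow> l \<in> V"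
    and w: "w \<in> X"
  shows "\<exists>v\<in>V. \<forall>g\<in>V. ip v g = ip w g"
proof -
  define H' where "H' = H\<lparr>hcarrier := V\<rparr>"
  have VX [simp]: "u \<in> V \<Longrightarrow> u \<in> X" for u using V by auto
  have inn: "inner_space H'"
    by unfold_locales (use V in \<open>auto simp: H'_def add_assoc add_left_commute add_zero add_inverse scale_one scale_scale
      scale_add_right scale_add_left inner_nonneg inner_definite add_commute inner_commute[symmetric]\<close>)
  have [simp]: "hnorm H' = nrm" "hminus H' = mns" "hcarrier H' = V" "hinner H' = ip" "hadd H' = hadd H" "hscale H' = hscale H"
    by (auto simp: H'_def hnorm_def hminus_def fun_eq_iff)
  interpret H': complex_hilbert_space H'
  proof (rule complex_hilbert_spaceI[OF inn])
    fix u assume "inner_space.cauchy H' u"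
    then have u: "\<And>n. u n \<in> V" "cauchy u" by (auto simp: cauchy_def inner_space.cauchy_def[OF inn])
    obtain l where l: "l \<in> X" "(\<lambda>n. nrm (mns (u n) l)) \<longlonglongrightarrow> 0" using complete_seq[OF u(2)] by blast
    have "l \<in> V" by (rule closed[OF u(1) l])
    then show "\<exists>l\<in>hcarrier H'. (\<lambda>n. hnorm H' (hminus H' (u n) l)) \<longlonglongrightarrow> 0" using l by auto
  qed
  have "\<exists>v\<in>hcarrier H'. \<forall>g\<in>hcarrier H'. hinner H' v g = ip w g"
    using w by (intro H'.riesz_representation[where K = "nrm w"]) (auto simp: Cauchy_Schwarz)
  then show ?thesis by simp
qed

lemma closed_subspace_orthogonal:
  assumes "V \<subseteq> X" "hzero H \<in> V" "\<And>u v. u \<in> V \<Longrightarrow> v \<in> V \<Longrightarrow> hadd H u v \<in> V"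
      "\<And>a u. u \<in> V \<Longrightarrow> hscale H a u \<in> V"
    and "\<And>u l. \<lbrakk>\<And>n. u n \<in> V; l \<in> X; (\<lambda>n. nrm (mns (u n) l)) \<longlonglongrightarrow> 0\<rbrakk> \<Longrightarrow> l \<in> V"
    and trivial: "\<And>z. z \<in> X \<Longrightarrow> (\<And>g. g \<in> V \<Longrightarrow> ip z g = 0) \<Longrightarrow> z = hzero H"
  shows "V = X"
proof -
  have "w \<in> V" if w: "w \<in> X" for w
  proof -
    have "\<exists>v\<in>V. \<forall>g\<in>V. ip v g = ip w g" by (rule closed_subspace_projection[OF assms(1-5) w])
    then obtain v where v: "v \<in> V" "\<And>g. g \<in> V \<Longrightarrow> ip v g = ip w g" by blast
    have [simp]: "v \<in> X" "g \<in> V \<Longrightarrow> g \<in> X" for g using v(1) assms(1) by auto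
    have "mns w v = hzero H" using v w by (intro trivial) simp_all
    then show ?thesis using minus_eq_zero[of w v] v w by simp
  qed
  then show ?thesis using assms(1) by auto
qed

end

context inner_space
begin

text \<open>Removing from \<open>u\<close> its component along one vector lowers \<open>\<parallel>u\<parallel>\<^sup>2\<close> by the square of that
  coefficient and leaves the other coefficients unchanged.\<close>

lemma bessel:
  assumes "finite F" "F \<subseteq> X" "\<And>e e'. e \<in> F \<Longrightarrow> e' \<in> F \<Longrightarrow> ip e e' = (if e = e' then 1 else 0)" "u \<in> X"
  shows "(\<Sum>e\<in>F. (cmod (ip e u))\<^sup>2) \<le> (nrm u)\<^sup>2"
  using assms
proof (induction F arbitrary: u rule: finite_induct)
  case (insert e F)
  have e [simp]: "e \<in> X" and ee: "ip e e = 1" using insert.prems(1,2) by auto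
  have F: "f \<in> X" "ip f e = 0" if "f \<in> F" for f
    using insert.prems(1,2) insert.hyps that by auto
  define u' where "u' = mns u (hscale H (ip e u) e)"
  have u: "u \<in> X" and u': "u' \<in> X" using insert.prems(3) by (auto simp: u'_def)
  have "(\<Sum>f\<in>F. (cmod (ip f u))\<^sup>2) = (\<Sum>f\<in>F. (cmod (ip f u'))\<^sup>2)"
    using F u by (intro sum.cong) (auto simp: u'_def)
  also have "\<dots> \<le> (nrm u')\<^sup>2" using insert.prems u' by (intro insert.IH) auto
  also have "\<dots> = (nrm u)\<^sup>2 - (cmod (ip e u))\<^sup>2"
  proof -
    have "ip e u * ip u e = complex_of_real ((cmod (ip e u))\<^sup>2)"
      using inner_commute[of u e] complex_norm_square[of "ip e u"] u by simp
    then have "Re (ip e u * ip u e) = (cmod (ip e u))\<^sup>2" by (metis Re_complex_of_real)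
    moreover have "(nrm e)\<^sup>2 = 1" by (simp add: nrm_sq ee)
    ultimately show ?thesis using u by (simp add: u'_def nrm_minus_sq nrm_scale power_mult_distrib)
  qed
  finally show ?case using insert.hyps by simp
qed simp

end

lemma summable_on_product_of_squares:
  fixes c d :: "'a \<Rightarrow> complex"
  assumes "(\<lambda>e. (cmod (c e))\<^sup>2) summable_on B" "(\<lambda>e. (cmod (d e))\<^sup>2) summable_on B"
  shows "(\<lambda>e. cmod (cnj (c e) * d e)) summable_on B" "(\<lambda>e. cnj (c e) * d e) summable_on B"
proof -
  have "(\<lambda>e. (cmod (c e))\<^sup>2 + (cmod (d e))\<^sup>2) summable_on B" using assms by (rule summable_on_add)
  then show "(\<lambda>e. cmod (cnj (c e) * d e)) summable_on B"
  proof (rule summable_on_comparison_test)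
    fix e
    show "cmod (cnj (c e) * d e) \<le> (cmod (c e))\<^sup>2 + (cmod (d e))\<^sup>2"
      using sum_squares_bound[of "cmod (c e)" "cmod (d e)"] zero_le_power2[of "cmod (c e)"] zero_le_power2[of "cmod (d e)"]
      by (simp only: norm_mult complex_mod_cnj)
  qed simp
  then show "(\<lambda>e. cnj (c e) * d e) summable_on B" by (rule abs_summable_summable)
qed

locale hilbert_basis = complex_hilbert_space H for H :: "'v hspace" +
  fixes B :: "'v set"
  assumes basis: "orthonormal_basis H B"
begin

lemma B_closed [simp]: "e \<in> B \<Longrightarrow> e \<in> X" using basis by (auto simp: orthonormal_basis_def)

lemma B_orth: "e \<in> B \<Longrightarrow> e' \<in> B \<Longrightarrow> ip e e' = (if e = e' then 1 else 0)"
  using basis by (auto simp: orthonormal_basis_def)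

lemma basis_ext: assumes "u \<in> X" "v \<in> X" "\<And>e. e \<in> B \<Longrightarrow> ip e u = ip e v" shows "u = v"
proof -
  have "mns u v = hzero H" using basis assms unfolding orthonormal_basis_def by simp
  then show ?thesis using minus_eq_zero assms by blast
qed

lemma coeff_sq_summable: assumes "u \<in> X" shows "(\<lambda>e. (cmod (ip e u))\<^sup>2) summable_on B"
proof (rule nonneg_bdd_above_summable_on)
  show "bdd_above (sum (\<lambda>e. (cmod (ip e u))\<^sup>2) ` {F. F \<subseteq> B \<and> finite F})"
  proof (rule bdd_aboveI2)
    fix F assume "F \<in> {F. F \<subseteq> B \<and> finite F}"
    then show "(\<Sum>e\<in>F. (cmod (ip e u))\<^sup>2) \<le> (nrm u)\<^sup>2"
      using assms by (intro bessel) (auto simp: B_orth subset_iff)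
  qed
qed simp

text \<open>The vector represents the functional
  \<open>u \<mapsto> \<Sum>e. cnj (c e) * ip e u\<close>, which is bounded by the Cauchy-Schwarz inequality for sums and
  Bessel's inequality.\<close>

theorem riesz_fischer:
  assumes c: "(\<lambda>e. (cmod (c e))\<^sup>2) summable_on B"
  shows "\<exists>v\<in>X. (\<forall>e\<in>B. ip e v = c e) \<and> (\<forall>u\<in>X. ((\<lambda>e. cnj (c e) * ip e u) has_sum ip v u) B)"
proof -
  define \<phi> where "\<phi> u = (\<Sum>\<^sub>\<infinity>e\<in>B. cnj (c e) * ip e u)" for u
  define C where "C = (\<Sum>\<^sub>\<infinity>e\<in>B. (cmod (c e))\<^sup>2)"
  note sm = summable_on_product_of_squares[OF c coeff_sq_summable]
  have "\<exists>v\<in>X. \<forall>u\<in>X. ip v u = \<phi> u"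
  proof (rule riesz_representation)
    show "\<phi> (hadd H u v) = \<phi> u + \<phi> v" if "u \<in> X" "v \<in> X" for u v
    proof -
      have "\<phi> (hadd H u v) = (\<Sum>\<^sub>\<infinity>e\<in>B. cnj (c e) * ip e u + cnj (c e) * ip e v)"
        unfolding \<phi>_def using that by (intro infsum_cong) (simp add: distrib_left)
      then show ?thesis using that by (simp add: \<phi>_def infsum_add[OF sm(2) sm(2)])
    qed
    show "\<phi> (hscale H a u) = a * \<phi> u" if "u \<in> X" for a u
    proof -
      have "\<phi> (hscale H a u) = (\<Sum>\<^sub>\<infinity>e\<in>B. a * (cnj (c e) * ip e u))"
        unfolding \<phi>_def using that by (intro infsum_cong) simp
      then show ?thesis by (simp add: \<phi>_def infsum_cmult_right')
    qed
    show "cmod (\<phi> u) \<le> sqrt C * nrm u" if u: "u \<in> X" for u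
    proof -
      have "cmod (\<phi> u) \<le> (\<Sum>\<^sub>\<infinity>e\<in>B. cmod (cnj (c e) * ip e u))"
        unfolding \<phi>_def by (rule norm_infsum_bound) (rule sm(1)[OF u])
      also have "\<dots> \<le> sqrt C * nrm u"
      proof (rule infsum_le_finite_sums[OF sm(1)[OF u]])
        fix F assume F: "finite F" "F \<subseteq> B"
        have "(\<Sum>e\<in>F. cmod (cnj (c e) * ip e u)) = (\<Sum>e\<in>F. \<bar>cmod (c e)\<bar> * \<bar>cmod (ip e u)\<bar>)"
          by (simp add: norm_mult)
        also have "\<dots> \<le> L2_set (\<lambda>e. cmod (c e)) F * L2_set (\<lambda>e. cmod (ip e u)) F"
          by (rule L2_set_mult_ineq)
        also have "\<dots> \<le> sqrt C * nrm u"
        proof (intro mult_mono)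
          show "L2_set (\<lambda>e. cmod (c e)) F \<le> sqrt C"
            unfolding L2_set_def C_def by (intro real_sqrt_le_mono finite_sum_le_infsum c F) simp
          have "(\<Sum>e\<in>F. (cmod (ip e u))\<^sup>2) \<le> (nrm u)\<^sup>2"
            using F u by (intro bessel) (auto simp: B_orth subset_iff)
          then show "L2_set (\<lambda>e. cmod (ip e u)) F \<le> nrm u"
            unfolding L2_set_def using u by (simp add: real_le_lsqrt sum_nonneg)
          show "0 \<le> sqrt C" by (simp add: C_def infsum_nonneg)
        qed (simp add: L2_set_nonneg)
        finally show "(\<Sum>e\<in>F. cmod (cnj (c e) * ip e u)) \<le> sqrt C * nrm u" .
      qed
      finally show ?thesis .
    qed
  qed
  then obtain v where v: "v \<in> X" "\<And>u. u \<in> X \<Longrightarrow> ip v u = \<phi> u" by blast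
  have "ip e v = c e" if e: "e \<in> B" for e
  proof -
    have "\<phi> e = (\<Sum>\<^sub>\<infinity>e'\<in>{e}. cnj (c e') * ip e' e)"
      unfolding \<phi>_def using e by (intro infsum_cong_neutral) (auto simp: B_orth)
    then have "ip v e = cnj (c e)" using v e by (simp add: B_orth)
    then show ?thesis using inner_commute[of e v] v e by simp
  qed
  moreover have "((\<lambda>e. cnj (c e) * ip e u) has_sum ip v u) B" if "u \<in> X" for u
    using v sm(2)[OF that] that by (simp add: \<phi>_def has_sum_infsum)
  ultimately show ?thesis using v by blast
qed

text \<open>The vector which the Riesz-Fischer theorem assigns to the coefficients of \<open>u\<close> is \<open>u\<close>, because a
  basis separates vectors.\<close>

lemma parseval: assumes "u \<in> X" "w \<in> X" shows "((\<lambda>e. cnj (ip e u) * ip e w) has_sum ip u w) B"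
proof -
  obtain v where v: "v \<in> X" "\<forall>e\<in>B. ip e v = ip e u"
     "\<forall>w\<in>X. ((\<lambda>e. cnj (ip e u) * ip e w) has_sum ip v w) B"
    using riesz_fischer[OF coeff_sq_summable[OF assms(1)]] by blast
  then have "v = u" using assms by (intro basis_ext) auto
  then show ?thesis using v assms by blast
qed

lemma parseval_norm: assumes "u \<in> X" shows "((\<lambda>e. (cmod (ip e u))\<^sup>2) has_sum (nrm u)\<^sup>2) B"
proof -
  have "((\<lambda>e. complex_of_real ((cmod (ip e u))\<^sup>2)) has_sum complex_of_real ((nrm u)\<^sup>2)) B"
    using parseval[OF assms assms] by (simp only: complex_norm_square inner_self[OF assms] mult.commute)
  then show ?thesis using has_sum_Re by fastforce
qed

end

section \<open>Diagonal operators on an orthonormal basis\<close>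

lemma nn_integral_count_space_has_sum:
  fixes f :: "'a \<Rightarrow> real"
  assumes "(f has_sum s) A" "\<And>x. x \<in> A \<Longrightarrow> 0 \<le> f x"
  shows "(\<integral>\<^sup>+x. ennreal (f x) \<partial>count_space A) = ennreal s"
proof -
  have "f summable_on A" using assms(1) by (rule has_sum_imp_summable)
  then have "(\<lambda>x. norm (f x)) summable_on A"
    using assms(2) by (subst summable_on_cong[of A _ f]) auto
  then have ab: "Infinite_Set_Sum.abs_summable_on f A" using abs_summable_equivalent by blast
  then have "(\<integral>\<^sup>+x. ennreal (f x) \<partial>count_space A) = ennreal (infsetsum f A)"
    using assms(2) by (intro nn_integral_conv_infsetsum) auto
  also have "infsetsum f A = s" using infsetsum_infsum[OF ab] assms(1) infsumI by metis
  finally show ?thesis .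
qed

lemma integral_count_space_has_sum:
  fixes f :: "'a \<Rightarrow> 'b::{banach, second_countable_topology}"
  assumes "(\<lambda>x. norm (f x)) summable_on A" "(f has_sum s) A"
  shows "integral\<^sup>L (count_space A) f = s"
proof -
  have "Infinite_Set_Sum.abs_summable_on f A" using assms(1) abs_summable_equivalent by blast
  from infsetsum_infsum[OF this] show ?thesis using assms(2) by (simp add: infsetsum_def infsumI)
qed

lemma integrable_count_space_iff:
  fixes f :: "'a \<Rightarrow> 'b::{banach, second_countable_topology}"
  shows "integrable (count_space A) f \<longleftrightarrow> (\<lambda>x. norm (f x)) summable_on A"
  using abs_summable_equivalent[of f A] by (simp add: abs_summable_on_def)

lemma finite_of_summable_bounded_below:
  fixes f :: "'a \<Rightarrow> real"
  assumes "f summable_on A" "\<And>x. x \<in> A \<Longrightarrow> 0 \<le> f x" "c > 0"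
  shows "finite {x\<in>A. c \<le> f x}"
proof (rule ccontr)
  assume inf: "infinite {x\<in>A. c \<le> f x}"
  obtain N :: nat where N: "infsum f A / c < real N" using reals_Archimedean2 by blast
  obtain F where F: "F \<subseteq> {x\<in>A. c \<le> f x}" "card F = N" "finite F"
    using infinite_arbitrarily_large[OF inf] by blast
  have "real N * c = (\<Sum>x\<in>F. c)" using F by simp
  also have "\<dots> \<le> sum f F" using F by (intro sum_mono) auto
  also have "\<dots> \<le> infsum f A" using F assms by (intro finite_sum_le_infsum) auto
  finally show False using N assms(3) by (simp add: field_simps)
qed

context hilbert_basis
begin

lemma truncation: assumes u: "u \<in> X" and F: "finite F" "F \<subseteq> B"
  shows "\<exists>v\<in>X. \<forall>e\<in>B. ip e v = (if e \<in> F then ip e u else 0)"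
proof -
  have "(\<lambda>e. (cmod (if e \<in> F then ip e u else 0))\<^sup>2) summable_on F"
    using F by (intro summable_on_finite)
  then have "(\<lambda>e. (cmod (if e \<in> F then ip e u else 0))\<^sup>2) summable_on B"
    by (rule summable_on_cong_neutral[THEN iffD1, rotated -1]) (use F in auto)
  from riesz_fischer[OF this] show ?thesis by blast
qed

lemma norm_le_of_coeff_le:
  assumes "v \<in> X" "u \<in> X" "0 \<le> K" "\<And>e. e \<in> B \<Longrightarrow> cmod (ip e v) \<le> K * cmod (ip e u)"
  shows "nrm v \<le> K * nrm u"
proof -
  have 1: "((\<lambda>e. K\<^sup>2 * (cmod (ip e u))\<^sup>2) has_sum K\<^sup>2 * (nrm u)\<^sup>2) B"
    using parseval_norm[OF assms(2)] by (rule has_sum_cmult_right)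
  have "(nrm v)\<^sup>2 \<le> K\<^sup>2 * (nrm u)\<^sup>2"
  proof (rule has_sum_mono[OF parseval_norm[OF assms(1)] 1])
    fix e assume "e \<in> B"
    then have "(cmod (ip e v))\<^sup>2 \<le> (K * cmod (ip e u))\<^sup>2" using assms(4) by (intro power_mono) auto
    then show "(cmod (ip e v))\<^sup>2 \<le> K\<^sup>2 * (cmod (ip e u))\<^sup>2" by (simp add: power_mult_distrib)
  qed
  then have "(nrm v)\<^sup>2 \<le> (K * nrm u)\<^sup>2" by (simp add: power_mult_distrib)
  then show ?thesis by (rule power2_le_imp_le) (use assms in simp)
qed

text \<open>The operator multiplying the coefficient at \<open>e\<close> by \<open>m e\<close>.  For bounded \<open>m\<close> the chosen vector exists
  by the Riesz-Fischer theorem and is unique.\<close>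

definition hdiag :: "('v \<Rightarrow> complex) \<Rightarrow> 'v \<Rightarrow> 'v"
  where "hdiag m = (\<lambda>u\<in>X. SOME v. v \<in> X \<and> (\<forall>e\<in>B. ip e v = m e * ip e u))"

context
  fixes m :: "'v \<Rightarrow> complex" and K :: real
  assumes m: "\<And>e. e \<in> B \<Longrightarrow> cmod (m e) \<le> K" and K: "0 \<le> K"
begin

lemma hdiag_exists: assumes u: "u \<in> X" shows "\<exists>v. v \<in> X \<and> (\<forall>e\<in>B. ip e v = m e * ip e u)"
proof -
  have "(\<lambda>e. K\<^sup>2 * (cmod (ip e u))\<^sup>2) summable_on B"
    using coeff_sq_summable[OF u] by (rule summable_on_cmult_right)
  then have "(\<lambda>e. (cmod (m e * ip e u))\<^sup>2) summable_on B"
  proof (rule summable_on_comparison_test)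
    fix e assume "e \<in> B"
    then have "(cmod (m e))\<^sup>2 \<le> K\<^sup>2" using m by (intro power_mono) auto
    then show "(cmod (m e * ip e u))\<^sup>2 \<le> K\<^sup>2 * (cmod (ip e u))\<^sup>2"
      by (simp add: norm_mult power_mult_distrib mult_right_mono)
  qed simp
  from riesz_fischer[OF this] show ?thesis by blast
qed

lemma hdiag_closed: "u \<in> X \<Longrightarrow> hdiag m u \<in> X"
  and hdiag_coeff: "u \<in> X \<Longrightarrow> e \<in> B \<Longrightarrow> ip e (hdiag m u) = m e * ip e u"
  using someI_ex[OF hdiag_exists] by (auto simp: hdiag_def)

lemma hdiag_bounded_op: "hdiag m \<in> bounded_ops H"
  unfolding bounded_ops_def
proof (intro CollectI conjI ballI allI exI)
  show "hdiag m \<in> X \<rightarrow>\<^sub>E X" using hdiag_closed by (auto simp: hdiag_def)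
  show "hdiag m (hadd H u v) = hadd H (hdiag m u) (hdiag m v)" if "u \<in> X" "v \<in> X" for u v
    using that by (intro basis_ext) (simp_all add: hdiag_closed hdiag_coeff distrib_left)
  show "hdiag m (hscale H a u) = hscale H a (hdiag m u)" if "u \<in> X" for a u
    using that by (intro basis_ext) (simp_all add: hdiag_closed hdiag_coeff)
  show "nrm (hdiag m u) \<le> K * nrm u" if "u \<in> X" for u
    using that by (intro norm_le_of_coeff_le)
      (simp_all add: hdiag_closed hdiag_coeff norm_mult K m mult_right_mono)
qed

lemma hdiag_inner: assumes "u \<in> X" "v \<in> X"
  shows "((\<lambda>e. cnj (ip e u) * m e * ip e v) has_sum ip u (hdiag m v)) B"
proof -
  have "((\<lambda>e. cnj (ip e u) * ip e (hdiag m v)) has_sum ip u (hdiag m v)) B"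
    using assms by (intro parseval hdiag_closed)
  then show ?thesis
    by (rule has_sum_cong[THEN iffD1, rotated]) (simp add: hdiag_coeff assms mult.assoc)
qed

end

text \<open>An orthonormal expansion over finitely many indices with bounded coefficients can be
  approximated by a finite net, one index at a time.\<close>

lemma finite_net:
  assumes "finite F" "F \<subseteq> B" "\<epsilon> > 0"
  shows "\<exists>A. finite A \<and> A \<subseteq> X \<and>
    (\<forall>u\<in>X. nrm u \<le> K \<longrightarrow> (\<forall>e\<in>B - F. ip e u = 0) \<longrightarrow> (\<exists>a\<in>A. nrm (mns u a) < \<epsilon>))"
  using assms
proof (induction F arbitrary: \<epsilon> rule: finite_induct)
  case empty
  have "nrm (mns u (hzero H)) < \<epsilon>" if "u \<in> X" "\<forall>e\<in>B. ip e u = 0" for u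
  proof -
    have "u = hzero H" using that by (intro basis_ext) simp_all
    then have "mns u (hzero H) = hzero H" by (intro inner_ext) simp_all
    then show ?thesis using empty by simp
  qed
  then show ?case by (intro exI[of _ "{hzero H}"]) simp
next
  case (insert e F)
  have e [simp]: "e \<in> B" "e \<in> X" using insert.prems by auto
  have F: "F \<subseteq> B" and eF: "e \<notin> F" using insert by auto
  obtain A where A: "finite A" "A \<subseteq> X"
    "\<forall>u\<in>X. nrm u \<le> K \<longrightarrow> (\<forall>e\<in>B - F. ip e u = 0) \<longrightarrow> (\<exists>a\<in>A. nrm (mns u a) < \<epsilon> / 2)"
    using insert.IH[OF F, of "\<epsilon> / 2"] insert.prems by auto
  have "compact (cball (0::complex) K)" by simp
  then obtain Z where Z: "finite Z" "cball (0::complex) K \<subseteq> (\<Union>z\<in>Z. ball z (\<epsilon> / 2))"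
    unfolding compact_eq_totally_bounded using insert.prems(2) half_gt_zero by blast
  let ?A = "(\<lambda>(a, z). hadd H a (hscale H z e)) ` (A \<times> Z)"
  have "\<exists>a\<in>?A. nrm (mns u a) < \<epsilon>"
    if u [simp]: "u \<in> X" and K: "nrm u \<le> K" and 0: "\<forall>e'\<in>B - insert e F. ip e' u = 0" for u
  proof -
    have ne: "nrm e = 1" using B_orth[of e e] by (simp add: hnorm_def)
    define u' where "u' = mns u (hscale H (ip e u) e)"
    have u' [simp]: "u' \<in> X" by (simp add: u'_def)
    have c: "ip e' u' = (if e' = e then 0 else ip e' u)" if "e' \<in> B" for e'
      using that by (simp add: u'_def B_orth)
    have "nrm u' \<le> 1 * nrm u" by (intro norm_le_of_coeff_le) (auto simp: c)
    then have "nrm u' \<le> K" using K by simp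
    moreover have "\<forall>e'\<in>B - F. ip e' u' = 0" using 0 by (auto simp: c)
    ultimately obtain a where a: "a \<in> A" "nrm (mns u' a) < \<epsilon> / 2" using A(3) by auto
    have aX [simp]: "a \<in> X" using a A by auto
    have "cmod (ip e u) \<le> K" using Cauchy_Schwarz[of e u] K ne by simp
    then obtain z where z: "z \<in> Z" "dist z (ip e u) < \<epsilon> / 2" using Z(2) by (force simp: subset_iff)
    have "mns u (hadd H a (hscale H z e)) = hadd H (mns u' a) (hscale H (ip e u - z) e)"
      by (intro inner_ext) (simp_all add: u'_def algebra_simps)
    then have "nrm (mns u (hadd H a (hscale H z e))) \<le> nrm (mns u' a) + cmod (ip e u - z)"
      using nrm_triangle[of "mns u' a" "hscale H (ip e u - z) e"] ne by (simp add: nrm_scale)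
    also have "\<dots> < \<epsilon>" using a z by (simp add: dist_norm norm_minus_commute)
    finally show ?thesis using a z by force
  qed
  moreover have "finite ?A" "?A \<subseteq> X" using A Z by (auto simp: subset_iff)
  ultimately show ?case by (intro exI[of _ ?A]) blast
qed

text \<open>Up to \<open>\<epsilon> / 2\<close> the image of the unit ball consists of bounded vectors supported on the finitely
  many \<open>e\<close> at which \<open>m\<close> is not small, and these have a finite net.\<close>

lemma compact_hdiag:
  assumes m: "\<And>e. e \<in> B \<Longrightarrow> cmod (m e) \<le> K" and K: "0 \<le> K"
    and small: "\<And>\<epsilon>. \<epsilon> > 0 \<Longrightarrow> finite {e\<in>B. \<epsilon> \<le> cmod (m e)}"
  shows "compact_op H (hdiag m)"
proof -
  note [simp] = hdiag_closed[OF m K] hdiag_coeff[OF m K]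
  let ?S = "hdiag m ` {u\<in>X. nrm u \<le> 1}"
  have net: "\<exists>A. finite A \<and> A \<subseteq> X \<and> ?S \<subseteq> (\<Union>a\<in>A. mball a \<epsilon>)" if \<epsilon>: "\<epsilon> > 0" for \<epsilon>
  proof -
    define F where "F = {e\<in>B. \<epsilon> / 2 \<le> cmod (m e)}"
    have F: "finite F" "F \<subseteq> B" using small[of "\<epsilon>/2"] \<epsilon> by (auto simp: F_def)
    obtain A where A: "finite A" "A \<subseteq> X"
      "\<forall>u\<in>X. nrm u \<le> K \<longrightarrow> (\<forall>e\<in>B - F. ip e u = 0) \<longrightarrow> (\<exists>a\<in>A. nrm (mns u a) < \<epsilon> / 2)"
      using finite_net[OF F, of "\<epsilon> / 2" K] \<epsilon> by auto
    have "hdiag m u \<in> (\<Union>a\<in>A. mball a \<epsilon>)" if u [simp]: "u \<in> X" and u1: "nrm u \<le> 1" for u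
    proof -
      obtain v where v [simp]: "v \<in> X" and vc: "\<And>e. e \<in> B \<Longrightarrow> ip e v = (if e \<in> F then ip e (hdiag m u) else 0)"
        using truncation[OF _ F, of "hdiag m u"] by auto
      have "nrm v \<le> K * nrm u"
        using m K by (intro norm_le_of_coeff_le) (auto simp: vc norm_mult mult_right_mono)
      then have "nrm v \<le> K" using K u1 mult_left_le[of "nrm u" K] by simp
      then obtain a where a: "a \<in> A" "nrm (mns v a) < \<epsilon> / 2" using A(3) vc by auto
      have aX [simp]: "a \<in> X" using a A by auto
      have "nrm (mns (hdiag m u) v) \<le> \<epsilon> / 2 * nrm u"
      proof (intro norm_le_of_coeff_le)
        fix e assume e: "e \<in> B"
        show "cmod (ip e (mns (hdiag m u) v)) \<le> \<epsilon> / 2 * cmod (ip e u)"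
        proof (cases "e \<in> F")
          case False
          then have "cmod (m e) \<le> \<epsilon> / 2" using e by (simp add: F_def)
          then have "cmod (m e) * cmod (ip e u) \<le> \<epsilon> / 2 * cmod (ip e u)" by (rule mult_right_mono) simp
          then show ?thesis using e False by (simp add: vc norm_mult)
        qed (use e \<epsilon> in \<open>simp add: vc\<close>)
      qed (use \<epsilon> in simp_all)
      also have "\<dots> \<le> \<epsilon> / 2" using u1 \<epsilon> by simp
      finally have "nrm (mns (hdiag m u) a) < \<epsilon>"
        using nrm_minus_triangle[of "hdiag m u" v a] a by simp
      then have "hdiag m u \<in> mball a \<epsilon>" by (simp add: hdist_def nrm_minus_commute[of a])
      then show ?thesis using a by blast
    qed
    then show ?thesis using A(1,2) by blast
  qed
  have "mtotally_bounded ?S"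
    unfolding mtotally_bounded_def
  proof (intro allI impI)
    fix \<epsilon> :: real assume \<epsilon>: "\<epsilon> > 0"
    obtain A where A: "finite A" "A \<subseteq> X" "?S \<subseteq> (\<Union>a\<in>A. mball a (\<epsilon>/2))" using net[of "\<epsilon>/2"] \<epsilon> by auto
    \<comment> \<open>Total boundedness asks for net points in the image itself, so every ball of the net that meets it is moved to one of its points.\<close>
    define pick where "pick a = (SOME s. s \<in> ?S \<and> s \<in> mball a (\<epsilon>/2))" for a
    define A' where "A' = {a\<in>A. \<exists>s. s \<in> ?S \<and> s \<in> mball a (\<epsilon>/2)}"
    have pick: "pick a \<in> ?S" "pick a \<in> mball a (\<epsilon>/2)" if "a \<in> A'" for a
      using that someI_ex[of "\<lambda>s. s \<in> ?S \<and> s \<in> mball a (\<epsilon>/2)"] by (auto simp: A'_def pick_def)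
    have "s \<in> (\<Union>x\<in>pick ` A'. mball x \<epsilon>)" if s: "s \<in> ?S" for s
    proof -
      obtain a where a: "a \<in> A" "s \<in> mball a (\<epsilon>/2)" using A(3) s by blast
      then have a': "a \<in> A'" using s by (auto simp: A'_def)
      have "pick a \<in> X" "s \<in> X" "a \<in> X" using pick[OF a'] a by auto
      moreover have "hdist H (pick a) s < \<epsilon>"
        using pick(2)[OF a'] a(2) triangle[of "pick a" a s] commute[of "pick a" a] calculation by auto
      ultimately show ?thesis using a' by auto
    qed
    then have "?S \<subseteq> (\<Union>x\<in>pick ` A'. mball x \<epsilon>)" by blast
    moreover have "pick ` A' \<subseteq> ?S" using pick(1) by blast
    moreover have "finite (pick ` A')" using A(1) by (simp add: A'_def)
    ultimately show "\<exists>K. finite K \<and> K \<subseteq> ?S \<and> ?S \<subseteq> (\<Union>x\<in>K. mball x \<epsilon>)" by blast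
  qed
  then have "compactin mtopology (mtopology closure_of ?S)"
    by (simp only: mtotally_bounded_eq_compact_closure_of[OF complete])
  then show ?thesis
    unfolding compact_op_def htopology_eq by (intro conjI hdiag_bounded_op[OF m K])
qed

end

section \<open>Spectral theory of diagonal operators\<close>

text \<open>The equivalence fixes the domain as well as the action of \<open>D\<close>: by the Riesz-Fischer theorem a
  vector belongs to the domain if and only if its coefficients multiplied by \<open>lam\<close> are square
  summable.\<close>

locale diagonal_operator = hilbert_basis H B for H :: "'v hspace" and B +
  fixes lam :: "'v \<Rightarrow> real" and D :: "'v \<rightharpoonup> 'v"
  assumes lam_nonneg: "e \<in> B \<Longrightarrow> 0 \<le> lam e"
    and D_iff: "D u = Some w \<longleftrightarrow>
      u \<in> X \<and> w \<in> X \<and> (\<forall>e\<in>B. ip e w = complex_of_real (lam e) * ip e u)"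
begin

lemma D_dom: assumes "u \<in> dom D"
  shows "u \<in> X" "the (D u) \<in> X" "e \<in> B \<Longrightarrow> ip e (the (D u)) = complex_of_real (lam e) * ip e u"
    "D u = Some (the (D u))"
proof -
  show 1: "D u = Some (the (D u))" using assms by auto
  show "u \<in> X" "the (D u) \<in> X" "e \<in> B \<Longrightarrow> ip e (the (D u)) = complex_of_real (lam e) * ip e u"
    using 1[unfolded D_iff] by auto
qed

lemma dom_D_iff: "u \<in> dom D \<longleftrightarrow> u \<in> X \<and> (\<lambda>e. (lam e)\<^sup>2 * (cmod (ip e u))\<^sup>2) summable_on B"
proof
  assume u: "u \<in> dom D"
  have "(\<lambda>e. (cmod (ip e (the (D u))))\<^sup>2) summable_on B" using D_dom(2)[OF u] by (rule coeff_sq_summable)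
  then have "(\<lambda>e. (lam e)\<^sup>2 * (cmod (ip e u))\<^sup>2) summable_on B"
    by (rule summable_on_cong[THEN iffD1, rotated]) (simp add: D_dom(3)[OF u] norm_mult power_mult_distrib)
  then show "u \<in> X \<and> (\<lambda>e. (lam e)\<^sup>2 * (cmod (ip e u))\<^sup>2) summable_on B" using D_dom(1)[OF u] by blast
next
  assume u: "u \<in> X \<and> (\<lambda>e. (lam e)\<^sup>2 * (cmod (ip e u))\<^sup>2) summable_on B"
  then have "(\<lambda>e. (cmod (complex_of_real (lam e) * ip e u))\<^sup>2) summable_on B"
    by (simp add: norm_mult power_mult_distrib)
  from riesz_fischer[OF this] obtain w where "w \<in> X" "\<forall>e\<in>B. ip e w = complex_of_real (lam e) * ip e u" by blast
  then show "u \<in> dom D" using u D_iff[of u w] by blast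
qed

lemma finite_support_dom: assumes "u \<in> X" "finite F" "F \<subseteq> B" "\<And>e. e \<in> B - F \<Longrightarrow> ip e u = 0"
  shows "u \<in> dom D"
proof -
  have "(\<lambda>e. (lam e)\<^sup>2 * (cmod (ip e u))\<^sup>2) summable_on F" using assms(2) by (rule summable_on_finite)
  then have "(\<lambda>e. (lam e)\<^sup>2 * (cmod (ip e u))\<^sup>2) summable_on B"
    by (rule summable_on_cong_neutral[THEN iffD1, rotated -1]) (use assms in auto)
  then show ?thesis using assms(1) dom_D_iff by blast
qed

lemma linear_D: "linear_operator H D"
  unfolding linear_operator_def
proof (intro conjI ballI allI)
  show "dom D \<subseteq> X" using D_dom(1) by blast
  show "ran D \<subseteq> X" by (auto simp: ran_def D_iff)
  show "hzero H \<in> dom D" by (rule finite_support_dom[of _ "{}"]) simp_all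
  show "D (hadd H u v) = Some (hadd H (the (D u)) (the (D v)))" if "u \<in> dom D" "v \<in> dom D" for u v
    unfolding D_iff using D_dom[OF that(1)] D_dom[OF that(2)] by (simp add: distrib_left)
  show "D (hscale H a u) = Some (hscale H a (the (D u)))" if "u \<in> dom D" for a u
    unfolding D_iff using D_dom[OF that] by simp
qed

lemma dense_D: "densely_defined H D"
proof -
  have "\<exists>v\<in>dom D. v \<in> mball u r" if u [simp]: "u \<in> X" and r: "r > 0" for u r
  proof -
    let ?f = "\<lambda>e. (cmod (ip e u))\<^sup>2"
    have hs: "(?f has_sum (nrm u)\<^sup>2) B" by (rule parseval_norm) simp
    have "eventually (\<lambda>F. dist (sum ?f F) ((nrm u)\<^sup>2) < r\<^sup>2) (finite_subsets_at_top B)"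
      using hs r unfolding has_sum_def tendsto_iff by simp
    then obtain F where F: "finite F" "F \<subseteq> B" "dist (sum ?f F) ((nrm u)\<^sup>2) < r\<^sup>2"
      unfolding eventually_finite_subsets_at_top by blast
    obtain v where v [simp]: "v \<in> X" and vc: "\<And>e. e \<in> B \<Longrightarrow> ip e v = (if e \<in> F then ip e u else 0)"
      using truncation[OF u F(1,2)] by blast
    have "(?f has_sum (nrm u)\<^sup>2 - sum ?f F) (B - F)"
      using hs F by (intro has_sum_Diff has_sum_finite) auto
    moreover have "((\<lambda>e. (cmod (ip e (mns u v)))\<^sup>2) has_sum (nrm (mns u v))\<^sup>2) (B - F)"
      by (rule has_sum_cong_neutral[THEN iffD1, OF _ _ _ parseval_norm]) (use F vc in auto)
    moreover have "((\<lambda>e. (cmod (ip e (mns u v)))\<^sup>2) has_sum (nrm u)\<^sup>2 - sum ?f F) (B - F)"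
      by (rule has_sum_cong[THEN iffD1, OF _ calculation(1)]) (use vc in simp)
    ultimately have "(nrm (mns u v))\<^sup>2 = (nrm u)\<^sup>2 - sum ?f F" using has_sum_unique by blast
    then have "(nrm (mns u v))\<^sup>2 < r\<^sup>2" using F(3) by (simp add: dist_real_def)
    then have "nrm (mns u v) < r" by (rule power2_less_imp_less) (use r in simp)
    moreover have "v \<in> dom D" by (rule finite_support_dom[OF _ F(1,2)]) (use vc in auto)
    ultimately show ?thesis by (auto simp: hdist_def)
  qed
  then have "mtopology closure_of dom D = X" unfolding metric_closure_of by blast
  then show ?thesis by (simp add: densely_defined_def htopology_eq)
qed

lemma basis_dom: assumes "e \<in> B" shows "D e = Some (hscale H (complex_of_real (lam e)) e)"
  unfolding D_iff using assms by (auto simp: B_orth)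

text \<open>Testing against the basis vectors, which belong to the domain, determines the coefficients of
  \<open>w\<close>; the converse is Parseval's identity.\<close>

lemma adjoint_represents:
  assumes v: "v \<in> X"
  shows "w \<in> X \<and> (\<forall>u\<in>dom D. ip v (the (D u)) = ip w u) \<longleftrightarrow> D v = Some w"
proof
  assume w: "w \<in> X \<and> (\<forall>u\<in>dom D. ip v (the (D u)) = ip w u)"
  have "ip e w = complex_of_real (lam e) * ip e v" if e: "e \<in> B" for e
  proof -
    have "complex_of_real (lam e) * ip v e = ip w e"
      using w basis_dom[OF e] e v by (auto dest!: bspec[of _ _ e])
    then have "cnj (complex_of_real (lam e) * ip v e) = cnj (ip w e)" by simp
    then show ?thesis using inner_commute[of e w] inner_commute[of e v] e v w by simp
  qed
  then show "D v = Some w" using w v by (simp add: D_iff)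
next
  assume D: "D v = Some w"
  then have w: "w \<in> X" "\<forall>e\<in>B. ip e w = complex_of_real (lam e) * ip e v" by (auto simp: D_iff)
  have "ip v (the (D u)) = ip w u" if u: "u \<in> dom D" for u
  proof -
    have "((\<lambda>e. cnj (ip e v) * ip e (the (D u))) has_sum ip v (the (D u))) B"
      using D_dom(2)[OF u] v by (intro parseval)
    then have "((\<lambda>e. cnj (ip e w) * ip e u) has_sum ip v (the (D u))) B"
      by (rule has_sum_cong[THEN iffD1, rotated]) (use w D_dom(3)[OF u] in simp)
    moreover have "((\<lambda>e. cnj (ip e w) * ip e u) has_sum ip w u) B"
      using w D_dom(1)[OF u] by (intro parseval)
    ultimately show ?thesis by (rule has_sum_unique)
  qed
  then show "w \<in> X \<and> (\<forall>u\<in>dom D. ip v (the (D u)) = ip w u)" using w by blast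
qed

lemma self_adjoint_D: "self_adjoint H D"
proof -
  have "adjoint_operator H D v = D v" for v
  proof (cases "v \<in> X")
    case True
    show ?thesis
      unfolding adjoint_operator_def Let_def adjoint_represents[OF True] using True
      by (cases "D v") auto
  next
    case False
    then have "D v = None" using D_iff[of v] by (cases "D v") auto
    then show ?thesis using False by (simp add: adjoint_operator_def)
  qed
  then show ?thesis using linear_D dense_D by (auto simp: self_adjoint_def)
qed

lemma resolvent_D:
  defines "R \<equiv> hdiag (\<lambda>e. complex_of_real (1 / (1 + lam e)))"
  shows "is_resolvent H D (- 1) R"
proof -
  have m: "cmod (complex_of_real (1 / (1 + lam e))) \<le> 1" if "e \<in> B" for e
    using lam_nonneg[OF that] by (simp add: norm_divide del: of_real_add)
  have ne: "1 + complex_of_real (lam e) \<noteq> 0" if "e \<in> B" for e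
    using lam_nonneg[OF that] by (metis of_real_1 of_real_add of_real_eq_0_iff add_pos_nonneg less_irrefl zero_less_one)
  have R: "R u \<in> X" "e \<in> B \<Longrightarrow> ip e (R u) = ip e u / (1 + complex_of_real (lam e))" if "u \<in> X" for u e
    using hdiag_closed[of "\<lambda>e. complex_of_real (1 / (1 + lam e))" 1, OF m _ that]
      hdiag_coeff[of "\<lambda>e. complex_of_real (1 / (1 + lam e))" 1, OF m _ that] by (auto simp: R_def)
  have DR: "D (R u) = Some (mns u (R u))" if "u \<in> X" for u
    unfolding D_iff using that R[OF that] ne by (simp add: field_simps)
  show ?thesis
    unfolding is_resolvent_def
  proof (intro conjI ballI)
    show "R \<in> bounded_ops H" unfolding R_def by (rule hdiag_bounded_op[of _ 1, OF m]) simp_all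
    fix u assume u [simp]: "u \<in> X"
    show "R u \<in> dom D" using DR[OF u] by auto
    show "mns (the (D (R u))) (hscale H (- 1) (R u)) = u"
      using R[OF u] by (intro inner_ext) (simp_all add: DR[OF u])
  next
    fix u assume u: "u \<in> dom D"
    note d = D_dom[OF u]
    define v where "v = mns (the (D u)) (hscale H (- 1) u)"
    have v: "v \<in> X" using d by (simp add: v_def)
    have vc: "ip e v = (1 + complex_of_real (lam e)) * ip e u" if "e \<in> B" for e
      using d that by (simp add: v_def distrib_right)
    show "R v = u"
      using v d(1) ne by (intro basis_ext) (simp_all add: R vc)
  qed
qed

end

text \<open>Summability of \<open>exp (- t \<lambda>)\<close> forces the eigenvalues to tend to infinity, hence a compact
  resolvent.\<close>

locale exp_summable_operator = diagonal_operator +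
  fixes t :: real
  assumes t_pos: "t > 0" and exp_summable: "(\<lambda>e. exp (- t * lam e)) summable_on B"
begin

lemma compact_resolvent_D: "compact_resolvent H D"
proof -
  have "compact_op H (hdiag (\<lambda>e. complex_of_real (1 / (1 + lam e))))"
  proof (rule compact_hdiag[of _ 1])
    show "cmod (complex_of_real (1 / (1 + lam e))) \<le> 1" if "e \<in> B" for e
      using lam_nonneg[OF that] by (simp add: norm_divide del: of_real_add)
    show "finite {e \<in> B. \<epsilon> \<le> cmod (complex_of_real (1 / (1 + lam e)))}" if \<epsilon>: "\<epsilon> > 0" for \<epsilon>
    proof (rule finite_subset)
      show "finite {e\<in>B. exp (- t * (1 / \<epsilon>)) \<le> exp (- t * lam e)}"
        by (rule finite_of_summable_bounded_below[OF exp_summable]) simp_all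
      show "{e \<in> B. \<epsilon> \<le> cmod (complex_of_real (1 / (1 + lam e)))} \<subseteq> {e\<in>B. exp (- t * (1 / \<epsilon>)) \<le> exp (- t * lam e)}"
      proof
        fix e assume "e \<in> {e \<in> B. \<epsilon> \<le> cmod (complex_of_real (1 / (1 + lam e)))}"
        then have e: "e \<in> B" "\<epsilon> \<le> cmod (complex_of_real (1 / (1 + lam e)))" by blast+
        have l: "0 \<le> lam e" using lam_nonneg e by blast
        then have "\<epsilon> \<le> 1 / (1 + lam e)" using e(2) by (simp add: norm_divide del: of_real_add)
        then have "lam e \<le> 1 / \<epsilon>" using l \<epsilon> by (simp add: field_simps)
        then have "t * lam e \<le> t * (1 / \<epsilon>)" using t_pos by (intro mult_left_mono) simp_all
        then show "e \<in> {e\<in>B. exp (- t * (1 / \<epsilon>)) \<le> exp (- t * lam e)}" using e by simp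
      qed
    qed
  qed simp
  then show ?thesis unfolding compact_resolvent_def using resolvent_D by blast
qed

end

context diagonal_operator
begin

definition proj :: "real set \<Rightarrow> 'v \<Rightarrow> 'v"
  where "proj S = hdiag (\<lambda>e. indicator S (lam e))"

text \<open>The image under \<open>lam\<close> of the measure with mass \<open>(cmod (ip e u))\<^sup>2\<close> at \<open>e\<close>: the spectral measure of
  the vector \<open>u\<close>.\<close>

definition coeff_measure :: "'v \<Rightarrow> real measure"
  where "coeff_measure u = distr (density (count_space B) (\<lambda>e. (cmod (ip e u))\<^sup>2)) borel lam"

lemma indicator_le_1: "cmod (indicator S (lam e)) \<le> 1" by (simp add: indicator_def)

lemmas proj_closed = hdiag_closed[of "\<lambda>e. indicator S (lam e)" 1 for S, OF indicator_le_1 zero_le_one, folded proj_def]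
lemmas proj_coeff = hdiag_coeff[of "\<lambda>e. indicator S (lam e)" 1 for S, OF indicator_le_1 zero_le_one, folded proj_def]
lemmas proj_bounded_op = hdiag_bounded_op[of "\<lambda>e. indicator S (lam e)" 1 for S, OF indicator_le_1 zero_le_one, folded proj_def]

lemma sets_coeff_measure [simp, measurable_cong]: "sets (coeff_measure u) = sets borel"
  and space_coeff_measure [simp]: "space (coeff_measure u) = UNIV"
  by (simp_all add: coeff_measure_def)

lemma proj_inner: assumes "u \<in> X"
  shows "((\<lambda>e. (cmod (ip e u))\<^sup>2 * indicator S (lam e)) has_sum Re (ip u (proj S u))) B"
proof -
  have "((\<lambda>e. cnj (ip e u) * indicator S (lam e) * ip e u) has_sum ip u (proj S u)) B"
    unfolding proj_def by (rule hdiag_inner[of _ 1]) (simp_all add: indicator_def assms)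
  from has_sum_Re[OF this] show ?thesis
    by (rule has_sum_cong[THEN iffD1, rotated])
       (auto simp: indicator_def cmod_power2 power2_eq_square[of "Re _"] power2_eq_square[of "Im _"])
qed

lemma emeasure_coeff_measure: assumes u: "u \<in> X" and S: "S \<in> sets borel"
  shows "emeasure (coeff_measure u) S = ennreal (Re (ip u (proj S u)))"
proof -
  have "emeasure (coeff_measure u) S
      = (\<integral>\<^sup>+e. ennreal ((cmod (ip e u))\<^sup>2) * indicator (lam -` S \<inter> B) e \<partial>count_space B)"
    using S by (simp add: coeff_measure_def emeasure_distr emeasure_density)
  also have "\<dots> = (\<integral>\<^sup>+e. ennreal ((cmod (ip e u))\<^sup>2 * indicator S (lam e)) \<partial>count_space B)"
    by (intro nn_integral_cong) (auto simp: indicator_def)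
  also have "\<dots> = ennreal (Re (ip u (proj S u)))"
    by (rule nn_integral_count_space_has_sum[OF proj_inner[OF u]]) simp
  finally show ?thesis .
qed

lemma scalar_measure_proj: assumes u: "u \<in> X" shows "scalar_measure H proj u = coeff_measure u"
proof -
  have "scalar_measure H proj u = measure_of UNIV (sets borel) (emeasure (coeff_measure u))"
    unfolding scalar_measure_def
  proof (rule measure_of_eq)
    fix S :: "real set" assume "S \<in> sigma_sets UNIV (sets borel)"
    then have "S \<in> sets borel" using sets.sigma_sets_eq[of "borel :: real measure"] by simp
    then show "ennreal (Re (ip u (proj S u))) = emeasure (coeff_measure u) S"
      using emeasure_coeff_measure[OF u] by simp
  qed simp
  also have "\<dots> = coeff_measure u" using measure_of_of_measure[of "coeff_measure u"] by simp
  finally show ?thesis .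
qed

lemma proj_nonneg: "u \<in> X \<Longrightarrow> 0 \<le> Re (ip u (proj S u))"
  by (rule has_sum_nonneg[OF proj_inner]) simp_all

text \<open>Countable additivity is inherited from the measures \<open>coeff_measure u\<close>; the algebraic identities
  hold coefficient by coefficient.\<close>

lemma pvm_proj: "projection_valued_measure H proj"
  unfolding projection_valued_measure_def
proof (intro conjI ballI allI impI)
  show "proj S \<in> bounded_ops H" for S by (rule proj_bounded_op)
  show "is_op_adjoint H (proj S) (proj S)" for S
    unfolding is_op_adjoint_def
  proof (intro ballI)
    fix u v assume u [simp]: "u \<in> X" and v [simp]: "v \<in> X"
    have "((\<lambda>e. cnj (ip e (proj S u)) * ip e v) has_sum ip (proj S u) v) B"
      by (intro parseval proj_closed u v)
    moreover have "((\<lambda>e. cnj (ip e u) * ip e (proj S v)) has_sum ip u (proj S v)) B"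
      by (intro parseval proj_closed u v)
    then have "((\<lambda>e. cnj (ip e (proj S u)) * ip e v) has_sum ip u (proj S v)) B"
      by (rule has_sum_cong[THEN iffD1, rotated]) (simp add: proj_coeff indicator_def)
    ultimately show "ip (proj S u) v = ip u (proj S v)" by (rule has_sum_unique)
  qed
  show "proj UNIV = op_id H"
  proof (rule extensionalityI[of _ X])
    show "proj UNIV \<in> extensional X" by (simp add: proj_def hdiag_def)
    show "op_id H \<in> extensional X" by (simp add: op_id_def)
    show "proj UNIV u = op_id H u" if "u \<in> X" for u
      using that by (intro basis_ext) (simp_all add: proj_closed proj_coeff op_id_def)
  qed
  show "proj (S \<inter> S') = compose X (proj S) (proj S')" for S S'
  proof (rule extensionalityI[of _ X])
    show "proj (S \<inter> S') \<in> extensional X" by (simp add: proj_def hdiag_def)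
    show "proj (S \<inter> S') u = compose X (proj S) (proj S') u" if "u \<in> X" for u
      using that by (intro basis_ext) (simp_all add: proj_closed proj_coeff compose_def indicator_inter_arith)
  qed simp
  fix u and S :: "nat \<Rightarrow> real set"
  assume u: "u \<in> X" and S: "range S \<subseteq> sets borel" "disjoint_family S"
  have "(\<Sum>i. emeasure (coeff_measure u) (S i)) = emeasure (coeff_measure u) (\<Union>i. S i)"
    using S by (intro suminf_emeasure) auto
  then have "(\<Sum>i. ennreal (Re (ip u (proj (S i) u)))) = ennreal (Re (ip u (proj (\<Union>i. S i) u)))"
    using S u by (subst (asm) (1 2) emeasure_coeff_measure) auto
  then have "(\<lambda>i. ennreal (Re (ip u (proj (S i) u)))) sums ennreal (Re (ip u (proj (\<Union>i. S i) u)))"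
    by (metis summableI summable_sums)
  then show "(\<lambda>i. Re (ip u (proj (S i) u))) sums Re (ip u (proj (\<Union>i. S i) u))"
    using proj_nonneg[OF u] by simp
qed

lemma integrable_coeff_measure:
  fixes f :: "real \<Rightarrow> 'b::{banach, second_countable_topology}"
  assumes "f \<in> borel_measurable borel"
  shows "integrable (coeff_measure u) f \<longleftrightarrow> (\<lambda>e. norm ((cmod (ip e u))\<^sup>2 *\<^sub>R f (lam e))) summable_on B"
  unfolding coeff_measure_def
  by (subst integrable_distr_eq) (simp_all add: assms integrable_density integrable_count_space_iff)

lemma integral_coeff_measure:
  fixes f :: "real \<Rightarrow> 'b::{banach, second_countable_topology}"
  assumes "f \<in> borel_measurable borel" "(\<lambda>e. norm ((cmod (ip e u))\<^sup>2 *\<^sub>R f (lam e))) summable_on B"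
    "((\<lambda>e. (cmod (ip e u))\<^sup>2 *\<^sub>R f (lam e)) has_sum s) B"
  shows "integral\<^sup>L (coeff_measure u) f = s"
  unfolding coeff_measure_def
  by (subst integral_distr) (simp_all add: assms(1) integral_density integral_count_space_has_sum[OF assms(2,3)])

lemma spectral_measure_proj: "is_spectral_measure H D proj"
  unfolding is_spectral_measure_def
proof (intro conjI ballI pvm_proj)
  show "dom D = {u \<in> X. integrable (scalar_measure H proj u) (\<lambda>s. s\<^sup>2)}"
    by (rule set_eqI)
       (simp add: dom_D_iff scalar_measure_proj integrable_coeff_measure mult.commute norm_mult del: domIff cong: conj_cong)
  fix u assume u: "u \<in> dom D"
  note d = D_dom[OF u]
  have p: "((\<lambda>e. cnj (ip e u) * ip e (the (D u))) has_sum ip u (the (D u))) B"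
    using d by (intro parseval)
  have ab: "(\<lambda>e. cmod (cnj (ip e u) * ip e (the (D u)))) summable_on B"
    using d by (intro summable_on_product_of_squares coeff_sq_summable)
  have eq: "cnj (ip e u) * ip e (the (D u)) = complex_of_real ((cmod (ip e u))\<^sup>2 *\<^sub>R lam e)" if "e \<in> B" for e
    using d(3)[OF that] complex_norm_square[of "ip e u"] by (simp add: mult_ac)
  have re: "((\<lambda>e. (cmod (ip e u))\<^sup>2 *\<^sub>R lam e) has_sum Re (ip u (the (D u)))) B"
    using has_sum_Re[OF p] by (rule has_sum_cong[THEN iffD1, rotated]) (simp add: eq)
  have "(LINT s|coeff_measure u. s) = Re (ip u (the (D u)))"
  proof (rule integral_coeff_measure[OF _ _ re])
    show "(\<lambda>e. norm ((cmod (ip e u))\<^sup>2 *\<^sub>R lam e)) summable_on B"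
      using ab by (rule summable_on_cong[THEN iffD1, rotated]) (simp add: eq norm_mult norm_power abs_mult)
  qed simp
  moreover have "((\<lambda>e. complex_of_real ((cmod (ip e u))\<^sup>2 *\<^sub>R lam e)) has_sum complex_of_real (Re (ip u (the (D u))))) B"
    using re by (rule has_sum_of_real)
  then have "((\<lambda>e. cnj (ip e u) * ip e (the (D u))) has_sum complex_of_real (Re (ip u (the (D u))))) B"
    by (rule has_sum_cong[THEN iffD1, rotated]) (simp add: eq)
  then have "ip u (the (D u)) = complex_of_real (Re (ip u (the (D u))))" using p has_sum_unique by blast
  ultimately show "ip u (the (D u)) = complex_of_real (LINT s|scalar_measure H proj u. s)"
    using d(1) by (simp add: scalar_measure_proj)
qed

lemma functional_calculus_hdiag:
  fixes f :: "real \<Rightarrow> complex"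
  assumes f: "f \<in> borel_measurable borel" and K: "\<And>s. cmod (f s) \<le> K"
  shows "is_functional_calculus H D f (hdiag (\<lambda>e. f (lam e)))"
proof -
  have K0: "0 \<le> K" using K[of 0] norm_ge_zero order_trans by blast
  have "ip u (hdiag (\<lambda>e. f (lam e)) u) = (LINT s|scalar_measure H proj u. f s)" if u: "u \<in> X" for u
  proof -
    have hs: "((\<lambda>e. cnj (ip e u) * f (lam e) * ip e u) has_sum ip u (hdiag (\<lambda>e. f (lam e)) u)) B"
      by (rule hdiag_inner[of _ K]) (simp_all add: K K0 u)
    have eq: "cnj (ip e u) * f (lam e) * ip e u = (cmod (ip e u))\<^sup>2 *\<^sub>R f (lam e)" for e
      using complex_norm_square[of "ip e u"] by (simp add: scaleR_conv_of_real mult_ac)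
    have "(\<lambda>e. K * (cmod (ip e u))\<^sup>2) summable_on B"
      using coeff_sq_summable[OF u] by (rule summable_on_cmult_right)
    then have "(\<lambda>e. norm ((cmod (ip e u))\<^sup>2 *\<^sub>R f (lam e))) summable_on B"
      by (rule summable_on_comparison_test) (simp_all add: K mult.commute mult_right_mono)
    from integral_coeff_measure[OF f this] hs[unfolded eq] show ?thesis by (simp add: scalar_measure_proj u)
  qed
  then show ?thesis
    unfolding is_functional_calculus_def
    using spectral_measure_proj hdiag_bounded_op[of "\<lambda>e. f (lam e)" K] K K0 by blast
qed

text \<open>A diagonal operator with nonnegative eigenvalues is its own absolute value, and the eigenbasis
  computes its trace as the sum of the eigenvalues.\<close>

lemma trace_class_hdiag:
  assumes a: "\<And>e. 0 \<le> a e" "\<And>e. a e \<le> K" and s: "a summable_on B"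
  shows "trace_class H (hdiag (\<lambda>e. complex_of_real (a e)))"
proof -
  let ?T = "hdiag (\<lambda>e. complex_of_real (a e))"
  have K: "0 \<le> K" using a order_trans by blast
  have m: "cmod (complex_of_real (a e)) \<le> K" for e using a by simp
  note T [simp] = hdiag_closed[OF m K] hdiag_coeff[OF m K]
  have pos: "positive_op H ?T"
    unfolding positive_op_def
  proof (intro conjI ballI)
    show "?T \<in> bounded_ops H" by (rule hdiag_bounded_op[OF m K])
    fix u assume u: "u \<in> X"
    have hs: "((\<lambda>e. cnj (ip e u) * complex_of_real (a e) * ip e u) has_sum ip u (?T u)) B"
      by (rule hdiag_inner[OF m K u u])
    have eq: "cnj (ip e u) * complex_of_real (a e) * ip e u = complex_of_real ((cmod (ip e u))\<^sup>2 * a e)" for e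
      using complex_norm_square[of "ip e u"] by (simp add: mult_ac)
    have "((\<lambda>e. 0) has_sum Im (ip u (?T u))) B" using has_sum_Im[OF hs[unfolded eq]] by simp
    then show "Im (ip u (?T u)) = 0" using has_sum_unique has_sum_0 by (metis (mono_tags, lifting))
    have "((\<lambda>e. (cmod (ip e u))\<^sup>2 * a e) has_sum Re (ip u (?T u))) B" using has_sum_Re[OF hs[unfolded eq]] by simp
    then show "0 \<le> Re (ip u (?T u))" by (rule has_sum_nonneg) (simp add: a)
  qed
  have "ip u (?T (?T v)) = ip (?T u) (?T v)" if [simp]: "u \<in> X" "v \<in> X" for u v
  proof -
    have "((\<lambda>e. cnj (ip e u) * ip e (?T (?T v))) has_sum ip u (?T (?T v))) B" by (intro parseval) simp_all
    then have "((\<lambda>e. cnj (ip e (?T u)) * ip e (?T v)) has_sum ip u (?T (?T v))) B"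
      by (rule has_sum_cong[THEN iffD1, rotated]) simp
    moreover have "((\<lambda>e. cnj (ip e (?T u)) * ip e (?T v)) has_sum ip (?T u) (?T v)) B" by (intro parseval) simp_all
    ultimately show ?thesis by (rule has_sum_unique)
  qed
  then have "is_op_abs H ?T ?T" unfolding is_op_abs_def using pos by blast
  moreover have "(\<lambda>e. Re (ip e (?T e))) summable_on B"
    using s by (rule summable_on_cong[THEN iffD1, rotated]) (simp add: B_orth)
  ultimately show ?thesis
    unfolding trace_class_def using basis hdiag_bounded_op[of "\<lambda>e. complex_of_real (a e)" K, OF m K] by blast
qed

end

context exp_summable_operator
begin

lemma Li_summable_D: "Li_summable H D"
proof -
  let ?f = "\<lambda>s. complex_of_real (exp (- t * \<bar>s\<bar>))"
  have "is_functional_calculus H D ?f (hdiag (\<lambda>e. ?f (lam e)))"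
    using t_pos by (intro functional_calculus_hdiag[where K = 1]) auto
  moreover have "(\<lambda>e. exp (- t * \<bar>lam e\<bar>)) summable_on B"
    using exp_summable by (rule summable_on_cong[THEN iffD1, rotated]) (simp add: lam_nonneg)
  then have "trace_class H (hdiag (\<lambda>e. ?f (lam e)))"
    using t_pos by (intro trace_class_hdiag[where K = 1]) auto
  ultimately show ?thesis unfolding Li_summable_def using t_pos by blast
qed

end

section \<open>Closed positive forms\<close>

locale positive_form = complex_hilbert_space H for H :: "'v hspace" +
  fixes Q :: "'v set" and q :: "'v \<Rightarrow> 'v \<Rightarrow> complex"
  assumes Q_sub: "Q \<subseteq> X"
    and Q_zero: "hzero H \<in> Q"
    and Q_add: "u \<in> Q \<Longrightarrow> v \<in> Q \<Longrightarrow> hadd H u v \<in> Q"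
    and Q_scale: "u \<in> Q \<Longrightarrow> hscale H a u \<in> Q"
    and q_add: "u \<in> Q \<Longrightarrow> v \<in> Q \<Longrightarrow> w \<in> Q \<Longrightarrow> q u (hadd H v w) = q u v + q u w"
    and q_scale: "u \<in> Q \<Longrightarrow> v \<in> Q \<Longrightarrow> q u (hscale H a v) = a * q u v"
    and q_commute: "u \<in> Q \<Longrightarrow> v \<in> Q \<Longrightarrow> q u v = cnj (q v u)"
    and q_nonneg: "u \<in> Q \<Longrightarrow> 0 \<le> Re (q u u)"
begin

lemma Q_X [simp]: "u \<in> Q \<Longrightarrow> u \<in> X" using Q_sub by blast

lemmas Q_simps [simp] = Q_zero Q_add Q_scale q_add q_scale

lemma q_add_left [simp]: "u \<in> Q \<Longrightarrow> v \<in> Q \<Longrightarrow> w \<in> Q \<Longrightarrow> q (hadd H u v) w = q u w + q v w"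
  using q_commute[of "hadd H u v" w] q_commute[of u w] q_commute[of v w] by simp

lemma q_scale_left [simp]: "u \<in> Q \<Longrightarrow> v \<in> Q \<Longrightarrow> q (hscale H a u) v = cnj a * q u v"
  using q_commute[of "hscale H a u" v] q_commute[of u v] by simp

lemma Q_minus [simp]: "u \<in> Q \<Longrightarrow> v \<in> Q \<Longrightarrow> mns u v \<in> Q"
  by (simp add: hminus_def)

lemma q_real: "u \<in> Q \<Longrightarrow> q u u = complex_of_real (Re (q u u))"
  using arg_cong[OF q_commute[of u u], of Im] by (simp add: complex_eq_iff)

text \<open>The form is closed if and only if its domain with this inner product is complete.\<close>

definition form_space :: "'v hspace"
  where "form_space = H\<lparr>hcarrier := Q, hinner := (\<lambda>u v. ip u v + q u v)\<rparr>"

lemma form_space_simps [simp]: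
  "hcarrier form_space = Q" "hzero form_space = hzero H" "hadd form_space = hadd H"
  "hscale form_space = hscale H" "hminus form_space = mns"
  "hinner form_space u v = ip u v + q u v"
  by (simp_all add: form_space_def hminus_def fun_eq_iff)

lemma form_norm: "u \<in> Q \<Longrightarrow> (hnorm form_space u)\<^sup>2 = (nrm u)\<^sup>2 + Re (q u u)"
  by (simp add: hnorm_def q_nonneg inner_nonneg)

lemma inner_space_form_space: "inner_space form_space"
proof unfold_locales
  fix u v assume u: "u \<in> hcarrier form_space" and v: "v \<in> hcarrier form_space"
  show "hinner form_space u v = cnj (hinner form_space v u)"
    using u v inner_commute[of u v] q_commute[of u v] by simp
  show "u = hzero form_space" if "hinner form_space u u = 0"
  proof -
    have "Re (ip u u) + Re (q u u) = 0" using arg_cong[OF that, of Re] by simp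
    then have "Re (ip u u) = 0" using q_nonneg[of u] inner_nonneg[of u] u by simp
    then have "ip u u = 0" using inner_self[of u] u by (simp add: hnorm_def)
    then show ?thesis using inner_definite u by simp
  qed
qed (simp_all add: add_assoc add_left_commute add_zero add_inverse scale_one scale_scale
      scale_add_right scale_add_left inner_nonneg q_nonneg add_commute algebra_simps)

end

text \<open>Density of the domain is stated as triviality of its orthogonal complement, the form in which
  it makes the resolvent injective.\<close>

locale closed_form = positive_form +
  assumes Q_dense: "z \<in> X \<Longrightarrow> (\<And>g. g \<in> Q \<Longrightarrow> ip z g = 0) \<Longrightarrow> z = hzero H"
    and form_complete: "inner_space.cauchy form_space u \<Longrightarrow>
      \<exists>l\<in>Q. (\<lambda>n. hnorm form_space (mns (u n) l)) \<longlonglongrightarrow> 0"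
begin

sublocale form: complex_hilbert_space form_space
  by (rule complex_hilbert_spaceI[OF inner_space_form_space]) (use form_complete in simp)

abbreviation "R \<equiv> form_resolvent H Q q"
abbreviation "\<Delta> \<equiv> form_operator H Q q"

lemma resolvent_unique:
  assumes "W \<in> Q" "W' \<in> Q" "\<And>G. G \<in> Q \<Longrightarrow> ip W G + q W G = ip W' G + q W' G"
  shows "W = W'"
  using assms by (intro form.inner_ext_left) simp_all

lemma resolvent_eqI:
  assumes "W \<in> Q" "\<And>G. G \<in> Q \<Longrightarrow> ip W G + q W G = ip F G"
  shows "R F = W"
  unfolding form_resolvent_def
proof (rule the_equality)
  show "W \<in> Q \<and> (\<forall>G\<in>Q. ip W G + q W G = ip F G)" using assms by blast
  show "W' = W" if "W' \<in> Q \<and> (\<forall>G\<in>Q. ip W' G + q W' G = ip F G)" for W'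
    using that assms by (intro resolvent_unique) simp_all
qed

text \<open>The functional \<open>G \<mapsto> ip F G\<close> is bounded for the form norm, which dominates the norm, and \<open>R F\<close>
  represents it in the form space.\<close>

lemma resolvent:
  assumes F: "F \<in> X"
  shows "R F \<in> Q" "G \<in> Q \<Longrightarrow> ip (R F) G + q (R F) G = ip F G"
proof -
  have "\<exists>W\<in>hcarrier form_space. \<forall>G\<in>hcarrier form_space. hinner form_space W G = ip F G"
  proof (rule form.riesz_representation)
    fix u assume u: "u \<in> hcarrier form_space"
    have "(nrm u)\<^sup>2 \<le> (hnorm form_space u)\<^sup>2" using u q_nonneg[of u] by (simp add: form_norm)
    then have "nrm u \<le> hnorm form_space u" by (rule power2_le_imp_le) (use u in simp)
    then have "nrm F * nrm u \<le> nrm F * hnorm form_space u" using F by (intro mult_left_mono) simp_all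
    then show "cmod (ip F u) \<le> nrm F * hnorm form_space u"
      using Cauchy_Schwarz[of F u] F u by simp
  qed (use F in simp_all)
  then obtain W where W: "W \<in> Q" "\<And>G. G \<in> Q \<Longrightarrow> ip W G + q W G = ip F G" by auto
  then have "R F = W" by (rule resolvent_eqI)
  then show "R F \<in> Q" "G \<in> Q \<Longrightarrow> ip (R F) G + q (R F) G = ip F G" using W by auto
qed

lemmas R_Q [simp] = resolvent(1)
lemma R_X [simp]: "F \<in> X \<Longrightarrow> R F \<in> X" by simp

lemma resolvent_inj: assumes "F \<in> X" "F' \<in> X" "R F = R F'" shows "F = F'"
proof -
  have "mns F F' = hzero H"
    using assms
    by (intro Q_dense) (simp_all flip: resolvent(2)[OF assms(1)] resolvent(2)[OF assms(2)])
  then show ?thesis using minus_eq_zero assms by blast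
qed

text \<open>By definition \<open>\<Delta> (R F) = F - R F\<close>, and the equation characterizing \<open>R F\<close> says that \<open>F - R F\<close>
  represents \<open>q (R F)\<close>.\<close>

lemma form_operator_iff:
  "\<Delta> W = Some Z \<longleftrightarrow> W \<in> Q \<and> Z \<in> X \<and> (\<forall>G\<in>Q. q W G = ip Z G)"
proof
  assume "\<Delta> W = Some Z"
  then obtain F where F: "F \<in> X" "W = R F" and Z: "Z = mns (inv_into X R W) W"
    by (auto simp: form_operator_def Let_def split: if_splits)
  have "inv_into X R W = F"
    using F resolvent_inj[of "inv_into X R W" F] inv_into_into[of W R X] f_inv_into_f[of W R X] by simp
  then have "Z = mns F W" using Z by simp
  moreover have "q W G = ip F G - ip W G" if "G \<in> Q" for G
    using resolvent(2)[OF F(1) that] F(2) by (simp add: algebra_simps)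
  ultimately show "W \<in> Q \<and> Z \<in> X \<and> (\<forall>G\<in>Q. q W G = ip Z G)" using F by simp
next
  assume W: "W \<in> Q \<and> Z \<in> X \<and> (\<forall>G\<in>Q. q W G = ip Z G)"
  define F where "F = hadd H Z W"
  have F: "F \<in> X" using W by (simp add: F_def)
  have RF: "R F = W" using W by (intro resolvent_eqI) (simp_all add: F_def)
  then have W': "W \<in> R ` X" using F by blast
  have "inv_into X R W = F"
    using F RF resolvent_inj[of "inv_into X R W" F] inv_into_into[OF W'] f_inv_into_f[OF W'] by simp
  moreover have "mns F W = Z" using W by (intro inner_ext) (simp_all add: F_def)
  ultimately show "\<Delta> W = Some Z" using W' by (simp add: form_operator_def)
qed

text \<open>Both sides equal the form inner product of \<open>R F\<close> and \<open>R G\<close>.\<close>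

lemma R_self_adjoint: assumes "F \<in> X" "G \<in> X" shows "ip (R F) G = ip F (R G)"
proof -
  have "ip (R F) G = cnj (ip G (R F))" using assms by (intro inner_commute) simp_all
  also have "\<dots> = cnj (ip (R G) (R F) + q (R G) (R F))" using assms by (simp add: resolvent(2))
  also have "\<dots> = ip (R F) (R G) + q (R F) (R G)"
    using assms inner_commute[of "R F" "R G"] q_commute[of "R F" "R G"] by simp
  also have "\<dots> = ip F (R G)" using assms by (simp add: resolvent(2))
  finally show ?thesis .
qed

lemma R_quadratic: assumes "F \<in> X"
  shows "Re (ip F (R F)) = (nrm (R F))\<^sup>2 + Re (q (R F) (R F))" "Im (ip F (R F)) = 0"
proof -
  have "ip F (R F) = complex_of_real ((nrm (R F))\<^sup>2 + Re (q (R F) (R F)))"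
    using assms resolvent(2)[of F "R F"] inner_self[of "R F"] q_real[of "R F"] by simp
  then show "Re (ip F (R F)) = (nrm (R F))\<^sup>2 + Re (q (R F) (R F))" "Im (ip F (R F)) = 0" by simp_all
qed

lemma R_contraction: assumes "F \<in> X" shows "nrm (R F) \<le> nrm F"
proof -
  have "(nrm (R F))\<^sup>2 \<le> Re (ip F (R F))" using R_quadratic[OF assms] q_nonneg[of "R F"] assms by simp
  also have "\<dots> \<le> nrm F * nrm (R F)"
    using Cauchy_Schwarz[of F "R F"] complex_Re_le_cmod[of "ip F (R F)"] assms by simp
  finally show ?thesis using assms nrm_nonneg[of "R F"] nrm_nonneg[of F]
    by (cases "nrm (R F) = 0") (auto simp: power2_eq_square order_less_le)
qed

lemma R_scale: "F \<in> X \<Longrightarrow> R (hscale H a F) = hscale H a (R F)"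
  by (intro inner_ext) (simp_all flip: R_self_adjoint)

lemma R_minus: "F \<in> X \<Longrightarrow> G \<in> X \<Longrightarrow> R (mns F G) = mns (R F) (R G)"
  by (intro inner_ext) (simp_all flip: R_self_adjoint)

text \<open>Let \<open>m\<close> be the supremum of the quadratic form of \<open>R\<close> on the unit sphere of the orthogonal
  complement of \<open>S\<close>.  If \<open>m\<close> is not an eigenvalue there, then the range of \<open>m - R\<close> is dense, so every
  maximizing sequence converges weakly to zero; the compactness hypothesis then forces \<open>m = 0\<close>.\<close>

lemma eigenvector_in_complement:
  assumes compact: "\<And>w. \<lbrakk>\<And>n. w n \<in> Q; \<And>n. nrm (w n) \<le> 1; \<And>n. Re (q (w n) (w n)) \<le> 1;
      \<And>v. v \<in> X \<Longrightarrow> (\<lambda>n. ip (w n) v) \<longlonglongrightarrow> 0\<rbrakk> \<Longrightarrow> (\<lambda>n. nrm (w n)) \<longlonglongrightarrow> 0"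
    and S: "S \<subseteq> X" "\<And>s. s \<in> S \<Longrightarrow> \<exists>\<rho>. R s = hscale H \<rho> s"
    and z0: "z0 \<in> X" "\<And>s. s \<in> S \<Longrightarrow> ip s z0 = 0" "z0 \<noteq> hzero H"
  shows "\<exists>z\<in>X. z \<noteq> hzero H \<and> (\<forall>s\<in>S. ip s z = 0) \<and> (\<exists>\<rho>. R z = hscale H \<rho> z)"
proof (rule ccontr)
  assume no: "\<not> ?thesis"
  define P where "P = {u\<in>X. \<forall>s\<in>S. ip s u = 0}"
  have PX [simp]: "u \<in> P \<Longrightarrow> u \<in> X" for u by (simp add: P_def)
  have SX [simp]: "s \<in> S \<Longrightarrow> s \<in> X" for s using S by blast
  have RP [simp]: "R u \<in> P" if u: "u \<in> P" for u
  proof -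
    have [simp]: "u \<in> X" using u by simp
    have "ip s (R u) = 0" if s: "s \<in> S" for s
    proof -
      obtain \<rho> where "R s = hscale H \<rho> s" using S(2) s by blast
      then have "ip s (R u) = cnj \<rho> * ip s u" using s u R_self_adjoint[of s u] by simp
      then show ?thesis using u s by (simp add: P_def del: PX)
    qed
    then show ?thesis using u by (simp add: P_def del: PX)
  qed
  have P_lin [simp]: "hadd H u v \<in> P" "hscale H a u \<in> P" "mns u v \<in> P" if "u \<in> P" "v \<in> P" for u v a
    using that by (simp_all add: P_def del: PX)
  define N where "N u = Re (ip u (R u))" for u
  define m where "m = Sup (N ` {u\<in>P. nrm u = 1})"
  have N_scale: "N (hscale H a u) = (cmod a)\<^sup>2 * N u" if "u \<in> X" for a u
  proof -
    have "ip (hscale H a u) (R (hscale H a u)) = complex_of_real ((cmod a)\<^sup>2) * ip u (R u)"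
      using that complex_norm_square[of a] by (simp add: R_scale mult_ac)
    then show ?thesis by (simp add: N_def)
  qed
  have N_le: "N u \<le> 1" if "u \<in> X" "nrm u = 1" for u
    using Cauchy_Schwarz[of u "R u"] complex_Re_le_cmod[of "ip u (R u)"] R_contraction[of u] that
    by (simp add: N_def)
  have bdd: "bdd_above (N ` {u\<in>P. nrm u = 1})" using N_le by (intro bdd_aboveI2[of _ _ 1]) simp
  have unit: "nrm (hscale H (1 / complex_of_real (nrm u)) u) = 1" if "u \<in> X" "u \<noteq> hzero H" for u
    using that nrm_eq_zero[of u] nrm_nonneg[of u] by (simp add: nrm_scale norm_divide)
  have N_m: "N u \<le> m * (nrm u)\<^sup>2" if u: "u \<in> P" for u
  proof (cases "u = hzero H")
    case True
    then show ?thesis by (simp add: N_def)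
  next
    case False
    then have n: "nrm u > 0" using nrm_eq_zero[of u] nrm_nonneg[of u] u by (simp add: order_less_le)
    have "N (hscale H (1 / complex_of_real (nrm u)) u) \<le> m"
      unfolding m_def using u unit[of u] False by (intro cSup_upper bdd imageI) simp
    then show ?thesis using n u by (simp add: N_scale norm_divide field_simps)
  qed
  have "z0 \<in> P" using z0 by (simp add: P_def del: PX)
  have N_pos: "0 < N u" if u: "u \<in> X" "u \<noteq> hzero H" for u
  proof -
    have "R u \<noteq> hzero H"
      using resolvent_inj[of u "hzero H"] u resolvent_eqI[of "hzero H" "hzero H"] q_scale_left[of "hzero H" _ 0]
      by (metis R_Q R_scale add_inverse mult_zero_left inner_zero_left resolvent(2) zero_closed
          nrm_zero nrm_eq_zero R_contraction order_antisym_conv nrm_nonneg R_X)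
    then have "nrm (R u) > 0" using nrm_eq_zero[of "R u"] nrm_nonneg[of "R u"] u by (simp add: order_less_le)
    then have "0 < (nrm (R u))\<^sup>2" by simp
    then show ?thesis unfolding N_def using R_quadratic(1)[OF u(1)] q_nonneg[OF R_Q[OF u(1)]] by linarith
  qed
  have m: "m > 0"
  proof -
    have "0 < N z0" using N_pos z0 by blast
    also have "\<dots> \<le> m * (nrm z0)\<^sup>2" using N_m \<open>z0 \<in> P\<close> by blast
    finally show ?thesis by (simp add: zero_less_mult_iff)
  qed
  have ne: "N ` {u\<in>P. nrm u = 1} \<noteq> {}" using unit[OF z0(1,3)] \<open>z0 \<in> P\<close> P_lin(2)[OF _ \<open>z0 \<in> P\<close>] by blast
  have "\<exists>u. u \<in> P \<and> nrm u = 1 \<and> m - 1 / real (Suc k) < N u" for k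
  proof -
    have "m - 1 / real (Suc k) < Sup (N ` {u\<in>P. nrm u = 1})" by (simp add: m_def)
    from less_cSupD[OF ne this] show ?thesis by auto
  qed
  then obtain u where u: "\<And>k. u k \<in> P" "\<And>k. nrm (u k) = 1" "\<And>k. m - 1 / real (Suc k) < N (u k)"
    by metis
  define A where "A v = mns (hscale H (complex_of_real m) v) (R v)" for v
  have AP [simp]: "A v \<in> P" if "v \<in> P" for v using that by (simp add: A_def)
  have A_sym: "ip (A v) w = ip v (A w)" if "v \<in> P" "w \<in> P" for v w
    using that by (simp add: A_def R_self_adjoint)
  have A_quad: "Re (ip v (A v)) = m * (nrm v)\<^sup>2 - N v" if "v \<in> P" for v
    using that by (simp add: A_def N_def nrm_sq)
  have A_add: "A (mns v (hscale H (complex_of_real t) w)) = mns (A v) (hscale H (complex_of_real t) (A w))"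
    if "v \<in> P" "w \<in> P" for v w t
    using that by (intro inner_ext) (simp_all add: A_def R_minus R_scale algebra_simps)
  \<comment> \<open>A Cauchy-Schwarz inequality for the possibly degenerate form of \<open>A = m - R\<close>, from its positivity at \<open>v - A v / m\<close>.\<close>
  have A_bound: "(nrm (A v))\<^sup>2 \<le> m * Re (ip v (A v))" if v: "v \<in> P" for v
  proof -
    define w where "w = mns v (hscale H (complex_of_real (1 / m)) (A v))"
    have w: "w \<in> P" using v by (simp add: w_def)
    have aa: "Re (ip (A v) (A (A v))) \<le> m * (nrm (A v))\<^sup>2"
    proof -
      have "0 \<le> N (A v)"
        using R_quadratic[of "A v"] q_nonneg[of "R (A v)"] v by (simp add: N_def)
      then show ?thesis using A_quad[of "A v"] v by simp
    qed
    have "0 \<le> Re (ip w (A w))" using A_quad[OF w] N_m[OF w] by simp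
    also have "ip w (A w) = ip v (A v) - 2 * complex_of_real (1 / m) * ip (A v) (A v)
        + (complex_of_real (1 / m))\<^sup>2 * ip (A v) (A (A v))"
      using v unfolding w_def by (simp only: A_add AP) (simp add: A_sym[symmetric, of v "A v"] power2_eq_square algebra_simps)
    also have "Re \<dots> = Re (ip v (A v)) - 2 / m * (nrm (A v))\<^sup>2 + (1 / m)\<^sup>2 * Re (ip (A v) (A (A v)))"
    proof -
      have "Re (ip (A v) (A v)) = (nrm (A v))\<^sup>2" using v by (simp add: nrm_sq)
      then show ?thesis by (simp add: power2_eq_square[of "complex_of_real _"] power2_eq_square[of "1 / m"])
    qed
    also have "\<dots> \<le> Re (ip v (A v)) - 2 / m * (nrm (A v))\<^sup>2 + (1 / m)\<^sup>2 * (m * (nrm (A v))\<^sup>2)"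
      by (intro add_left_mono mult_left_mono aa) simp
    also have "\<dots> = Re (ip v (A v)) - (nrm (A v))\<^sup>2 / m"
      using m by (simp add: field_simps power2_eq_square)
    finally show ?thesis using m by (simp add: field_simps)
  qed
  have Au: "(\<lambda>k. nrm (A (u k))) \<longlonglongrightarrow> 0"
  proof -
    have "(nrm (A (u k)))\<^sup>2 \<le> m * (1 / real (Suc k))" for k
    proof -
      have "Re (ip (u k) (A (u k))) \<le> 1 / real (Suc k)" using A_quad[OF u(1)] u(2,3)[of k] by simp
      then have "m * Re (ip (u k) (A (u k))) \<le> m * (1 / real (Suc k))" using m by (intro mult_left_mono) simp_all
      then show ?thesis using A_bound[OF u(1)[of k]] by simp
    qed
    moreover have "(\<lambda>k. m * (1 / real (Suc k))) \<longlonglongrightarrow> m * 0"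
      by (intro tendsto_intros LIMSEQ_Suc[OF lim_1_over_n])
    ultimately have "(\<lambda>k. (nrm (A (u k)))\<^sup>2) \<longlonglongrightarrow> 0"
      using Lim_null_comparison[of "\<lambda>k. (nrm (A (u k)))\<^sup>2" "\<lambda>k. m * (1 / real (Suc k))" sequentially]
      by (auto simp del: One_nat_def)
    then have "(\<lambda>k. sqrt ((nrm (A (u k)))\<^sup>2)) \<longlonglongrightarrow> sqrt 0" by (rule tendsto_real_sqrt)
    then show ?thesis using u(1) by simp
  qed
  \<comment> \<open>The vectors against which the maximizing sequence tends to zero: a closed subspace containing \<open>S\<close> and the image of \<open>P\<close> under \<open>A\<close>.\<close>
  define V where "V = {v\<in>X. (\<lambda>k. ip (u k) v) \<longlonglongrightarrow> 0}"
  have uX [simp]: "u k \<in> X" for k using u(1) by simp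
  have "V = X"
  proof (rule closed_subspace_orthogonal)
    show "V \<subseteq> X" "hzero H \<in> V" by (auto simp: V_def)
    show "hadd H v w \<in> V" if "v \<in> V" "w \<in> V" for v w
      using that tendsto_add[of "\<lambda>k. ip (u k) v" 0 sequentially "\<lambda>k. ip (u k) w" 0] by (simp add: V_def)
    show "hscale H a v \<in> V" if "v \<in> V" for a v
      using that tendsto_mult_right_zero[of "\<lambda>k. ip (u k) v" sequentially a] by (simp add: V_def)
    show "l \<in> V" if v: "\<And>n. v n \<in> V" and l: "l \<in> X" and lim: "(\<lambda>n. nrm (mns (v n) l)) \<longlonglongrightarrow> 0" for v l
    proof -
      have vX: "v n \<in> X" for n using v by (simp add: V_def)
      have "(\<lambda>k. ip (u k) l) \<longlonglongrightarrow> 0"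
      proof (rule LIMSEQ_I)
        fix \<epsilon> :: real assume \<epsilon>: "0 < \<epsilon>"
        obtain n where n: "nrm (mns (v n) l) < \<epsilon> / 2"
          using LIMSEQ_D[OF lim, of "\<epsilon> / 2"] \<epsilon> vX l by fastforce
        have "(\<lambda>k. ip (u k) (v n)) \<longlonglongrightarrow> 0" using v by (simp add: V_def)
        then obtain K where K: "\<And>k. k \<ge> K \<Longrightarrow> cmod (ip (u k) (v n)) < \<epsilon> / 2"
          using LIMSEQ_D[of _ 0 "\<epsilon> / 2"] \<epsilon> by fastforce
        have "norm (ip (u k) l - 0) < \<epsilon>" if k: "k \<ge> K" for k
        proof -
          have "ip (u k) l = ip (u k) (v n) - ip (u k) (mns (v n) l)" using vX l by simp
          then have "cmod (ip (u k) l) \<le> cmod (ip (u k) (v n)) + cmod (ip (u k) (mns (v n) l))"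
            by (metis norm_triangle_ineq4)
          also have "\<dots> \<le> cmod (ip (u k) (v n)) + nrm (mns (v n) l)"
            using Cauchy_Schwarz[of "u k" "mns (v n) l"] u(2) vX l by simp
          finally show ?thesis using K[OF k] n by simp
        qed
        then show "\<exists>K. \<forall>k\<ge>K. norm (ip (u k) l - 0) < \<epsilon>" by blast
      qed
      then show ?thesis using l by (simp add: V_def)
    qed
    fix z assume z: "z \<in> X" "\<And>g. g \<in> V \<Longrightarrow> ip z g = 0"
    have SV: "s \<in> V" if "s \<in> S" for s
    proof -
      have "ip s (u k) = 0" for k using u(1) that by (simp add: P_def del: PX)
      then have "ip (u k) s = 0" for k using inner_commute[of "u k" s] that by simp
      then show ?thesis using that by (simp add: V_def)
    qed
    have zP: "z \<in> P"
      using z SV inner_commute[of _ z] by (auto simp: P_def simp del: PX)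
    have AV: "A v \<in> V" if v: "v \<in> P" for v
    proof -
      have "(\<lambda>k. nrm (A (u k)) * nrm v) \<longlonglongrightarrow> 0" using Au by (rule tendsto_mult_left_zero)
      then have "(\<lambda>k. ip (u k) (A v)) \<longlonglongrightarrow> 0"
      proof (rule Lim_null_comparison[rotated], intro always_eventually allI)
        fix k show "norm (ip (u k) (A v)) \<le> nrm (A (u k)) * nrm v"
          using Cauchy_Schwarz[of "A (u k)" v] A_sym[OF u(1) v] u(1) v by simp
      qed
      then show ?thesis using v by (simp add: V_def)
    qed
    have "ip (A z) (A z) = 0" using A_sym[of z "A z"] z(2)[OF AV[of "A z"]] zP by simp
    then have "A z = hzero H" using zP by (intro inner_definite) simp_all
    then have "R z = hscale H (complex_of_real m) z" using zP minus_eq_zero[of "hscale H (complex_of_real m) z" "R z"] by (simp add: A_def)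
    then show "z = hzero H" using no zP unfolding P_def by blast
  qed
  then have weak: "(\<lambda>k. ip (u k) v) \<longlonglongrightarrow> 0" if "v \<in> X" for v using that by (auto simp: V_def)
  have "(\<lambda>k. nrm (R (u k))) \<longlonglongrightarrow> 0"
  proof (rule compact)
    show "R (u n) \<in> Q" "nrm (R (u n)) \<le> 1" for n using R_contraction[of "u n"] u(2) by simp_all
    show "Re (q (R (u n)) (R (u n))) \<le> 1" for n
      using R_quadratic(1)[OF uX[of n]] N_le[OF uX u(2), of n] zero_le_power2[of "nrm (R (u n))"]
      unfolding N_def by linarith
    show "(\<lambda>n. ip (R (u n)) v) \<longlonglongrightarrow> 0" if "v \<in> X" for v
      using weak[of "R v"] that by (simp add: R_self_adjoint)
  qed
  moreover have "m - 1 / real (Suc k) \<le> nrm (R (u k))" for k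
    using u(3)[of k] Cauchy_Schwarz[of "u k" "R (u k)"] complex_Re_le_cmod[of "ip (u k) (R (u k))"] u(2)[of k]
    by (simp add: N_def)
  moreover have "(\<lambda>k. m - 1 / real (Suc k)) \<longlonglongrightarrow> m - 0"
    by (intro tendsto_intros LIMSEQ_Suc[OF lim_1_over_n])
  ultimately have "m - 0 \<le> 0" by (meson LIMSEQ_le)
  then show False using m by simp
qed

end

section \<open>Eigenbases of forms with compact embedding\<close>

context closed_form
begin

text \<open>By Zorn's lemma there is a maximal orthonormal set of eigenvectors.  It is a basis: a nonzero
  orthogonal vector would yield a further eigenvector orthogonal to the set.\<close>

theorem eigenbasis_exists:
  assumes compact: "\<And>w. \<lbrakk>\<And>n. w n \<in> Q; \<And>n. nrm (w n) \<le> 1; \<And>n. Re (q (w n) (w n)) \<le> 1;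
      \<And>v. v \<in> X \<Longrightarrow> (\<lambda>n. ip (w n) v) \<longlonglongrightarrow> 0\<rbrakk> \<Longrightarrow> (\<lambda>n. nrm (w n)) \<longlonglongrightarrow> 0"
  shows "\<exists>B. orthonormal_basis H B \<and> (\<forall>e\<in>B. \<exists>\<rho>. R e = hscale H \<rho> e)"
proof -
  define E where "E = {S. S \<subseteq> X \<and> (\<forall>e\<in>S. \<forall>e'\<in>S. ip e e' = (if e = e' then 1 else 0))
      \<and> (\<forall>e\<in>S. \<exists>\<rho>. R e = hscale H \<rho> e)}"
  have "\<exists>S\<in>E. \<forall>S'\<in>E. S \<subseteq> S' \<longrightarrow> S' = S"
  proof (rule subset_Zorn_nonempty)
    show "E \<noteq> {}" by (auto simp: E_def intro!: exI[of _ "{}"])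
    show "\<Union>\<C> \<in> E" if "\<C> \<noteq> {}" and c: "subset.chain E \<C>" for \<C>
    proof -
      have sub: "S \<in> E" if "S \<in> \<C>" for S using c that by (auto simp: subset_chain_def)
      have "ip e e' = (if e = e' then 1 else 0)" if e: "e \<in> \<Union>\<C>" "e' \<in> \<Union>\<C>" for e e'
      proof -
        obtain S S' where S: "S \<in> \<C>" "S' \<in> \<C>" "e \<in> S" "e' \<in> S'" using e by blast
        then have "S \<subseteq> S' \<or> S' \<subseteq> S" using c by (auto simp: subset_chain_def)
        then obtain T where "T \<in> \<C>" "e \<in> T" "e' \<in> T" using S by blast
        then show ?thesis using sub[of T] by (simp add: E_def)
      qed
      moreover have "\<Union>\<C> \<subseteq> X" "\<forall>e\<in>\<Union>\<C>. \<exists>\<rho>. R e = hscale H \<rho> e"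
        using sub unfolding E_def by blast+
      ultimately show ?thesis unfolding E_def by blast
    qed
  qed
  then obtain S where S: "S \<in> E" and max: "\<And>S'. S' \<in> E \<Longrightarrow> S \<subseteq> S' \<Longrightarrow> S' = S" by blast
  have SX: "S \<subseteq> X" and So: "\<And>e e'. e \<in> S \<Longrightarrow> e' \<in> S \<Longrightarrow> ip e e' = (if e = e' then 1 else 0)"
    and Se: "\<And>e. e \<in> S \<Longrightarrow> \<exists>\<rho>. R e = hscale H \<rho> e" using S by (auto simp: E_def)
  have "u = hzero H" if u: "u \<in> X" "\<forall>e\<in>S. ip e u = 0" for u
  proof (rule ccontr)
    assume "u \<noteq> hzero H"
    then obtain z \<rho> where z: "z \<in> X" "z \<noteq> hzero H" "\<forall>s\<in>S. ip s z = 0" "R z = hscale H \<rho> z"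
      using eigenvector_in_complement[OF compact SX Se, of u] u by blast
    define e where "e = hscale H (1 / complex_of_real (nrm z)) z"
    have n: "nrm z \<noteq> 0" using z nrm_eq_zero by blast
    have e: "e \<in> X" using z by (simp add: e_def)
    have ee: "ip e e = 1" using z n by (simp add: inner_self[OF e]) (simp add: e_def nrm_scale norm_divide)
    have se: "ip s e = 0" if "s \<in> S" for s using z that SX by (auto simp: e_def)
    have es: "ip e s = 0" if "s \<in> S" for s using se[OF that] inner_commute[of e s] e that SX by auto
    have "R e = hscale H \<rho> e"
      using z e by (simp add: e_def R_scale scale_scale mult.commute)
    moreover have eS: "e \<notin> S" using se[of e] ee by auto
    ultimately have "insert e S \<in> E"
      unfolding E_def using e ee se es SX So Se by simp blast
    then have "insert e S = S" by (rule max) blast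
    then show False using eS by blast
  qed
  then have "orthonormal_basis H S" using SX So by (auto simp: orthonormal_basis_def)
  then show ?thesis using Se by blast
qed

text \<open>For \<open>R e = \<rho> e\<close> the defining identity of \<open>R e\<close> says \<open>q e = (1 / cnj \<rho> - 1) ip e\<close> on \<open>Q\<close>, and
  evaluating it at \<open>e\<close> identifies the factor with the Rayleigh quotient of \<open>e\<close>.\<close>

lemma eigenvector_form:
  assumes e: "e \<in> X" "e \<noteq> hzero H" and ev: "R e = hscale H \<rho> e"
  shows "e \<in> Q" "G \<in> Q \<Longrightarrow> q e G = complex_of_real (Re (q e e) / (nrm e)\<^sup>2) * ip e G"
    "\<rho> = 1 / (1 + complex_of_real (Re (q e e) / (nrm e)\<^sup>2))"
proof -
  have \<rho>: "\<rho> \<noteq> 0"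
  proof
    assume "\<rho> = 0"
    moreover have "hscale H 0 e = hscale H 0 (hzero H)" using e by (intro inner_ext) simp_all
    ultimately have "R e = R (hscale H 0 e)" using e ev
      by (metis R_scale inner_ext inner_scale_right mult_zero_left scale_closed R_X)
    then have "e = hscale H 0 e" by (rule resolvent_inj[OF e(1) scale_closed[OF e(1)]])
    also have "\<dots> = hzero H" using e by (intro inner_ext) simp_all
    finally show False using e by blast
  qed
  have "e = hscale H (1 / \<rho>) (R e)" using e \<rho> by (simp add: ev scale_scale scale_one)
  then show Q: "e \<in> Q" using e by (metis Q_scale R_Q)
  have qe: "q e G = (1 / cnj \<rho> - 1) * ip e G" if "G \<in> Q" for G
  proof -
    have "cnj \<rho> * (ip e G + q e G) = ip e G"
      using resolvent(2)[OF e(1) that] Q that by (simp add: ev distrib_left)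
    then show ?thesis using \<rho> by (simp add: field_simps)
  qed
  have n: "nrm e \<noteq> 0" using e nrm_eq_zero by blast
  have "q e e = (1 / cnj \<rho> - 1) * complex_of_real ((nrm e)\<^sup>2)" using qe[OF Q] inner_self[OF e(1)] by simp
  then have "1 / cnj \<rho> - 1 = q e e / complex_of_real ((nrm e)\<^sup>2)" using n by simp
  also have "\<dots> = complex_of_real (Re (q e e) / (nrm e)\<^sup>2)" by (subst q_real[OF Q]) simp
  finally have eq: "1 / cnj \<rho> - 1 = complex_of_real (Re (q e e) / (nrm e)\<^sup>2)" .
  show "G \<in> Q \<Longrightarrow> q e G = complex_of_real (Re (q e e) / (nrm e)\<^sup>2) * ip e G" using qe eq by simp
  have "1 / cnj \<rho> = 1 + complex_of_real (Re (q e e) / (nrm e)\<^sup>2)" using eq by (simp add: algebra_simps)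
  then have "cnj \<rho> = 1 / (1 + complex_of_real (Re (q e e) / (nrm e)\<^sup>2))" using \<rho>
    by (metis div_by_1 divide_divide_eq_right mult_1 )
  then have "cnj (cnj \<rho>) = 1 / (1 + complex_of_real (Re (q e e) / (nrm e)\<^sup>2))" by simp
  then show "\<rho> = 1 / (1 + complex_of_real (Re (q e e) / (nrm e)\<^sup>2))" by simp
qed

text \<open>The coefficient of \<open>q u\<close> at a basis vector is the energy of that vector times the coefficient
  of \<open>u\<close>.  Conversely, if the coefficients of \<open>w\<close> are obtained in this way, then \<open>u\<close> and \<open>R (u + w)\<close>
  have the same coefficients.\<close>

lemma form_operator_diagonal:
  assumes B: "orthonormal_basis H B" and ev: "\<And>e. e \<in> B \<Longrightarrow> \<exists>\<rho>. R e = hscale H \<rho> e"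
  shows "B \<subseteq> Q" "diagonal_operator H B (\<lambda>e. Re (q e e)) \<Delta>"
proof -
  interpret hilbert_basis H B by unfold_locales (rule B)
  have n: "nrm e = 1" "e \<noteq> hzero H" if "e \<in> B" for e
  proof -
    show "nrm e = 1" using B_orth[OF that that] by (simp add: hnorm_def)
    then show "e \<noteq> hzero H" using nrm_zero by auto
  qed
  have BQ: "e \<in> Q" if e: "e \<in> B" for e using eigenvector_form(1) ev[OF e] n[OF e] e B_closed by blast
  then show "B \<subseteq> Q" by blast
  have qe: "q e G = complex_of_real (Re (q e e)) * ip e G" if e: "e \<in> B" "G \<in> Q" for e G
  proof -
    obtain \<rho> where "R e = hscale H \<rho> e" using ev[OF e(1)] by blast
    from eigenvector_form(2)[OF B_closed[OF e(1)] n(2)[OF e(1)] this e(2)] show ?thesis using n[OF e(1)] by simp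
  qed
  have Re: "R e = hscale H (1 / (1 + complex_of_real (Re (q e e)))) e" if e: "e \<in> B" for e
  proof -
    obtain \<rho> where r: "R e = hscale H \<rho> e" using ev[OF e(1)] by blast
    from eigenvector_form(3)[OF B_closed[OF e(1)] n(2)[OF e(1)] this] show ?thesis using n[OF e(1)] r by simp
  qed
  have ne: "1 + complex_of_real (Re (q e e)) \<noteq> 0" if "e \<in> B" for e
    using q_nonneg[OF BQ[OF that]] by (metis of_real_1 of_real_add of_real_eq_0_iff add_pos_nonneg less_irrefl zero_less_one)
  show "diagonal_operator H B (\<lambda>e. Re (q e e)) \<Delta>"
  proof unfold_locales
    show "0 \<le> Re (q e e)" if "e \<in> B" for e using BQ[OF that] by (rule q_nonneg)
    fix u w
    show "\<Delta> u = Some w \<longleftrightarrow> u \<in> X \<and> w \<in> X \<and> (\<forall>e\<in>B. ip e w = complex_of_real (Re (q e e)) * ip e u)"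
      unfolding form_operator_iff
    proof
      assume u: "u \<in> Q \<and> w \<in> X \<and> (\<forall>G\<in>Q. q u G = ip w G)"
      have "ip e w = complex_of_real (Re (q e e)) * ip e u" if e: "e \<in> B" for e
        using u BQ[OF e] qe[OF e, of u] q_commute[of e u] inner_commute[of e w] by simp
      then show "u \<in> X \<and> w \<in> X \<and> (\<forall>e\<in>B. ip e w = complex_of_real (Re (q e e)) * ip e u)" using u by simp
    next
      assume u: "u \<in> X \<and> w \<in> X \<and> (\<forall>e\<in>B. ip e w = complex_of_real (Re (q e e)) * ip e u)"
      define F where "F = hadd H u w"
      have F: "F \<in> X" using u by (simp add: F_def)
      have "ip e (R F) = ip e u" if e: "e \<in> B" for e
      proof -
        have "ip e (R F) = ip (R e) F" using e F by (simp add: R_self_adjoint)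
        also have "\<dots> = 1 / (1 + complex_of_real (Re (q e e))) * ip e F" using e F by (simp add: Re[OF e])
        also have "ip e F = (1 + complex_of_real (Re (q e e))) * ip e u" using u e by (simp add: F_def distrib_right)
        finally show ?thesis using ne[OF e] by simp
      qed
      then have RF: "R F = u" using u F by (intro basis_ext) simp_all
      have "q u G = ip w G" if "G \<in> Q" for G
        using resolvent(2)[OF F that] u that unfolding RF by (simp add: F_def)
      then show "u \<in> Q \<and> w \<in> X \<and> (\<forall>G\<in>Q. q u G = ip w G)" using u R_Q[OF F] RF by simp
    qed
  qed
qed

end

text \<open>Group the elements by the integer part \<open>n\<close> of \<open>lam\<close>.  A group has at most \<open>A exp (b (n + 1))\<close>
  elements, each contributing at most \<open>exp (- (b + 1) n)\<close>, so the sums are dominated by a geometric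
  series.\<close>

lemma exponential_counting_summable:
  fixes lam :: "'a \<Rightarrow> real"
  assumes nonneg: "\<And>e. e \<in> B \<Longrightarrow> 0 \<le> lam e" and A: "0 \<le> A"
    and count: "\<And>F L. \<lbrakk>finite F; F \<subseteq> B; 0 \<le> L; \<And>e. e \<in> F \<Longrightarrow> lam e \<le> L\<rbrakk> \<Longrightarrow> real (card F) \<le> A * exp (b * L)"
    and b: "0 \<le> b"
  shows "(\<lambda>e. exp (- (b + 1) * lam e)) summable_on B"
proof (rule nonneg_bdd_above_summable_on)
  have geo: "summable (\<lambda>n. exp (-1) ^ n :: real)" by (intro summable_geometric) simp
  show "bdd_above (sum (\<lambda>e. exp (- (b + 1) * lam e)) ` {F. F \<subseteq> B \<and> finite F})"
  proof (rule bdd_aboveI2)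
    fix F assume "F \<in> {F. F \<subseteq> B \<and> finite F}"
    then have F: "F \<subseteq> B" "finite F" by auto
    define f where "f e = nat \<lfloor>lam e\<rfloor>" for e
    have f: "real (f e) \<le> lam e" "lam e \<le> real (f e) + 1" if "e \<in> F" for e
    proof -
      have "0 \<le> lam e" using that F nonneg by blast
      then show "real (f e) \<le> lam e" "lam e \<le> real (f e) + 1" by (simp_all add: f_def)
    qed
    have "(\<Sum>e\<in>F. exp (- (b + 1) * lam e)) = (\<Sum>n\<in>f ` F. \<Sum>e\<in>{e\<in>F. f e = n}. exp (- (b + 1) * lam e))"
      using F(2) by (rule sum.image_gen)
    also have "\<dots> \<le> (\<Sum>n\<in>f ` F. A * exp b * exp (-1) ^ n)"
    proof (rule sum_mono)
      fix n assume "n \<in> f ` F"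
      have "(\<Sum>e\<in>{e\<in>F. f e = n}. exp (- (b + 1) * lam e)) \<le> (\<Sum>e\<in>{e\<in>F. f e = n}. exp (- (b + 1) * real n))"
      proof (rule sum_mono)
        fix e assume "e \<in> {e\<in>F. f e = n}"
        then have "(b + 1) * real n \<le> (b + 1) * lam e" using f(1)[of e] b by (intro mult_left_mono) auto
        then show "exp (- (b + 1) * lam e) \<le> exp (- (b + 1) * real n)"
          by (subst exp_le_cancel_iff) (simp only: mult_minus_left neg_le_iff_le)
      qed
      also have "\<dots> = real (card {e\<in>F. f e = n}) * exp (- (b + 1) * real n)" by simp
      also have "\<dots> \<le> A * exp (b * (real n + 1)) * exp (- (b + 1) * real n)"
      proof (intro mult_right_mono count)
        show "lam e \<le> real n + 1" if "e \<in> {e\<in>F. f e = n}" for e using f(2)[of e] that by auto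
      qed (use F in auto)
      also have "\<dots> = A * exp b * exp (- real n)"
        by (simp add: algebra_simps flip: exp_add)
      also have "exp (- real n) = exp (-1) ^ n" by (simp flip: exp_of_nat_mult)
      finally show "(\<Sum>e\<in>{e\<in>F. f e = n}. exp (- (b + 1) * lam e)) \<le> A * exp b * exp (-1) ^ n" .
    qed
    also have "\<dots> = A * exp b * (\<Sum>n\<in>f ` F. exp (-1) ^ n)" by (simp add: sum_distrib_left)
    also have "\<dots> \<le> A * exp b * (\<Sum>n. exp (-1) ^ n)"
      using F A by (intro mult_left_mono sum_le_suminf geo) auto
    finally show "(\<Sum>e\<in>F. exp (- (b + 1) * lam e)) \<le> A * exp b * (\<Sum>n. exp (-1) ^ n)" .
  qed
qed simp

section \<open>The Hilbert space of square-integrable functions\<close>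

lemma cmod_add_sq_le: "(cmod (a + b))\<^sup>2 \<le> 2 * (cmod a)\<^sup>2 + 2 * (cmod b)\<^sup>2"
proof -
  have "(cmod (a + b))\<^sup>2 \<le> (cmod a + cmod b)\<^sup>2" by (intro power_mono norm_triangle_ineq) simp
  also have "\<dots> \<le> 2 * (cmod a)\<^sup>2 + 2 * (cmod b)\<^sup>2"
    using sum_squares_bound[of "cmod a" "cmod b"] by (simp add: power2_sum)
  finally show ?thesis .
qed

lemma L2_funsD: assumes "f \<in> L2_funs M"
  shows "f \<in> borel_measurable M" "integrable M (\<lambda>x. (cmod (f x))\<^sup>2)"
  using assms by (auto simp: L2_funs_def)

lemma L2_funsI_bound:
  assumes "f \<in> borel_measurable M" "integrable M g" "\<And>x. (cmod (f x))\<^sup>2 \<le> g x"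
  shows "f \<in> L2_funs M"
proof -
  have "integrable M (\<lambda>x. (cmod (f x))\<^sup>2)"
    by (rule Bochner_Integration.integrable_bound[OF assms(2)])
       (use assms in \<open>auto intro!: AE_I2 order_trans[OF assms(3) abs_ge_self]\<close>)
  then show ?thesis using assms(1) by (simp add: L2_funs_def)
qed

lemma L2_funs_iff_nn_integral: "f \<in> L2_funs M \<longleftrightarrow>
    f \<in> borel_measurable M \<and> (\<integral>\<^sup>+x. ennreal ((cmod (f x))\<^sup>2) \<partial>M) < \<infinity>"
  by (auto simp: L2_funs_def integrable_iff_bounded)

lemma L2_add: assumes "f \<in> L2_funs M" "g \<in> L2_funs M" shows "(\<lambda>x. f x + g x) \<in> L2_funs M"
  by (rule L2_funsI_bound[where g = "\<lambda>x. 2 * (cmod (f x))\<^sup>2 + 2 * (cmod (g x))\<^sup>2"])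
     (use L2_funsD[OF assms(1)] L2_funsD[OF assms(2)] in \<open>auto intro: cmod_add_sq_le\<close>)

lemma L2_bounded_mult:
  assumes "f \<in> L2_funs M" "h \<in> borel_measurable M" "\<And>x. cmod (h x) \<le> K"
  shows "(\<lambda>x. h x * f x) \<in> L2_funs M"
proof (rule L2_funsI_bound[where g = "\<lambda>x. K\<^sup>2 * (cmod (f x))\<^sup>2"])
  fix x
  have "(cmod (h x))\<^sup>2 \<le> K\<^sup>2" using assms(3) by (intro power_mono) auto
  then show "(cmod (h x * f x))\<^sup>2 \<le> K\<^sup>2 * (cmod (f x))\<^sup>2"
    by (simp add: norm_mult power_mult_distrib mult_right_mono)
qed (use L2_funsD[OF assms(1)] assms(2) in auto)

lemma L2_scale: "f \<in> L2_funs M \<Longrightarrow> (\<lambda>x. c * f x) \<in> L2_funs M"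
  by (rule L2_bounded_mult[where K = "cmod c"]) auto

lemma L2_diff: assumes "f \<in> L2_funs M" "g \<in> L2_funs M" shows "(\<lambda>x. f x - g x) \<in> L2_funs M"
  using L2_add[OF assms(1) L2_scale[OF assms(2), of "- 1"]] by simp

lemma L2_zero: "(\<lambda>x. 0) \<in> L2_funs M" by (simp add: L2_funs_def)

lemma measurable_cnj_comp [measurable (raw)]:
  "f \<in> borel_measurable M \<Longrightarrow> (\<lambda>x. cnj (f x)) \<in> borel_measurable M"
  by (rule borel_measurable_continuous_on[where f = cnj]) (intro continuous_intros)

lemma L2_prod_integrable: assumes "f \<in> L2_funs M" "g \<in> L2_funs M"
  shows "integrable M (\<lambda>x. cnj (f x) * g x)"
proof (rule Bochner_Integration.integrable_bound)
  show "integrable M (\<lambda>x. (cmod (f x))\<^sup>2 + (cmod (g x))\<^sup>2)"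
    using L2_funsD(2)[OF assms(1)] L2_funsD(2)[OF assms(2)] by simp
  show "(\<lambda>x. cnj (f x) * g x) \<in> borel_measurable M" using assms[THEN L2_funsD(1)] by measurable
  show "AE x in M. norm (cnj (f x) * g x) \<le> norm ((cmod (f x))\<^sup>2 + (cmod (g x))\<^sup>2)"
  proof (rule AE_I2)
    fix x
    have "2 * cmod (f x) * cmod (g x) \<le> (cmod (f x))\<^sup>2 + (cmod (g x))\<^sup>2" by (rule sum_squares_bound)
    moreover have "0 \<le> cmod (f x) * cmod (g x)" by simp
    ultimately have "cmod (f x) * cmod (g x) \<le> (cmod (f x))\<^sup>2 + (cmod (g x))\<^sup>2" by linarith
    then show "norm (cnj (f x) * g x) \<le> norm ((cmod (f x))\<^sup>2 + (cmod (g x))\<^sup>2)"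
      by (simp add: norm_mult)
  qed
qed

lemma equiv_ae_rel: "equiv (L2_funs M) (ae_rel M)"
proof (rule equivI)
  show "ae_rel M \<subseteq> L2_funs M \<times> L2_funs M" by (auto simp: ae_rel_def)
  show "refl_on (L2_funs M) (ae_rel M)" by (auto simp: refl_on_def ae_rel_def)
  show "sym (ae_rel M)"
    by (rule symI) (auto simp: ae_rel_def elim!: AE_mp)
  show "trans (ae_rel M)"
  proof (rule transI)
    fix f g h assume "(f, g) \<in> ae_rel M" "(g, h) \<in> ae_rel M"
    then show "(f, h) \<in> ae_rel M" by (auto simp: ae_rel_def elim: AE_mp)
  qed
qed

lemma L2_class_eq_iff: assumes "f \<in> L2_funs M" "g \<in> L2_funs M"
  shows "L2_class M f = L2_class M g \<longleftrightarrow> (AE x in M. f x = g x)"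
  unfolding L2_class_def using eq_equiv_class_iff[OF equiv_ae_rel assms] assms
  by (simp add: ae_rel_def)

lemma L2_class_closed: "f \<in> L2_funs M \<Longrightarrow> L2_class M f \<in> hcarrier (L2_space M)"
  by (simp add: L2_space_def L2_class_def quotientI)

lemma L2_class_cases:
  assumes "U \<in> hcarrier (L2_space M)"
  obtains f where "f \<in> L2_funs M" "U = L2_class M f"
  using assms by (auto simp: L2_space_def L2_class_def elim: quotientE)

lemma L2_rep_class: assumes "f \<in> L2_funs M"
  shows "L2_rep (L2_class M f) \<in> L2_funs M" "AE x in M. L2_rep (L2_class M f) x = f x"
proof -
  have "f \<in> L2_class M f" using assms by (simp add: L2_class_def ae_rel_def)
  then have "L2_rep (L2_class M f) \<in> L2_class M f" unfolding L2_rep_def by (rule someI[of "\<lambda>f'. f' \<in> L2_class M f"])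
  then have "(f, L2_rep (L2_class M f)) \<in> ae_rel M" by (simp add: L2_class_def)
  then show "L2_rep (L2_class M f) \<in> L2_funs M" "AE x in M. L2_rep (L2_class M f) x = f x"
    by (auto simp: ae_rel_def elim: AE_mp)
qed

lemma L2_rep_closed: assumes "U \<in> hcarrier (L2_space M)"
  shows "L2_rep U \<in> L2_funs M" "L2_class M (L2_rep U) = U"
proof -
  obtain f where f: "f \<in> L2_funs M" "U = L2_class M f" by (rule L2_class_cases[OF assms])
  show "L2_rep U \<in> L2_funs M" using L2_rep_class f by simp
  then show "L2_class M (L2_rep U) = U" using f L2_rep_class[OF f(1)] by (simp add: L2_class_eq_iff)
qed

context
  fixes M :: "'a measure" and f g :: "'a \<Rightarrow> complex"
  assumes f: "f \<in> L2_funs M" and g: "g \<in> L2_funs M"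
begin

lemma L2_hadd: "hadd (L2_space M) (L2_class M f) (L2_class M g) = L2_class M (\<lambda>x. f x + g x)"
proof -
  have "AE x in M. L2_rep (L2_class M f) x + L2_rep (L2_class M g) x = f x + g x"
    using L2_rep_class(2)[OF f] L2_rep_class(2)[OF g] by eventually_elim simp
  then show ?thesis by (simp add: L2_space_def L2_class_eq_iff L2_add L2_rep_class f g)
qed

lemma L2_hscale: "hscale (L2_space M) c (L2_class M f) = L2_class M (\<lambda>x. c * f x)"
proof -
  have "AE x in M. c * L2_rep (L2_class M f) x = c * f x"
    using L2_rep_class(2)[OF f] by eventually_elim simp
  then show ?thesis by (simp add: L2_space_def L2_class_eq_iff L2_scale L2_rep_class f)
qed

lemma L2_hinner: "hinner (L2_space M) (L2_class M f) (L2_class M g) = (LINT x|M. cnj (f x) * g x)"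
proof -
  have [measurable]: "f \<in> borel_measurable M" "g \<in> borel_measurable M"
      "L2_rep (L2_class M f) \<in> borel_measurable M" "L2_rep (L2_class M g) \<in> borel_measurable M"
    using L2_funsD f g L2_rep_class by blast+
  have "hinner (L2_space M) (L2_class M f) (L2_class M g)
      = (LINT x|M. cnj (L2_rep (L2_class M f) x) * L2_rep (L2_class M g) x)" by (simp add: L2_space_def)
  also have "\<dots> = (LINT x|M. cnj (f x) * g x)"
  proof (rule integral_cong_AE)
    show "AE x in M. cnj (L2_rep (L2_class M f) x) * L2_rep (L2_class M g) x = cnj (f x) * g x"
      using L2_rep_class(2)[OF f] L2_rep_class(2)[OF g] by eventually_elim simp
  qed measurable
  finally show ?thesis .
qed

lemma L2_mult_op:
  assumes "h \<in> borel_measurable M" "\<And>x. cmod (h x) \<le> K"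
  shows "mult_op M h (L2_class M f) = L2_class M (\<lambda>x. h x * f x)"
proof -
  have "AE x in M. h x * L2_rep (L2_class M f) x = h x * f x"
    using L2_rep_class(2)[OF f] by eventually_elim simp
  then show ?thesis
    using L2_class_eq_iff[OF L2_bounded_mult[OF L2_rep_class(1)[OF f] assms] L2_bounded_mult[OF f assms]]
    by (simp add: mult_op_def L2_class_closed f)
qed

end

lemma L2_hzero: "hzero (L2_space M) = L2_class M (\<lambda>x. 0)" by (simp add: L2_space_def)

lemmas L2_closed = L2_add L2_scale L2_diff L2_zero L2_class_closed

lemma L2_inner_self: assumes "f \<in> L2_funs M"
  shows "hinner (L2_space M) (L2_class M f) (L2_class M f) = complex_of_real (LINT x|M. (cmod (f x))\<^sup>2)"
proof -
  have "cnj (f x) * f x = complex_of_real ((cmod (f x))\<^sup>2)" for x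
    using complex_norm_square[of "f x"] by (simp add: mult.commute)
  then show ?thesis using assms by (simp add: L2_hinner flip: integral_complex_of_real)
qed

lemma inner_space_L2: "inner_space (L2_space M)"
proof
  fix u v w :: "('a \<Rightarrow> complex) set" and a b :: complex
  show "hzero (L2_space M) \<in> hcarrier (L2_space M)" by (simp add: L2_hzero L2_closed)
  assume "u \<in> hcarrier (L2_space M)"
  then obtain f where f: "f \<in> L2_funs M" and u: "u = L2_class M f" by (rule L2_class_cases)
  show "hscale (L2_space M) a u \<in> hcarrier (L2_space M)"
    using f by (simp add: u L2_hscale L2_closed)
  show "hadd (L2_space M) u (hzero (L2_space M)) = u"
    using f by (simp add: u L2_hzero L2_hadd L2_closed)
  show "hadd (L2_space M) u (hscale (L2_space M) (- 1) u) = hzero (L2_space M)"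
    using f L2_scale[OF f, of "- 1"] by (simp add: u L2_hzero L2_hadd L2_hscale L2_closed)
  show "hscale (L2_space M) 1 u = u" using f by (simp add: u L2_hscale)
  show "hscale (L2_space M) a (hscale (L2_space M) b u) = hscale (L2_space M) (a * b) u"
    using f by (simp add: u L2_hscale L2_closed mult.assoc)
  show "hscale (L2_space M) (a + b) u = hadd (L2_space M) (hscale (L2_space M) a u) (hscale (L2_space M) b u)"
    using f by (simp add: u L2_hscale L2_hadd L2_closed distrib_right)
  have uu: "hinner (L2_space M) u u = complex_of_real (LINT x|M. (cmod (f x))\<^sup>2)"
    unfolding u by (rule L2_inner_self[OF f])
  show "0 \<le> Re (hinner (L2_space M) u u)" by (simp add: uu)
  show "u = hzero (L2_space M)" if "hinner (L2_space M) u u = 0"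
  proof -
    have "(LINT x|M. (cmod (f x))\<^sup>2) = 0" using that uu by simp
    then have "AE x in M. (cmod (f x))\<^sup>2 = 0"
      using integral_nonneg_eq_0_iff_AE[of M "\<lambda>x. (cmod (f x))\<^sup>2"] L2_funsD[OF f] by simp
    then show ?thesis using f by (simp add: u L2_hzero L2_class_eq_iff L2_closed)
  qed
  assume "v \<in> hcarrier (L2_space M)"
  then obtain g where g: "g \<in> L2_funs M" and v: "v = L2_class M g" by (rule L2_class_cases)
  show "hadd (L2_space M) u v \<in> hcarrier (L2_space M)" using f g by (simp add: u v L2_hadd L2_closed)
  show "hadd (L2_space M) u v = hadd (L2_space M) v u"
    using f g by (simp add: u v L2_hadd add.commute)
  show "hscale (L2_space M) a (hadd (L2_space M) u v) = hadd (L2_space M) (hscale (L2_space M) a u) (hscale (L2_space M) a v)"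
    using f g by (simp add: u v L2_hadd L2_hscale L2_closed distrib_left)
  show "hinner (L2_space M) u (hscale (L2_space M) a v) = a * hinner (L2_space M) u v"
    using f g L2_prod_integrable[OF f g] by (simp add: u v L2_hscale L2_hinner L2_closed mult.left_commute)
  show "hinner (L2_space M) u v = cnj (hinner (L2_space M) v u)"
    using f g Bochner_Integration.integral_cnj[of M "\<lambda>x. cnj (g x) * f x"]
    by (simp add: u v L2_hinner mult.commute)
  assume "w \<in> hcarrier (L2_space M)"
  then obtain h where h: "h \<in> L2_funs M" and w: "w = L2_class M h" by (rule L2_class_cases)
  show "hadd (L2_space M) (hadd (L2_space M) u v) w = hadd (L2_space M) u (hadd (L2_space M) v w)"
    using f g h by (simp add: u v w L2_hadd L2_closed add.assoc)
  show "hinner (L2_space M) u (hadd (L2_space M) v w) = hinner (L2_space M) u v + hinner (L2_space M) u w"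
    using f g h L2_prod_integrable[OF f g] L2_prod_integrable[OF f h]
    by (simp add: u v w L2_hadd L2_hinner L2_closed distrib_left)
qed

lemma L2_hminus: assumes "f \<in> L2_funs M" "g \<in> L2_funs M"
  shows "hminus (L2_space M) (L2_class M f) (L2_class M g) = L2_class M (\<lambda>x. f x - g x)"
  using assms L2_scale[OF assms(2), of "- 1"] by (simp add: hminus_def L2_hscale L2_hadd)

lemma L2_hnorm_sq: assumes "f \<in> L2_funs M"
  shows "(hnorm (L2_space M) (L2_class M f))\<^sup>2 = (LINT x|M. (cmod (f x))\<^sup>2)"
  using L2_inner_self[OF assms] by (simp add: hnorm_def)

lemma L2_fatou:
  assumes g [measurable]: "g \<in> borel_measurable M" and h: "h \<in> L2_funs M" and f: "\<And>k. f k \<in> L2_funs M"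
    and lim: "AE x in M. (\<lambda>k. f k x) \<longlonglongrightarrow> g x"
    and bound: "\<And>k. k \<ge> K \<Longrightarrow> (LINT x|M. (cmod (f k x - h x))\<^sup>2) \<le> c"
  shows "(\<lambda>x. g x - h x) \<in> L2_funs M" "(LINT x|M. (cmod (g x - h x))\<^sup>2) \<le> c"
proof -
  have [measurable]: "h \<in> borel_measurable M" "\<And>k. f k \<in> borel_measurable M" using h f L2_funsD by blast+
  have "0 \<le> (LINT x|M. (cmod (f K x - h x))\<^sup>2)" by simp
  also have "\<dots> \<le> c" by (rule bound) simp
  finally have c: "0 \<le> c" .
  have "(\<integral>\<^sup>+x. ennreal ((cmod (g x - h x))\<^sup>2) \<partial>M) \<le> (\<integral>\<^sup>+x. liminf (\<lambda>k. ennreal ((cmod (f k x - h x))\<^sup>2)) \<partial>M)"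
  proof (rule nn_integral_mono_AE)
    show "AE x in M. ennreal ((cmod (g x - h x))\<^sup>2) \<le> liminf (\<lambda>k. ennreal ((cmod (f k x - h x))\<^sup>2))"
      using lim
    proof eventually_elim
      case (elim x)
      have "(\<lambda>k. ennreal ((cmod (f k x - h x))\<^sup>2)) \<longlonglongrightarrow> ennreal ((cmod (g x - h x))\<^sup>2)"
        by (intro tendsto_ennrealI tendsto_intros elim)
      from lim_imp_Liminf[OF sequentially_bot this] show ?case by simp
    qed
  qed
  also have "\<dots> \<le> liminf (\<lambda>k. \<integral>\<^sup>+x. ennreal ((cmod (f k x - h x))\<^sup>2) \<partial>M)"
    by (rule nn_integral_liminf) measurable
  also have "\<dots> \<le> liminf (\<lambda>k. ennreal c)"
  proof (rule Liminf_mono)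
    show "\<forall>\<^sub>F k in sequentially. (\<integral>\<^sup>+x. ennreal ((cmod (f k x - h x))\<^sup>2) \<partial>M) \<le> ennreal c"
      using eventually_ge_at_top[of K]
    proof eventually_elim
      case (elim k)
      have "(\<integral>\<^sup>+x. ennreal ((cmod (f k x - h x))\<^sup>2) \<partial>M) = ennreal (LINT x|M. (cmod (f k x - h x))\<^sup>2)"
        using L2_funsD(2)[OF L2_diff[OF f h]] by (intro nn_integral_eq_integral) auto
      then show ?case using bound[OF elim] by (simp add: ennreal_leI)
    qed
  qed
  also have "\<dots> = ennreal c" by (simp add: Liminf_const)
  finally have le: "(\<integral>\<^sup>+x. ennreal ((cmod (g x - h x))\<^sup>2) \<partial>M) \<le> ennreal c" .
  then show L2: "(\<lambda>x. g x - h x) \<in> L2_funs M"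
    unfolding L2_funs_iff_nn_integral by (auto intro: le_less_trans)
  have "(\<integral>\<^sup>+x. ennreal ((cmod (g x - h x))\<^sup>2) \<partial>M) = ennreal (LINT x|M. (cmod (g x - h x))\<^sup>2)"
    using L2_funsD(2)[OF L2] by (intro nn_integral_eq_integral) auto
  then show "(LINT x|M. (cmod (g x - h x))\<^sup>2) \<le> c" using le c by (simp add: ennreal_le_iff)
qed

text \<open>A rapidly Cauchy subsequence converges almost everywhere because its increments are
  absolutely summable in \<open>L\<^sup>1\<close>.\<close>

lemma L2_cauchy_AE_subseq:
  fixes f :: "nat \<Rightarrow> 'a \<Rightarrow> complex"
  assumes fin: "finite_measure M" and f: "\<And>n. f n \<in> L2_funs M"
    and cauchy: "\<And>\<epsilon>. \<epsilon> > 0 \<Longrightarrow> \<exists>N. \<forall>m\<ge>N. \<forall>n\<ge>N. (LINT x|M. (cmod (f m x - f n x))\<^sup>2) < \<epsilon>"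
  shows "\<exists>g r. g \<in> L2_funs M \<and> strict_mono r \<and> (AE x in M. (\<lambda>k. f (r k) x) \<longlonglongrightarrow> g x)"
proof -
  interpret finite_measure M by fact
  have [measurable]: "\<And>n. f n \<in> borel_measurable M" using f L2_funsD by blast
  have "\<exists>N. \<forall>m\<ge>N. \<forall>n\<ge>N. (LINT x|M. (cmod (f m x - f n x))\<^sup>2) < (1/4) ^ k" for k :: nat
    by (rule cauchy) simp
  then obtain N where N: "\<And>k m n. m \<ge> N k \<Longrightarrow> n \<ge> N k \<Longrightarrow> (LINT x|M. (cmod (f m x - f n x))\<^sup>2) < (1/4) ^ k"
    by metis
  \<comment> \<open>The summand \<open>k\<close> makes \<open>r\<close> strictly increasing, and the sum dominates \<open>N k\<close>.\<close>
  define r where "r k = k + (\<Sum>i\<le>k. N i)" for k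
  have rN: "N k \<le> r k" for k
    using member_le_sum[of k "{..k}" N] by (simp add: r_def)
  have mono: "strict_mono r" by (rule strict_mono_Suc_iff[THEN iffD2]) (simp add: r_def)
  define d where "d k x = cmod (f (r (Suc k)) x - f (r k) x)" for k x
  have [measurable]: "d k \<in> borel_measurable M" for k unfolding d_def by measurable
  have d1: "(\<integral>\<^sup>+x. ennreal (d k x) \<partial>M) \<le> ennreal ((measure M (space M) + 1) * (1/2) ^ k)" for k
  proof -
    have int: "integrable M (\<lambda>x. (d k x)\<^sup>2)" unfolding d_def by (rule L2_funsD(2)[OF L2_diff[OF f f]])
    have "N k \<le> r (Suc k)" using rN[of k] mono by (meson le_trans lessI less_or_eq_imp_le strict_mono_less)
    then have lt: "(LINT x|M. (d k x)\<^sup>2) < (1/4) ^ k" unfolding d_def using N rN by blast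
    \<comment> \<open>The measure is finite, so this elementary inequality bounds \<open>L\<^sup>1\<close> by \<open>L\<^sup>2\<close> increments.\<close>
    have le: "d k x \<le> (1/2) ^ k + 2 ^ k * (d k x)\<^sup>2" for x
    proof -
      define c :: real where "c = (1/2) ^ k"
      have c: "c > 0" "2 ^ k = 1 / c" by (simp_all add: c_def power_one_over)
      have "2 * c * d k x \<le> c\<^sup>2 + (d k x)\<^sup>2" by (rule sum_squares_bound)
      then have "2 * d k x \<le> c + 1 / c * (d k x)\<^sup>2" using c(1) by (simp add: field_simps power2_eq_square)
      then have "2 * d k x \<le> (1/2) ^ k + 2 ^ k * (d k x)\<^sup>2" unfolding c(2) by (simp add: c_def)
      moreover have "0 \<le> d k x" by (simp add: d_def)
      ultimately show ?thesis by linarith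
    qed
    have int2: "integrable M (\<lambda>x. (1/2) ^ k + 2 ^ k * (d k x)\<^sup>2)" using int by simp
    have "(\<integral>\<^sup>+x. ennreal (d k x) \<partial>M) \<le> (\<integral>\<^sup>+x. ennreal ((1/2) ^ k + 2 ^ k * (d k x)\<^sup>2) \<partial>M)"
      by (intro nn_integral_mono ennreal_leI le)
    also have "\<dots> = ennreal (LINT x|M. (1/2) ^ k + 2 ^ k * (d k x)\<^sup>2)"
      by (intro nn_integral_eq_integral int2) auto
    also have "(LINT x|M. (1/2) ^ k + 2 ^ k * (d k x)\<^sup>2) = (1/2) ^ k * measure M (space M) + 2 ^ k * (LINT x|M. (d k x)\<^sup>2)"
      using int by simp
    also have "\<dots> \<le> (1/2) ^ k * measure M (space M) + 2 ^ k * (1/4) ^ k"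
      using lt by (intro add_left_mono mult_left_mono) auto
    also have "\<dots> = (measure M (space M) + 1) * (1/2) ^ k"
      by (simp add: algebra_simps flip: power_mult_distrib)
    finally show ?thesis by (simp add: ennreal_leI)
  qed
  have "(\<integral>\<^sup>+x. (\<Sum>k. ennreal (d k x)) \<partial>M) = (\<Sum>k. \<integral>\<^sup>+x. ennreal (d k x) \<partial>M)"
    by (rule nn_integral_suminf) measurable
  also have "\<dots> \<le> (\<Sum>k. ennreal ((measure M (space M) + 1) * (1/2) ^ k))"
    by (intro suminf_le d1) auto
  also have "\<dots> < \<infinity>"
  proof -
    have "summable (\<lambda>k. (measure M (space M) + 1) * (1/2) ^ k :: real)" by (intro summable_mult summable_geometric) simp
    then show ?thesis by (subst suminf_ennreal2) (auto intro: mult_nonneg_nonneg add_nonneg_nonneg)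
  qed
  finally have "AE x in M. (\<Sum>k. ennreal (d k x)) \<noteq> \<infinity>"
    by (intro nn_integral_PInf_AE) auto
  then have conv: "AE x in M. convergent (\<lambda>k. f (r k) x)"
  proof eventually_elim
    case (elim x)
    have "summable (\<lambda>k. d k x)"
      using elim by (intro summable_suminf_not_top) (auto simp: d_def)
    then have "summable (\<lambda>k. f (r (Suc k)) x - f (r k) x)" unfolding d_def by (rule summable_norm_cancel)
    then have "convergent (\<lambda>n. \<Sum>k<n. f (r (Suc k)) x - f (r k) x)" by (simp add: summable_iff_convergent)
    then have "convergent (\<lambda>n. f (r n) x - f (r 0) x)"
      by (simp only: sum_lessThan_telescope[of "\<lambda>k. f (r k) x"])
    then have "convergent (\<lambda>n. f (r n) x - f (r 0) x + f (r 0) x)" by (intro convergent_add convergent_const)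
    then show ?case by simp
  qed
  define g where "g x = lim (\<lambda>k. f (r k) x)" for x
  have [measurable]: "g \<in> borel_measurable M" unfolding g_def by measurable
  have lim: "AE x in M. (\<lambda>k. f (r k) x) \<longlonglongrightarrow> g x"
    using conv by eventually_elim (simp add: g_def convergent_LIMSEQ_iff)
  obtain N0 where N0: "\<And>m n. m \<ge> N0 \<Longrightarrow> n \<ge> N0 \<Longrightarrow> (LINT x|M. (cmod (f m x - f n x))\<^sup>2) < 1"
    using cauchy[of 1] by auto
  have "(\<lambda>x. g x - f N0 x) \<in> L2_funs M"
  proof (rule L2_fatou(1)[where f = "\<lambda>k. f (r k)" and K = N0 and c = 1])
    show "AE x in M. (\<lambda>k. f (r k) x) \<longlonglongrightarrow> g x" by (rule lim)
    fix k assume "k \<ge> N0"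
    then have "r k \<ge> N0" using seq_suble[OF mono, of k] by linarith
    then show "(LINT x|M. (cmod (f (r k) x - f N0 x))\<^sup>2) \<le> 1" using N0[of "r k" N0] by simp
  qed (use f in auto)
  from L2_add[OF this f[of N0]] have "g \<in> L2_funs M" by simp
  then show ?thesis using mono lim by blast
qed

text \<open>Fatou's lemma along the subsequence bounds the distance from \<open>f n\<close> to \<open>g\<close> by the distances
  between late members of the sequence.\<close>

lemma L2_cauchy_limit:
  fixes f :: "nat \<Rightarrow> 'a \<Rightarrow> complex"
  assumes f: "\<And>n. f n \<in> L2_funs M" and g: "g \<in> borel_measurable M"
    and cauchy: "\<And>\<epsilon>. \<epsilon> > 0 \<Longrightarrow> \<exists>N. \<forall>m\<ge>N. \<forall>n\<ge>N. (LINT x|M. (cmod (f m x - f n x))\<^sup>2) < \<epsilon>"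
    and r: "strict_mono r" and lim: "AE x in M. (\<lambda>k. f (r k) x) \<longlonglongrightarrow> g x"
  shows "g \<in> L2_funs M" "(\<lambda>n. LINT x|M. (cmod (f n x - g x))\<^sup>2) \<longlonglongrightarrow> 0"
proof -
  have *: "\<exists>N. \<forall>n\<ge>N. (\<lambda>x. g x - f n x) \<in> L2_funs M \<and> (LINT x|M. (cmod (g x - f n x))\<^sup>2) \<le> \<epsilon>" if \<epsilon>: "\<epsilon> > 0" for \<epsilon>
  proof -
    obtain N where N: "\<And>m n. m \<ge> N \<Longrightarrow> n \<ge> N \<Longrightarrow> (LINT x|M. (cmod (f m x - f n x))\<^sup>2) < \<epsilon>"
      using cauchy[OF \<epsilon>] by auto
    have "(\<lambda>x. g x - f n x) \<in> L2_funs M \<and> (LINT x|M. (cmod (g x - f n x))\<^sup>2) \<le> \<epsilon>" if n: "n \<ge> N" for n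
    proof -
      have "(LINT x|M. (cmod (f (r k) x - f n x))\<^sup>2) \<le> \<epsilon>" if "k \<ge> N" for k
        using N[of "r k" n] seq_suble[OF r, of k] that n by simp
      from L2_fatou[OF g f _ lim this] show ?thesis using f by blast
    qed
    then show ?thesis by blast
  qed
  obtain n where "(\<lambda>x. g x - f n x) \<in> L2_funs M" using *[of 1] by auto
  from L2_add[OF this f[of n]] show "g \<in> L2_funs M" by simp
  show "(\<lambda>n. LINT x|M. (cmod (f n x - g x))\<^sup>2) \<longlonglongrightarrow> 0"
  proof (rule LIMSEQ_I)
    fix \<epsilon> :: real assume "0 < \<epsilon>"
    then obtain N where N: "\<And>n. n \<ge> N \<Longrightarrow> (LINT x|M. (cmod (g x - f n x))\<^sup>2) \<le> \<epsilon> / 2"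
      using *[of "\<epsilon> / 2"] by auto
    have "norm ((LINT x|M. (cmod (f n x - g x))\<^sup>2) - 0) < \<epsilon>" if "n \<ge> N" for n
      using N[OF that] \<open>0 < \<epsilon>\<close> by (simp add: norm_minus_commute)
    then show "\<exists>N. \<forall>n\<ge>N. norm ((LINT x|M. (cmod (f n x - g x))\<^sup>2) - 0) < \<epsilon>" by blast
  qed
qed

lemma L2_space_cauchy_rep:
  assumes "inner_space.cauchy (L2_space M) U"
  obtains f where "\<And>n. f n \<in> L2_funs M" "\<And>n. U n = L2_class M (f n)"
    "\<And>\<epsilon>. \<epsilon> > 0 \<Longrightarrow> \<exists>N. \<forall>m\<ge>N. \<forall>n\<ge>N. (LINT x|M. (cmod (f m x - f n x))\<^sup>2) < \<epsilon>"
proof -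
  interpret inner_space "L2_space M" by (rule inner_space_L2)
  have U: "\<And>n. U n \<in> X" using assms by (simp add: cauchy_def)
  define f where "f n = L2_rep (U n)" for n
  have f: "f n \<in> L2_funs M" "U n = L2_class M (f n)" for n using L2_rep_closed[OF U] by (simp_all add: f_def)
  have "\<exists>N. \<forall>m\<ge>N. \<forall>n\<ge>N. (LINT x|M. (cmod (f m x - f n x))\<^sup>2) < \<epsilon>" if \<epsilon>: "\<epsilon> > 0" for \<epsilon>
  proof -
    obtain N where N: "\<And>m n. m \<ge> N \<Longrightarrow> n \<ge> N \<Longrightarrow> nrm (mns (U m) (U n)) < sqrt \<epsilon>"
      using assms \<epsilon> unfolding cauchy_def by (metis real_sqrt_gt_zero)
    have "(LINT x|M. (cmod (f m x - f n x))\<^sup>2) < \<epsilon>" if "m \<ge> N" "n \<ge> N" for m n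
    proof -
      have "(nrm (mns (U m) (U n)))\<^sup>2 < (sqrt \<epsilon>)\<^sup>2"
        using N[OF that] U by (intro power_strict_mono) simp_all
      then show ?thesis using \<epsilon> f by (simp add: L2_hminus L2_hnorm_sq L2_diff)
    qed
    then show ?thesis by blast
  qed
  then show thesis using that f by blast
qed

lemma hilbert_space_L2: assumes "finite_measure M" shows "complex_hilbert_space (L2_space M)"
proof (rule complex_hilbert_spaceI[OF inner_space_L2])
  interpret inner_space "L2_space M" by (rule inner_space_L2)
  fix U assume "cauchy U"
  then obtain f where f: "\<And>n. f n \<in> L2_funs M" "\<And>n. U n = L2_class M (f n)"
    and c: "\<And>\<epsilon>. \<epsilon> > 0 \<Longrightarrow> \<exists>N. \<forall>m\<ge>N. \<forall>n\<ge>N. (LINT x|M. (cmod (f m x - f n x))\<^sup>2) < \<epsilon>"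
    by (rule L2_space_cauchy_rep) blast
  obtain g r where g: "g \<in> L2_funs M" and r: "strict_mono r" "AE x in M. (\<lambda>k. f (r k) x) \<longlonglongrightarrow> g x"
    using L2_cauchy_AE_subseq[OF assms f(1) c] by blast
  have "(\<lambda>n. sqrt (LINT x|M. (cmod (f n x - g x))\<^sup>2)) \<longlonglongrightarrow> sqrt 0"
    by (intro tendsto_real_sqrt L2_cauchy_limit(2)[OF f(1) L2_funsD(1)[OF g] c r])
  moreover have "nrm (mns (U n) (L2_class M g)) = sqrt (LINT x|M. (cmod (f n x - g x))\<^sup>2)" for n
    using f g L2_hnorm_sq[OF L2_diff[OF f(1) g], of n]
    by (simp add: L2_hminus L2_closed real_sqrt_unique[symmetric])
  ultimately have "(\<lambda>n. nrm (mns (U n) (L2_class M g))) \<longlonglongrightarrow> 0" by simp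
  then show "\<exists>l\<in>X. (\<lambda>n. nrm (mns (U n) l)) \<longlonglongrightarrow> 0" using g L2_class_closed by blast
qed

section \<open>The logarithmic Dirichlet form\<close>

locale borel_metric_measure = finite_measure M
  for M :: "'a::{metric_space, second_countable_topology} measure" +
  fixes \<delta> :: real
  assumes sets_M [measurable_cong]: "sets M = sets borel"
begin

lemma space_M [simp]: "space M = UNIV"
  using sets_eq_imp_space_eq[OF sets_M] by simp

sublocale MM: pair_sigma_finite M M ..

abbreviation "P \<equiv> M \<Otimes>\<^sub>M M"

lemma finite_measure_P: "finite_measure P"
  by (rule finite_measure_pair_measure) (rule finite_measure_axioms)+

sublocale PP: finite_measure P by (rule finite_measure_P)

lemma AE_P: assumes "AE x in M. R x" shows "AE z in P. R (fst z) \<and> R (snd z)"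
proof -
  obtain N where N: "N \<in> null_sets M" "{x\<in>space M. \<not> R x} \<subseteq> N" using assms by (auto elim: AE_E simp: null_sets_def)
  have "N \<times> UNIV \<in> null_sets P" "UNIV \<times> N \<in> null_sets P"
    using N(1) sets.top[of M] by (auto simp: null_sets_def emeasure_pair_measure_Times)
  then have n: "N \<times> UNIV \<union> UNIV \<times> N \<in> null_sets P" by (rule null_sets.Un)
  show ?thesis
    by (rule AE_I'[OF n]) (use N(2) in auto)
qed

text \<open>The energy of \<open>f\<close> is half the squared \<open>L\<^sup>2(M \<Otimes> M)\<close> norm of the difference quotient \<open>diff_quot f\<close>, so
  the algebra of the form is that of an inner product.  On the diagonal the quotient is \<open>0 / 0 = 0\<close>.\<close>

definition sqrt_weight :: "'a \<times> 'a \<Rightarrow> real" where "sqrt_weight z = dist (fst z) (snd z) powr (\<delta> / 2)"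

definition diff_quot :: "('a \<Rightarrow> complex) \<Rightarrow> 'a \<times> 'a \<Rightarrow> complex"
  where "diff_quot f z = (f (fst z) - f (snd z)) / complex_of_real (sqrt_weight z)"

lemma dist_measurable_P [measurable]: "(\<lambda>z. dist (fst z) (snd z)) \<in> borel_measurable P"
  by (rule borel_measurable_dist) measurable

lemma sqrt_weight_measurable [measurable]: "sqrt_weight \<in> borel_measurable P"
  unfolding sqrt_weight_def by measurable

lemma measurable_fst_comp [measurable]: "f \<in> borel_measurable M \<Longrightarrow> (\<lambda>z. f (fst z)) \<in> borel_measurable P"
  and measurable_snd_comp [measurable]: "f \<in> borel_measurable M \<Longrightarrow> (\<lambda>z. f (snd z)) \<in> borel_measurable P"
  by (erule measurable_compose[OF measurable_fst], erule measurable_compose[OF measurable_snd])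

lemma diff_quot_measurable [measurable]: assumes "f \<in> borel_measurable M" shows "diff_quot f \<in> borel_measurable P"
  unfolding diff_quot_def using measurable_fst_comp[OF assms] measurable_snd_comp[OF assms] sqrt_weight_measurable
  by (intro borel_measurable_divide borel_measurable_diff) auto

lemma sqrt_weight_sq: "sqrt_weight z * sqrt_weight z = dist (fst z) (snd z) powr \<delta>"
  by (simp add: sqrt_weight_def flip: powr_add)

lemma diff_quot_sq: "(cmod (diff_quot f z))\<^sup>2 = (cmod (f (fst z) - f (snd z)))\<^sup>2 / dist (fst z) (snd z) powr \<delta>"
  using sqrt_weight_sq[of z] by (simp add: diff_quot_def norm_divide power_divide power2_eq_square[of "sqrt_weight z"])

lemma diff_quot_prod: "cnj (diff_quot f z) * diff_quot g z = cnj (f (fst z) - f (snd z)) * (g (fst z) - g (snd z))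
    / complex_of_real (dist (fst z) (snd z) powr \<delta>)"
  unfolding sqrt_weight_sq[symmetric] by (simp add: diff_quot_def)

lemma diff_quot_add: "diff_quot (\<lambda>x. f x + g x) = (\<lambda>z. diff_quot f z + diff_quot g z)"
  by (simp add: diff_quot_def fun_eq_iff add_divide_distrib diff_divide_distrib)

lemma diff_quot_scale: "diff_quot (\<lambda>x. c * f x) = (\<lambda>z. c * diff_quot f z)"
  by (simp add: diff_quot_def fun_eq_iff right_diff_distrib)

lemma diff_quot_diff: "diff_quot (\<lambda>x. f x - g x) = (\<lambda>z. diff_quot f z - diff_quot g z)"
  by (simp add: diff_quot_def fun_eq_iff diff_divide_distrib)

definition energy_funs :: "('a \<Rightarrow> complex) set"
  where "energy_funs = {f \<in> L2_funs M. diff_quot f \<in> L2_funs P}"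

lemma energy_funsD: assumes "f \<in> energy_funs"
  shows "f \<in> L2_funs M" "diff_quot f \<in> L2_funs P" "f \<in> borel_measurable M"
  using assms by (auto simp: energy_funs_def L2_funs_def)

lemma energy_add: "f \<in> energy_funs \<Longrightarrow> g \<in> energy_funs \<Longrightarrow> (\<lambda>x. f x + g x) \<in> energy_funs"
  by (simp add: energy_funs_def diff_quot_add L2_add)

lemma energy_scale: "f \<in> energy_funs \<Longrightarrow> (\<lambda>x. c * f x) \<in> energy_funs"
  by (simp add: energy_funs_def diff_quot_scale L2_scale)

lemma energy_diff: "f \<in> energy_funs \<Longrightarrow> g \<in> energy_funs \<Longrightarrow> (\<lambda>x. f x - g x) \<in> energy_funs"
  by (simp add: energy_funs_def diff_quot_diff L2_diff)

lemma energy_zero: "(\<lambda>x. 0) \<in> energy_funs"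
proof -
  have "diff_quot (\<lambda>x. 0) = (\<lambda>z. 0)" by (simp add: diff_quot_def fun_eq_iff)
  then show ?thesis by (simp add: energy_funs_def L2_zero)
qed

lemma nn_integral_diff_quot: assumes [measurable]: "f \<in> borel_measurable M"
  shows "(\<integral>\<^sup>+ x. \<integral>\<^sup>+ y. ennreal ((cmod (f x - f y))\<^sup>2 / dist x y powr \<delta>) \<partial>M \<partial>M)
    = (\<integral>\<^sup>+z. ennreal ((cmod (diff_quot f z))\<^sup>2) \<partial>P)"
  by (subst nn_integral_fst[symmetric]) (simp_all add: diff_quot_sq)

lemma diff_quot_AE: assumes "AE x in M. f x = g x" shows "AE z in P. diff_quot f z = diff_quot g z"
  using AE_P[OF assms] by eventually_elim (simp add: diff_quot_def)

abbreviation "L2 \<equiv> L2_space M"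
abbreviation "Q \<equiv> log_form_dom M \<delta>"
abbreviation "q \<equiv> log_form M \<delta>"
abbreviation "cls \<equiv> L2_class M"

lemma Q_iff: "U \<in> Q \<longleftrightarrow> U \<in> hcarrier L2 \<and> L2_rep U \<in> energy_funs"
proof -
  have "U \<in> Q \<longleftrightarrow> diff_quot (L2_rep U) \<in> L2_funs P" if U: "U \<in> hcarrier L2"
  proof -
    have [measurable]: "L2_rep U \<in> borel_measurable M" using L2_rep_closed[OF U] L2_funsD by blast
    show ?thesis using U by (simp add: log_form_dom_def nn_integral_diff_quot L2_funs_iff_nn_integral)
  qed
  moreover have "U \<in> Q \<Longrightarrow> U \<in> hcarrier L2" by (simp add: log_form_dom_def)
  ultimately show ?thesis using L2_rep_closed[of U M] by (auto simp: energy_funs_def)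
qed

lemma L2_funs_AE: assumes "f \<in> L2_funs N" "g \<in> borel_measurable N" "AE x in N. g x = f x" shows "g \<in> L2_funs N"
proof -
  have "(\<integral>\<^sup>+x. ennreal ((cmod (g x))\<^sup>2) \<partial>N) = (\<integral>\<^sup>+x. ennreal ((cmod (f x))\<^sup>2) \<partial>N)"
    by (rule nn_integral_cong_AE) (use assms(3) in eventually_elim, simp)
  then show ?thesis using assms by (simp add: L2_funs_iff_nn_integral)
qed

text \<open>Membership in the form domain does not depend on the representative, because functions that agree
  almost everywhere have difference quotients that agree almost everywhere on the product.\<close>

lemma energy_AE: assumes "f \<in> energy_funs" "g \<in> L2_funs M" "AE x in M. g x = f x" shows "g \<in> energy_funs"
  using assms L2_funs_AE[of "diff_quot f" P "diff_quot g"] diff_quot_AE[OF assms(3)] L2_funsD(1)[OF assms(2)]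
  by (simp add: energy_funs_def)

lemma cls_Q: "f \<in> energy_funs \<Longrightarrow> cls f \<in> Q"
  unfolding Q_iff using L2_rep_class[of f M] energy_AE[of f "L2_rep (cls f)"] L2_class_closed energy_funsD(1)
  by blast

lemma Q_cases: assumes "U \<in> Q" obtains f where "f \<in> energy_funs" "U = cls f"
  using assms L2_rep_closed(2)[of U M] unfolding Q_iff by metis

lemma q_cls: assumes f: "f \<in> energy_funs" and g: "g \<in> energy_funs"
  shows "q (cls f) (cls g) = 1 / 2 * (LINT z|P. cnj (diff_quot f z) * diff_quot g z)"
proof -
  let ?f = "L2_rep (cls f)" and ?g = "L2_rep (cls g)"
  have rep: "?f \<in> energy_funs" "?g \<in> energy_funs" using cls_Q f g by (simp_all add: Q_iff)
  have m [measurable]: "f \<in> borel_measurable M" "g \<in> borel_measurable M"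
    "?f \<in> borel_measurable M" "?g \<in> borel_measurable M" using f g rep energy_funsD by blast+
  have "q (cls f) (cls g) = 1 / 2 * (LINT x|M. LINT y|M. cnj (diff_quot ?f (x, y)) * diff_quot ?g (x, y))"
    by (simp add: log_form_def diff_quot_prod)
  also have "(LINT x|M. LINT y|M. cnj (diff_quot ?f (x, y)) * diff_quot ?g (x, y)) = (LINT z|P. cnj (diff_quot ?f z) * diff_quot ?g z)"
    by (rule MM.integral_fst') (intro L2_prod_integrable energy_funsD rep)
  also have "\<dots> = (LINT z|P. cnj (diff_quot f z) * diff_quot g z)"
  proof (rule integral_cong_AE)
    show "AE z in P. cnj (diff_quot ?f z) * diff_quot ?g z = cnj (diff_quot f z) * diff_quot g z"
      using diff_quot_AE[OF L2_rep_class(2)[OF energy_funsD(1)[OF f]]] diff_quot_AE[OF L2_rep_class(2)[OF energy_funsD(1)[OF g]]]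
      by eventually_elim simp
  qed measurable
  finally show ?thesis .
qed

lemma q_cls_self: assumes f: "f \<in> energy_funs"
  shows "q (cls f) (cls f) = complex_of_real (1 / 2 * (LINT z|P. (cmod (diff_quot f z))\<^sup>2))"
proof -
  have "q (cls f) (cls f) = 1 / 2 * hinner (L2_space P) (L2_class P (diff_quot f)) (L2_class P (diff_quot f))"
    using f by (simp add: q_cls L2_hinner energy_funsD)
  then show ?thesis using f by (simp add: L2_inner_self energy_funsD)
qed

lemma complex_hilbert_L2: "complex_hilbert_space L2"
  by (rule hilbert_space_L2) unfold_locales

sublocale L2: complex_hilbert_space L2 by (rule complex_hilbert_L2)

sublocale form: positive_form L2 Q q
proof
  show "Q \<subseteq> L2.X" by (auto simp: Q_iff)
  show "hzero L2 \<in> Q" using cls_Q[OF energy_zero] by (simp add: L2_hzero)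
  fix u v w a assume "u \<in> Q"
  then obtain f where f: "f \<in> energy_funs" and u: "u = cls f" by (rule Q_cases)
  note fd = energy_funsD(1,2)[OF f]
  show "hscale L2 a u \<in> Q" using f fd by (simp add: u L2_hscale cls_Q energy_scale)
  show "0 \<le> Re (q u u)" using f by (simp add: u q_cls_self)
  assume "v \<in> Q"
  then obtain g where g: "g \<in> energy_funs" and v: "v = cls g" by (rule Q_cases)
  note gd = energy_funsD(1,2)[OF g]
  show "hadd L2 u v \<in> Q" using f fd g gd by (simp add: u v L2_hadd cls_Q energy_add)
  show "q u (hscale L2 a v) = a * q u v"
    using f fd g gd by (simp add: u v L2_hscale q_cls energy_scale diff_quot_scale mult.left_commute)
  show "q u v = cnj (q v u)"
    using f fd g gd Bochner_Integration.integral_cnj[of P "\<lambda>z. cnj (diff_quot g z) * diff_quot f z"]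
    by (simp add: u v q_cls mult.commute)
  assume "w \<in> Q"
  then obtain h where h: "h \<in> energy_funs" and w: "w = cls h" by (rule Q_cases)
  note hd = energy_funsD(1,2)[OF h]
  show "q u (hadd L2 v w) = q u v + q u w"
    using f g h L2_prod_integrable[OF fd(2) gd(2)] L2_prod_integrable[OF fd(2) hd(2)]
    by (simp add: u v w L2_hadd fd gd hd q_cls energy_add diff_quot_add distrib_left)
qed

lemma form_norm_diff: assumes f: "f \<in> energy_funs" and g: "g \<in> energy_funs"
  shows "(hnorm form.form_space (hminus L2 (cls f) (cls g)))\<^sup>2 =
    (LINT x|M. (cmod (f x - g x))\<^sup>2) + 1 / 2 * (LINT z|P. (cmod (diff_quot f z - diff_quot g z))\<^sup>2)"
  using assms
  by (simp add: form.form_norm cls_Q energy_diff L2_hminus energy_funsD L2_hnorm_sq q_cls_self)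
     (simp add: diff_quot_diff)

text \<open>A Cauchy sequence for the form norm converges in \<open>L\<^sup>2\<close>, hence almost everywhere along a
  subsequence; the difference quotients then converge almost everywhere along the same
  subsequence.\<close>

lemma form_norm_complete:
  assumes "inner_space.cauchy form.form_space U"
  shows "\<exists>l\<in>Q. (\<lambda>n. hnorm form.form_space (hminus L2 (U n) l)) \<longlonglongrightarrow> 0"
proof -
  interpret fs: inner_space form.form_space by (rule form.inner_space_form_space)
  have UQ: "U n \<in> Q" for n using assms by (simp add: fs.cauchy_def)
  have "\<exists>f. f \<in> energy_funs \<and> U n = cls f" for n using Q_cases[OF UQ[of n]] by blast
  then obtain f where f: "\<And>n. f n \<in> energy_funs" and U: "\<And>n. U n = cls (f n)" by metis
  have c: "\<exists>N. \<forall>m\<ge>N. \<forall>n\<ge>N. (LINT x|M. (cmod (f m x - f n x))\<^sup>2) < \<epsilon>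
      \<and> (LINT z|P. (cmod (diff_quot (f m) z - diff_quot (f n) z))\<^sup>2) < \<epsilon>" if \<epsilon>: "\<epsilon> > 0" for \<epsilon>
  proof -
    obtain N where N: "\<And>m n. m \<ge> N \<Longrightarrow> n \<ge> N \<Longrightarrow> hnorm form.form_space (hminus L2 (U m) (U n)) < sqrt (\<epsilon> / 2)"
      using assms \<epsilon> unfolding fs.cauchy_def by (simp) (metis real_sqrt_gt_zero half_gt_zero)
    have "(LINT x|M. (cmod (f m x - f n x))\<^sup>2) < \<epsilon> \<and> (LINT z|P. (cmod (diff_quot (f m) z - diff_quot (f n) z))\<^sup>2) < \<epsilon>"
      if mn: "m \<ge> N" "n \<ge> N" for m n
    proof -
      have "(hnorm form.form_space (hminus L2 (U m) (U n)))\<^sup>2 < (sqrt (\<epsilon> / 2))\<^sup>2"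
        using N[OF mn] fs.nrm_nonneg[of "hminus L2 (U m) (U n)"] form.Q_minus[OF UQ UQ]
        by (intro power_strict_mono) simp_all
      then have "(LINT x|M. (cmod (f m x - f n x))\<^sup>2) + 1 / 2 * (LINT z|P. (cmod (diff_quot (f m) z - diff_quot (f n) z))\<^sup>2) < \<epsilon> / 2"
        using \<epsilon> by (simp add: U form_norm_diff[OF f f])
      moreover have "0 \<le> (LINT x|M. (cmod (f m x - f n x))\<^sup>2)" "0 \<le> (LINT z|P. (cmod (diff_quot (f m) z - diff_quot (f n) z))\<^sup>2)"
        by simp_all
      ultimately show ?thesis by linarith
    qed
    then show ?thesis by blast
  qed
  have c1: "\<exists>N. \<forall>m\<ge>N. \<forall>n\<ge>N. (LINT x|M. (cmod (f m x - f n x))\<^sup>2) < \<epsilon>" if "\<epsilon> > 0" for \<epsilon>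
    using c[OF that] by blast
  have c2: "\<exists>N. \<forall>m\<ge>N. \<forall>n\<ge>N. (LINT z|P. (cmod (diff_quot (f m) z - diff_quot (f n) z))\<^sup>2) < \<epsilon>" if "\<epsilon> > 0" for \<epsilon>
    using c[OF that] by blast
  have fL: "f n \<in> L2_funs M" and fP: "diff_quot (f n) \<in> L2_funs P" for n using f energy_funsD by blast+
  obtain g r where g: "g \<in> L2_funs M" and r: "strict_mono r" and lim: "AE x in M. (\<lambda>k. f (r k) x) \<longlonglongrightarrow> g x"
    using L2_cauchy_AE_subseq[OF finite_measure_axioms fL c1] by blast
  note gm = L2_funsD(1)[OF g]
  have l1: "(\<lambda>n. LINT x|M. (cmod (f n x - g x))\<^sup>2) \<longlonglongrightarrow> 0"
    by (rule L2_cauchy_limit(2)[OF fL gm c1 r lim])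
  have limP: "AE z in P. (\<lambda>k. diff_quot (f (r k)) z) \<longlonglongrightarrow> diff_quot g z"
    using AE_P[OF lim]
  proof eventually_elim
    case (elim z)
    have "(\<lambda>k. (f (r k) (fst z) - f (r k) (snd z)) * (1 / complex_of_real (sqrt_weight z)))
        \<longlonglongrightarrow> (g (fst z) - g (snd z)) * (1 / complex_of_real (sqrt_weight z))"
      using elim by (intro tendsto_intros) auto
    then show ?case by (simp add: diff_quot_def)
  qed
  note l2 = L2_cauchy_limit[OF fP diff_quot_measurable[OF gm] c2 r limP]
  have ge: "g \<in> energy_funs" using g l2(1) by (simp add: energy_funs_def)
  have "(\<lambda>n. (LINT x|M. (cmod (f n x - g x))\<^sup>2) + 1 / 2 * (LINT z|P. (cmod (diff_quot (f n) z - diff_quot g z))\<^sup>2)) \<longlonglongrightarrow> 0 + 1 / 2 * 0"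
    by (intro tendsto_intros l1 l2(2))
  then have "(\<lambda>n. sqrt ((hnorm form.form_space (hminus L2 (U n) (cls g)))\<^sup>2)) \<longlonglongrightarrow> sqrt 0"
    by (intro tendsto_real_sqrt) (simp add: U form_norm_diff[OF f ge])
  moreover have "0 \<le> hnorm form.form_space (hminus L2 (U n) (cls g))" for n
    using form.Q_minus[OF UQ cls_Q[OF ge]] by (intro fs.nrm_nonneg) simp
  ultimately show ?thesis using cls_Q[OF ge] by (intro bexI[of _ "cls g"]) simp_all
qed

end

section \<open>Multiplication operators and commutators\<close>

lemma mult_op_bounded:
  assumes h: "h \<in> borel_measurable M" "\<And>x. cmod (h x) \<le> K"
  shows "mult_op M h \<in> bounded_ops (L2_space M)"
proof -
  interpret inner_space "L2_space M" by (rule inner_space_L2)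
  have K: "0 \<le> K" using h(2)[of undefined] norm_ge_zero order_trans by blast
  note mo = L2_mult_op[OF _ _ h] and bm = L2_bounded_mult[OF _ h]
  show ?thesis
    unfolding bounded_ops_def
  proof (intro CollectI conjI ballI allI exI)
    have "mult_op M h u \<in> X" if u: "u \<in> X" for u
    proof -
      obtain f where "f \<in> L2_funs M" "u = L2_class M f" using L2_class_cases[OF u] .
      then show ?thesis by (simp add: mo[of f f] bm L2_class_closed)
    qed
    then show "mult_op M h \<in> X \<rightarrow>\<^sub>E X" by (auto simp: mult_op_def)
    fix u assume "u \<in> X"
    then obtain f where f: "f \<in> L2_funs M" and u: "u = L2_class M f" by (rule L2_class_cases)
    show "mult_op M h (hscale (L2_space M) a u) = hscale (L2_space M) a (mult_op M h u)" for a
      using f by (simp add: u L2_hscale mo[of f f] mo[of "\<lambda>x. a * f x" f] bm L2_scale mult.left_commute)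
    show "nrm (mult_op M h u) \<le> K * nrm u"
    proof -
      have "(nrm (mult_op M h u))\<^sup>2 = (LINT x|M. (cmod (h x * f x))\<^sup>2)"
        using f by (simp add: u mo[of f f] bm L2_hnorm_sq)
      also have "\<dots> \<le> (LINT x|M. K\<^sup>2 * (cmod (f x))\<^sup>2)"
      proof (rule integral_mono)
        show "integrable M (\<lambda>x. (cmod (h x * f x))\<^sup>2)" using L2_funsD(2)[OF bm[OF f]] .
        show "integrable M (\<lambda>x. K\<^sup>2 * (cmod (f x))\<^sup>2)" using L2_funsD(2)[OF f] by simp
        fix x
        have "(cmod (h x))\<^sup>2 \<le> K\<^sup>2" using h(2) by (intro power_mono) auto
        then show "(cmod (h x * f x))\<^sup>2 \<le> K\<^sup>2 * (cmod (f x))\<^sup>2"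
          by (simp add: norm_mult power_mult_distrib mult_right_mono)
      qed
      also have "\<dots> = (K * nrm u)\<^sup>2" using f by (simp add: u L2_hnorm_sq power_mult_distrib)
      finally show ?thesis
        by (rule power2_le_imp_le) (use K f in \<open>simp add: u L2_class_closed\<close>)
    qed
    fix v assume "v \<in> X"
    then obtain g where g: "g \<in> L2_funs M" and v: "v = L2_class M g" by (rule L2_class_cases)
    show "mult_op M h (hadd (L2_space M) u v) = hadd (L2_space M) (mult_op M h u) (mult_op M h v)"
      using f g by (simp add: u v L2_hadd mo[of f f] mo[of g g] mo[of "\<lambda>x. f x + g x" f] bm L2_add distrib_left)
  qed
qed

text \<open>A bounded function for which the kernel of the commutator with the Laplacian satisfies the
  hypothesis of Schur's test.\<close>

locale schur_multiplier = borel_metric_measure +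
  fixes h :: "'a \<Rightarrow> complex" and K S :: real
  assumes h_meas [measurable]: "h \<in> borel_measurable M"
    and h_bound: "\<And>x. cmod (h x) \<le> K"
    and schur: "\<And>x. (\<integral>\<^sup>+y. ennreal (cmod (h x - h y) / dist x y powr \<delta>) \<partial>M) \<le> ennreal S"
    and S_nonneg: "0 \<le> S"
begin

lemma K_nonneg: "0 \<le> K" using h_bound[of undefined] norm_ge_zero order_trans by blast

definition comm_kernel :: "'a \<times> 'a \<Rightarrow> complex"
  where "comm_kernel z = (h (fst z) - h (snd z)) / complex_of_real (dist (fst z) (snd z) powr \<delta>)"

lemma comm_kernel_measurable [measurable]: "comm_kernel \<in> borel_measurable P"
  unfolding comm_kernel_def using measurable_fst_comp[OF h_meas] measurable_snd_comp[OF h_meas] dist_measurable_P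
  by (intro borel_measurable_divide borel_measurable_diff) auto

lemma comm_kernel_swap: "comm_kernel (y, x) = - comm_kernel (x, y)"
  by (simp add: comm_kernel_def dist_commute[of y x] minus_divide_left)

lemma schur_comm_kernel: "(\<integral>\<^sup>+y. ennreal (cmod (comm_kernel (x, y))) \<partial>M) \<le> ennreal S"
  using schur[of x] by (simp add: comm_kernel_def norm_divide)

lemma schur_weighted: assumes f: "f \<in> L2_funs M"
  shows "(\<integral>\<^sup>+z. ennreal (cmod (comm_kernel z) * (cmod (f (snd z)))\<^sup>2) \<partial>P) \<le> ennreal (S * (LINT x|M. (cmod (f x))\<^sup>2))"
    and "(\<integral>\<^sup>+z. ennreal (cmod (comm_kernel z) * (cmod (f (fst z)))\<^sup>2) \<partial>P) \<le> ennreal (S * (LINT x|M. (cmod (f x))\<^sup>2))"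
proof -
  have [measurable]: "f \<in> borel_measurable M" using f L2_funsD by blast
  have m1: "(\<lambda>z. ennreal (cmod (comm_kernel z) * (cmod (f (fst z)))\<^sup>2)) \<in> borel_measurable P"
    using measurable_fst_comp[of f] by (intro measurable_compose[OF _ measurable_ennreal] borel_measurable_times borel_measurable_power) auto
  have m2: "(\<lambda>z. ennreal (cmod (comm_kernel z) * (cmod (f (snd z)))\<^sup>2)) \<in> borel_measurable P"
    using measurable_snd_comp[of f] by (intro measurable_compose[OF _ measurable_ennreal] borel_measurable_times borel_measurable_power) auto
  have mk: "(\<lambda>y. ennreal (cmod (comm_kernel (x, y)))) \<in> borel_measurable M" for x
    using measurable_compose[OF measurable_Pair1'[of x M M] comm_kernel_measurable] by simp
  have fst_le: "(\<integral>\<^sup>+z. ennreal (cmod (comm_kernel z) * (cmod (f (fst z)))\<^sup>2) \<partial>P) \<le> ennreal (S * (LINT x|M. (cmod (f x))\<^sup>2))"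
  proof -
    have "(\<integral>\<^sup>+z. ennreal (cmod (comm_kernel z) * (cmod (f (fst z)))\<^sup>2) \<partial>P)
        = (\<integral>\<^sup>+x. \<integral>\<^sup>+y. ennreal ((cmod (f x))\<^sup>2) * ennreal (cmod (comm_kernel (x, y))) \<partial>M \<partial>M)"
      by (subst nn_integral_fst[OF m1, symmetric]) (simp add: ennreal_mult' mult.commute)
    also have "\<dots> = (\<integral>\<^sup>+x. ennreal ((cmod (f x))\<^sup>2) * (\<integral>\<^sup>+y. ennreal (cmod (comm_kernel (x, y))) \<partial>M) \<partial>M)"
      using mk by (simp add: nn_integral_cmult)
    also have "\<dots> \<le> (\<integral>\<^sup>+x. ennreal ((cmod (f x))\<^sup>2) * ennreal S \<partial>M)"
      by (intro nn_integral_mono mult_left_mono schur_comm_kernel) simp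
    also have "\<dots> = ennreal (LINT x|M. (cmod (f x))\<^sup>2) * ennreal S"
      using L2_funsD(2)[OF f] by (simp add: nn_integral_multc nn_integral_eq_integral)
    finally show ?thesis by (simp add: ennreal_mult' S_nonneg mult.commute)
  qed
  then show "(\<integral>\<^sup>+z. ennreal (cmod (comm_kernel z) * (cmod (f (fst z)))\<^sup>2) \<partial>P) \<le> ennreal (S * (LINT x|M. (cmod (f x))\<^sup>2))" .
  have "(\<integral>\<^sup>+z. ennreal (cmod (comm_kernel z) * (cmod (f (snd z)))\<^sup>2) \<partial>P)
      = (\<integral>\<^sup>+z. ennreal (cmod (comm_kernel z) * (cmod (f (snd z)))\<^sup>2) \<partial>distr P P (\<lambda>(x, y). (y, x)))"
    using MM.distr_pair_swap by simp
  also have "\<dots> = (\<integral>\<^sup>+z. ennreal (cmod (comm_kernel (snd z, fst z)) * (cmod (f (fst z)))\<^sup>2) \<partial>P)"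
    by (subst nn_integral_distr[OF measurable_pair_swap']) (use m2 in \<open>simp_all add: case_prod_beta\<close>)
  also have "\<dots> = (\<integral>\<^sup>+z. ennreal (cmod (comm_kernel z) * (cmod (f (fst z)))\<^sup>2) \<partial>P)"
    using comm_kernel_swap by (intro nn_integral_cong) (metis norm_minus_cancel prod.collapse)
  finally show "(\<integral>\<^sup>+z. ennreal (cmod (comm_kernel z) * (cmod (f (snd z)))\<^sup>2) \<partial>P) \<le> ennreal (S * (LINT x|M. (cmod (f x))\<^sup>2))"
    using fst_le by simp
qed

text \<open>The kernel is split into two square roots, so that the bilinear form of the integral operator
  becomes an inner product in \<open>L\<^sup>2(M \<Otimes> M)\<close> and Schur's test becomes the Cauchy-Schwarz inequality.\<close>

definition left_factor :: "('a \<Rightarrow> complex) \<Rightarrow> 'a \<times> 'a \<Rightarrow> complex"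
  where "left_factor f z = complex_of_real (sqrt (cmod (comm_kernel z))) * f (snd z)"

definition right_factor :: "('a \<Rightarrow> complex) \<Rightarrow> 'a \<times> 'a \<Rightarrow> complex"
  where "right_factor g z = cnj (sgn (comm_kernel z)) * complex_of_real (sqrt (cmod (comm_kernel z))) * g (fst z)"

lemma factor_prod: "cnj (left_factor f z) * right_factor g z = cnj (comm_kernel z * f (snd z)) * g (fst z)"
proof -
  have "complex_of_real (sqrt (cmod (comm_kernel z))) * complex_of_real (sqrt (cmod (comm_kernel z))) = complex_of_real (cmod (comm_kernel z))"
    by (simp flip: of_real_mult)
  then have "cnj (left_factor f z) * right_factor g z
      = cnj (sgn (comm_kernel z) * complex_of_real (cmod (comm_kernel z))) * cnj (f (snd z)) * g (fst z)"
    by (simp add: left_factor_def right_factor_def mult_ac)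
  also have "sgn (comm_kernel z) * complex_of_real (cmod (comm_kernel z)) = comm_kernel z" by (simp add: sgn_eq)
  finally show ?thesis by simp
qed

lemma factor_L2: assumes f: "f \<in> L2_funs M"
  shows "left_factor f \<in> L2_funs P" "(LINT z|P. (cmod (left_factor f z))\<^sup>2) \<le> S * (LINT x|M. (cmod (f x))\<^sup>2)"
    and "right_factor f \<in> L2_funs P" "(LINT z|P. (cmod (right_factor f z))\<^sup>2) \<le> S * (LINT x|M. (cmod (f x))\<^sup>2)"
proof -
  have m: "f \<in> borel_measurable M" using f L2_funsD by blast
  have c: "(cmod (left_factor f z))\<^sup>2 = cmod (comm_kernel z) * (cmod (f (snd z)))\<^sup>2" for z
    by (simp add: left_factor_def norm_mult power_mult_distrib)
  have d: "(cmod (right_factor f z))\<^sup>2 = cmod (comm_kernel z) * (cmod (f (fst z)))\<^sup>2" for z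
    by (cases "comm_kernel z = 0") (simp_all add: right_factor_def norm_mult power_mult_distrib norm_sgn)
  have sgn_m: "(\<lambda>z. sgn (comm_kernel z)) \<in> borel_measurable P"
    unfolding sgn_eq by (intro borel_measurable_divide) auto
  have ml: "left_factor f \<in> borel_measurable P"
    unfolding left_factor_def using measurable_snd_comp[OF m] by (intro borel_measurable_times) auto
  have mr: "right_factor f \<in> borel_measurable P"
    unfolding right_factor_def using measurable_fst_comp[OF m] sgn_m by (intro borel_measurable_times measurable_cnj_comp) auto
  have bound: "F \<in> L2_funs P \<and> (LINT z|P. (cmod (F z))\<^sup>2) \<le> C"
    if F: "F \<in> borel_measurable P" and C: "0 \<le> C" and le: "(\<integral>\<^sup>+z. ennreal ((cmod (F z))\<^sup>2) \<partial>P) \<le> ennreal C"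
    for F :: "'a \<times> 'a \<Rightarrow> complex" and C
  proof -
    have L: "F \<in> L2_funs P" using F le by (auto simp: L2_funs_iff_nn_integral intro: le_less_trans)
    have "(\<integral>\<^sup>+z. ennreal ((cmod (F z))\<^sup>2) \<partial>P) = ennreal (LINT z|P. (cmod (F z))\<^sup>2)"
      using L2_funsD(2)[OF L] by (intro nn_integral_eq_integral) auto
    then show ?thesis using L le C by (simp add: ennreal_le_iff)
  qed
  have C: "0 \<le> S * (LINT x|M. (cmod (f x))\<^sup>2)" using S_nonneg by simp
  show "left_factor f \<in> L2_funs P" "(LINT z|P. (cmod (left_factor f z))\<^sup>2) \<le> S * (LINT x|M. (cmod (f x))\<^sup>2)"
    using bound[OF ml C] schur_weighted(1)[OF f] by (simp_all add: c)
  show "right_factor f \<in> L2_funs P" "(LINT z|P. (cmod (right_factor f z))\<^sup>2) \<le> S * (LINT x|M. (cmod (f x))\<^sup>2)"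
    using bound[OF mr C] schur_weighted(2)[OF f] by (simp_all add: d)
qed

text \<open>By the product rule for difference quotients.  The cross term is square integrable since the
  squared difference quotient of the bounded function \<open>h\<close> is at most \<open>2 K\<close> times the absolute value of the kernel, whose
  integrals in one variable are bounded.\<close>

lemma multiplier_energy: assumes f: "f \<in> energy_funs" shows "(\<lambda>x. h x * f x) \<in> energy_funs"
proof -
  have fL: "f \<in> L2_funs M" and fm: "f \<in> borel_measurable M" using energy_funsD[OF f] by blast+
  have hf: "(\<lambda>x. h x * f x) \<in> L2_funs M" by (rule L2_bounded_mult[OF fL h_meas h_bound])
  have prod: "diff_quot (\<lambda>x. h x * f x) z = h (fst z) * diff_quot f z + f (snd z) * diff_quot h z" for z
    by (simp add: diff_quot_def add_divide_distrib[symmetric] diff_divide_distrib[symmetric] algebra_simps)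
  have 1: "(\<lambda>z. h (fst z) * diff_quot f z) \<in> L2_funs P"
    by (rule L2_bounded_mult[OF energy_funsD(2)[OF f] measurable_fst_comp[OF h_meas] h_bound])
  have 2: "(\<lambda>z. f (snd z) * diff_quot h z) \<in> L2_funs P"
  proof (rule L2_funsI_bound)
    show "(\<lambda>z. f (snd z) * diff_quot h z) \<in> borel_measurable P"
      using measurable_snd_comp[OF fm] by (intro borel_measurable_times) auto
    show "integrable P (\<lambda>z. 2 * K * (cmod (left_factor f z))\<^sup>2)"
      using L2_funsD(2)[OF factor_L2(1)[OF fL]] by simp
    fix z
    have "(cmod (diff_quot h z))\<^sup>2 = cmod (h (fst z) - h (snd z)) * cmod (comm_kernel z)"
      unfolding diff_quot_sq by (simp add: comm_kernel_def norm_divide power2_eq_square)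
    also have "\<dots> \<le> (2 * K) * cmod (comm_kernel z)"
      using norm_triangle_ineq4[of "h (fst z)" "h (snd z)"] h_bound[of "fst z"] h_bound[of "snd z"]
      by (intro mult_right_mono) auto
    finally have "(cmod (f (snd z)))\<^sup>2 * (cmod (diff_quot h z))\<^sup>2 \<le> (cmod (f (snd z)))\<^sup>2 * (2 * K * cmod (comm_kernel z))"
      by (intro mult_left_mono) auto
    then show "(cmod (f (snd z) * diff_quot h z))\<^sup>2 \<le> 2 * K * (cmod (left_factor f z))\<^sup>2"
      by (simp add: left_factor_def norm_mult power_mult_distrib mult_ac)
  qed
  have "diff_quot (\<lambda>x. h x * f x) \<in> L2_funs P" using L2_add[OF 1 2] unfolding prod[symmetric] .
  then show ?thesis using hf by (simp add: energy_funs_def)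
qed

lemma schur_cnj: "schur_multiplier M \<delta> (\<lambda>x. cnj (h x)) K S"
proof
  show "(\<lambda>x. cnj (h x)) \<in> borel_measurable M" by measurable
  show "cmod (cnj (h x)) \<le> K" for x using h_bound by simp
  show "(\<integral>\<^sup>+y. ennreal (cmod (cnj (h x) - cnj (h y)) / dist x y powr \<delta>) \<partial>M) \<le> ennreal S" for x
    using schur[of x] by (simp flip: complex_cnj_diff)
  show "0 \<le> S" by (rule S_nonneg)
qed

definition comm_form :: "('a \<Rightarrow> complex) \<Rightarrow> ('a \<Rightarrow> complex) \<Rightarrow> complex"
  where "comm_form f g = (LINT z|P. cnj (left_factor f z) * right_factor g z)"

lemma comm_form_bound: assumes "f \<in> L2_funs M" "g \<in> L2_funs M"
  shows "cmod (comm_form f g) \<le> S * sqrt (LINT x|M. (cmod (f x))\<^sup>2) * sqrt (LINT x|M. (cmod (g x))\<^sup>2)"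
proof -
  interpret I: inner_space "L2_space P" by (rule inner_space_L2)
  let ?F = "L2_class P (left_factor f)" and ?G = "L2_class P (right_factor g)"
  note F = factor_L2(1,2)[OF assms(1)] and G = factor_L2(3,4)[OF assms(2)]
  have "comm_form f g = I.ip ?F ?G" using F G by (simp add: comm_form_def L2_hinner)
  then have "cmod (comm_form f g) \<le> I.nrm ?F * I.nrm ?G"
    using I.Cauchy_Schwarz[of ?F ?G] F G by (simp add: L2_class_closed)
  also have "\<dots> \<le> sqrt (S * (LINT x|M. (cmod (f x))\<^sup>2)) * sqrt (S * (LINT x|M. (cmod (g x))\<^sup>2))"
    using F G S_nonneg
    by (intro mult_mono real_le_rsqrt) (simp_all add: L2_hnorm_sq L2_class_closed)
  also have "\<dots> = S * sqrt (LINT x|M. (cmod (f x))\<^sup>2) * sqrt (LINT x|M. (cmod (g x))\<^sup>2)"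
    using S_nonneg by (simp add: real_sqrt_mult)
  finally show ?thesis .
qed

text \<open>Formally \<open>[\<Delta>, h]\<close> is the integral operator with kernel \<open>comm_kernel\<close>.  In the weak form of this
  identity the difference of the two energies is antisymmetrized, and interchanging the variables
  identifies its two halves.\<close>

lemma form_commutator:
  assumes f: "f \<in> energy_funs" and g: "g \<in> energy_funs"
  shows "q (cls (\<lambda>x. h x * f x)) (cls g) = q (cls f) (cls (\<lambda>x. cnj (h x) * g x)) + comm_form f g"
proof -
  interpret c: schur_multiplier M \<delta> "\<lambda>x. cnj (h x)" K S by (rule schur_cnj)
  have fL: "f \<in> L2_funs M" and gL: "g \<in> L2_funs M" using f g energy_funsD by blast+
  note hf = multiplier_energy[OF f] and hg = c.multiplier_energy[OF g]
  define \<beta> where "\<beta> z = cnj (left_factor f z) * right_factor g z" for z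
  have \<beta>: "integrable P \<beta>" unfolding \<beta>_def by (intro L2_prod_integrable factor_L2 fL gL)
  have i1: "integrable P (\<lambda>z. cnj (diff_quot (\<lambda>x. h x * f x) z) * diff_quot g z)"
    by (intro L2_prod_integrable energy_funsD(2) hf g)
  have i2: "integrable P (\<lambda>z. cnj (diff_quot f z) * diff_quot (\<lambda>x. cnj (h x) * g x) z)"
    by (intro L2_prod_integrable energy_funsD(2) f hg)
  have "cnj (diff_quot (\<lambda>x. h x * f x) z) * diff_quot g z - cnj (diff_quot f z) * diff_quot (\<lambda>x. cnj (h x) * g x) z
      = \<beta> z + \<beta> (snd z, fst z)" for z
    unfolding \<beta>_def factor_prod diff_quot_prod comm_kernel_def
    by (simp add: dist_commute[of "snd z" "fst z"] add_divide_distrib[symmetric] diff_divide_distrib[symmetric] algebra_simps)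
  then have eq: "(\<lambda>z. cnj (diff_quot (\<lambda>x. h x * f x) z) * diff_quot g z - cnj (diff_quot f z) * diff_quot (\<lambda>x. cnj (h x) * g x) z)
      = (\<lambda>z. \<beta> z + (case z of (x, y) \<Rightarrow> \<beta> (y, x)))"
    by (auto simp: fun_eq_iff split: prod.split)
  have sw: "integrable P (\<lambda>(x, y). \<beta> (y, x))" using \<beta> by (rule MM.integrable_product_swap)
  have "q (cls (\<lambda>x. h x * f x)) (cls g) - q (cls f) (cls (\<lambda>x. cnj (h x) * g x))
    = 1 / 2 * (LINT z|P. cnj (diff_quot (\<lambda>x. h x * f x) z) * diff_quot g z - cnj (diff_quot f z) * diff_quot (\<lambda>x. cnj (h x) * g x) z)"
    using i1 i2 by (simp add: q_cls f g hf hg right_diff_distrib)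
  also have "\<dots> = 1 / 2 * ((LINT z|P. \<beta> z) + (LINT z|P. (case z of (x, y) \<Rightarrow> \<beta> (y, x))))"
    unfolding eq using \<beta> sw by simp
  also have "(LINT z|P. (case z of (x, y) \<Rightarrow> \<beta> (y, x))) = (LINT z|P. \<beta> z)"
    using MM.integral_product_swap[of \<beta>] \<beta> by simp
  also have "1 / 2 * ((LINT z|P. \<beta> z) + (LINT z|P. \<beta> z)) = comm_form f g" by (simp add: comm_form_def \<beta>_def)
  finally show ?thesis by (simp add: algebra_simps)
qed

lemma factor_AE: assumes "AE x in M. f x = g x"
  shows "AE z in P. left_factor f z = left_factor g z" "AE z in P. right_factor f z = right_factor g z"
proof -
  show "AE z in P. left_factor f z = left_factor g z"
    using AE_P[OF assms] by eventually_elim (simp add: left_factor_def)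
  show "AE z in P. right_factor f z = right_factor g z"
    using AE_P[OF assms] by eventually_elim (simp add: right_factor_def)
qed

lemma comm_form_AE: assumes L: "f \<in> L2_funs M" "f' \<in> L2_funs M" "g \<in> L2_funs M" "g' \<in> L2_funs M"
    and "AE x in M. f x = f' x" "AE x in M. g x = g' x"
  shows "comm_form f g = comm_form f' g'"
  unfolding comm_form_def
proof (rule integral_cong_AE)
  show "AE z in P. cnj (left_factor f z) * right_factor g z = cnj (left_factor f' z) * right_factor g' z"
    using factor_AE(1)[OF assms(5)] factor_AE(2)[OF assms(6)] by eventually_elim simp
  show "(\<lambda>z. cnj (left_factor f z) * right_factor g z) \<in> borel_measurable P"
    "(\<lambda>z. cnj (left_factor f' z) * right_factor g' z) \<in> borel_measurable P"
    using factor_L2(1,3)[THEN L2_funsD(1)] L by (intro borel_measurable_times measurable_cnj_comp; blast)+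
qed

text \<open>The form \<open>comm_form\<close> depends only on the classes of its arguments and is bounded, so it is the form
  of a bounded operator.\<close>

theorem commutator_operator_exists:
  "\<exists>T\<in>bounded_ops L2. \<forall>f\<in>L2_funs M. \<forall>g\<in>L2_funs M. hinner L2 (T (cls f)) (cls g) = comm_form f g"
proof -
  define B where "B U V = comm_form (L2_rep U) (L2_rep V)" for U V
  have B: "B (cls f) (cls g) = comm_form f g" if "f \<in> L2_funs M" "g \<in> L2_funs M" for f g
    unfolding B_def using that L2_rep_class by (intro comm_form_AE) auto
  have int: "integrable P (\<lambda>z. cnj (left_factor f z) * right_factor g z)"
    if "f \<in> L2_funs M" "g \<in> L2_funs M" for f g
    using that by (intro L2_prod_integrable factor_L2)
  have ladd: "left_factor (\<lambda>x. f x + g x) z = left_factor f z + left_factor g z"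
    and radd: "right_factor (\<lambda>x. f x + g x) z = right_factor f z + right_factor g z"
    and lsc: "left_factor (\<lambda>x. c * f x) z = c * left_factor f z"
    and rsc: "right_factor (\<lambda>x. c * f x) z = c * right_factor f z" for f g c z
    by (simp_all add: left_factor_def right_factor_def algebra_simps)
  have "\<exists>T\<in>bounded_ops L2. \<forall>U\<in>L2.X. \<forall>V\<in>L2.X. L2.ip (T U) V = B U V"
  proof (rule L2.bounded_sesquilinear_operator)
    fix U V W a assume "U \<in> L2.X" "V \<in> L2.X"
    then obtain f g where f: "f \<in> L2_funs M" and U: "U = cls f" and g: "g \<in> L2_funs M" and V: "V = cls g"
      by (metis L2_class_cases)
    show "B U (hscale L2 a V) = a * B U V"
      using f g int[OF f g] by (simp add: U V L2_hscale B L2_scale comm_form_def rsc mult.left_commute)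
    show "B (hscale L2 a U) V = cnj a * B U V"
      using f g int[OF f g] by (simp add: U V L2_hscale B L2_scale comm_form_def lsc mult.assoc)
    show "cmod (B U V) \<le> S * L2.nrm U * L2.nrm V"
    proof -
      have n: "L2.nrm (cls f) = sqrt (LINT x|M. (cmod (f x))\<^sup>2)" if "f \<in> L2_funs M" for f
        using L2_hnorm_sq[OF that] L2.nrm_nonneg[OF L2_class_closed[OF that]] by (simp add: real_sqrt_unique)
      show ?thesis using comm_form_bound[OF f g] f g by (simp add: U V B n)
    qed
    assume "W \<in> L2.X"
    then obtain h' where h': "h' \<in> L2_funs M" and W: "W = cls h'" by (metis L2_class_cases)
    show "B U (hadd L2 V W) = B U V + B U W"
      using f g h' int[OF f g] int[OF f h'] by (simp add: U V W L2_hadd B L2_add comm_form_def radd distrib_left)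
    show "B (hadd L2 U V) W = B U W + B V W"
      using f g h' int[OF f h'] int[OF g h'] by (simp add: U V W L2_hadd B L2_add comm_form_def ladd distrib_right)
  qed
  then show ?thesis using B L2_class_closed by metis
qed

lemma mult_cls: "f \<in> L2_funs M \<Longrightarrow> mult_op M h (cls f) = cls (\<lambda>x. h x * f x)"
  by (rule L2_mult_op[OF _ _ h_meas h_bound])

end

section \<open>Bounded kernels and eigenvalue counting\<close>

context borel_metric_measure
begin

abbreviation "\<mu> \<equiv> measure M UNIV"

lemma bounded_L2: assumes "f \<in> borel_measurable M" "\<And>x. cmod (f x) \<le> B" shows "f \<in> L2_funs M"
proof (rule L2_funsI_bound[OF assms(1), where g = "\<lambda>x. B\<^sup>2"])
  show "(cmod (f x))\<^sup>2 \<le> B\<^sup>2" for x using assms(2) by (intro power_mono) auto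
qed simp

lemma L2_norm_integral_bounded:
  assumes "f \<in> borel_measurable M" "\<And>x. (cmod (f x))\<^sup>2 \<le> B"
  shows "(LINT x|M. (cmod (f x))\<^sup>2) \<le> B * \<mu>"
proof -
  have "f \<in> L2_funs M" using assms by (intro L2_funsI_bound[where g = "\<lambda>x. B"]) auto
  then have "(LINT x|M. (cmod (f x))\<^sup>2) \<le> (LINT x|M. B)" using assms L2_funsD(2) by (intro integral_mono) auto
  then show ?thesis by (simp add: mult.commute)
qed

lemma L2_fst_P: assumes "f \<in> L2_funs M" shows "(\<lambda>z. f (fst z)) \<in> L2_funs P" "(\<lambda>z. f (snd z)) \<in> L2_funs P"
proof -
  have m: "f \<in> borel_measurable M" using assms L2_funsD by blast
  note m1 = measurable_fst_comp[OF m] and m2 = measurable_snd_comp[OF m]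
  have i: "integrable M (\<lambda>x. (cmod (f x))\<^sup>2)" by (rule L2_funsD(2)[OF assms])
  have "(\<integral>\<^sup>+z. ennreal ((cmod (f (fst z)))\<^sup>2) \<partial>P) = (\<integral>\<^sup>+x. \<integral>\<^sup>+y. ennreal ((cmod (f x))\<^sup>2) \<partial>M \<partial>M)"
    using m1 by (subst nn_integral_fst[symmetric]) auto
  also have "\<dots> = ennreal (LINT x|M. (cmod (f x))\<^sup>2) * emeasure M UNIV"
    using i by (simp add: nn_integral_multc nn_integral_eq_integral)
  also have "\<dots> < \<infinity>" by (simp add: ennreal_mult_less_top emeasure_eq_measure)
  finally show "(\<lambda>z. f (fst z)) \<in> L2_funs P" using m1 by (simp add: L2_funs_iff_nn_integral)
  have "(\<integral>\<^sup>+z. ennreal ((cmod (f (snd z)))\<^sup>2) \<partial>P) = (\<integral>\<^sup>+x. \<integral>\<^sup>+y. ennreal ((cmod (f y))\<^sup>2) \<partial>M \<partial>M)"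
    using m2 by (subst nn_integral_fst[symmetric]) auto
  also have "\<dots> = ennreal (LINT x|M. (cmod (f x))\<^sup>2) * emeasure M UNIV"
    using i by (simp add: nn_integral_eq_integral)
  also have "\<dots> < \<infinity>" by (simp add: ennreal_mult_less_top emeasure_eq_measure)
  finally show "(\<lambda>z. f (snd z)) \<in> L2_funs P" using m2 by (simp add: L2_funs_iff_nn_integral)
qed

context
  fixes \<kappa> :: "'a \<times> 'a \<Rightarrow> real" and B :: real
  assumes \<kappa>_m: "\<kappa> \<in> borel_measurable P" and \<kappa>_b: "\<And>z. \<bar>\<kappa> z\<bar> \<le> B"
begin

definition "kernel_row x = (\<lambda>y. complex_of_real (\<kappa> (x, y)))"

definition "kernel_op f x = (LINT y|M. kernel_row x y * f y)"

lemma kernel_row_measurable: "kernel_row x \<in> borel_measurable M"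
  unfolding kernel_row_def using measurable_compose[OF measurable_Pair1'[of x M M] \<kappa>_m] by simp

lemma kernel_row_L2: "kernel_row x \<in> L2_funs M"
  by (rule bounded_L2[OF kernel_row_measurable, of _ B]) (use \<kappa>_b in \<open>simp add: kernel_row_def\<close>)

lemma kernel_row_norm: "(LINT y|M. (cmod (kernel_row x y))\<^sup>2) \<le> B\<^sup>2 * \<mu>"
proof (rule L2_norm_integral_bounded[OF kernel_row_measurable])
  fix y show "(cmod (kernel_row x y))\<^sup>2 \<le> B\<^sup>2"
    using \<kappa>_b[of "(x, y)"] by (simp add: kernel_row_def abs_le_square_iff[symmetric])
qed

lemma kernel_op_inner: assumes "f \<in> L2_funs M" shows "kernel_op f x = hinner L2 (cls (kernel_row x)) (cls f)"
  unfolding L2_hinner[OF kernel_row_L2 assms] kernel_op_def by (simp add: kernel_row_def)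

lemma kernel_op_measurable: assumes "f \<in> L2_funs M" shows "kernel_op f \<in> borel_measurable M"
proof -
  have "(\<lambda>z. complex_of_real (\<kappa> z) * f (snd z)) \<in> borel_measurable P"
    using \<kappa>_m measurable_snd_comp[OF L2_funsD(1)[OF assms]] by (intro borel_measurable_times) auto
  moreover have "(\<lambda>(x, y). kernel_row x y * f y) = (\<lambda>z. complex_of_real (\<kappa> z) * f (snd z))"
    by (auto simp: kernel_row_def fun_eq_iff)
  ultimately have "(\<lambda>(x, y). kernel_row x y * f y) \<in> borel_measurable P" by simp
  then show ?thesis unfolding kernel_op_def by (rule borel_measurable_lebesgue_integral)
qed

lemma kernel_op_bound: assumes "f \<in> L2_funs M"
  shows "(cmod (kernel_op f x))\<^sup>2 \<le> B\<^sup>2 * \<mu> * (LINT y|M. (cmod (f y))\<^sup>2)"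
proof -
  have "cmod (kernel_op f x) \<le> L2.nrm (cls (kernel_row x)) * L2.nrm (cls f)"
    unfolding kernel_op_inner[OF assms] using assms kernel_row_L2 by (intro L2.Cauchy_Schwarz L2_class_closed)
  then have "(cmod (kernel_op f x))\<^sup>2 \<le> (L2.nrm (cls (kernel_row x)) * L2.nrm (cls f))\<^sup>2" by (intro power_mono) auto
  also have "\<dots> = (LINT y|M. (cmod (kernel_row x y))\<^sup>2) * (LINT y|M. (cmod (f y))\<^sup>2)"
    using assms kernel_row_L2 by (simp add: power_mult_distrib L2_hnorm_sq)
  also have "\<dots> \<le> B\<^sup>2 * \<mu> * (LINT y|M. (cmod (f y))\<^sup>2)" by (intro mult_right_mono kernel_row_norm) simp
  finally show ?thesis .
qed

lemma kernel_op_L2: assumes "f \<in> L2_funs M" shows "kernel_op f \<in> L2_funs M"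
  by (rule L2_funsI_bound[OF kernel_op_measurable[OF assms], where g = "\<lambda>_. B\<^sup>2 * \<mu> * (LINT y|M. (cmod (f y))\<^sup>2)"])
     (use kernel_op_bound[OF assms] in auto)

lemma kernel_prod_integrable: assumes "f \<in> L2_funs M" "g \<in> L2_funs M"
  shows "integrable P (\<lambda>z. cnj (f (fst z)) * (complex_of_real (\<kappa> z) * g (snd z)))"
proof -
  have "(\<lambda>z. complex_of_real (\<kappa> z) * g (snd z)) \<in> L2_funs P"
    by (rule L2_bounded_mult[OF L2_fst_P(2)[OF assms(2)], where K = B]) (use \<kappa>_m \<kappa>_b in auto)
  then show ?thesis using L2_fst_P(1)[OF assms(1)] by (intro L2_prod_integrable)
qed

lemma kernel_op_form: assumes "f \<in> L2_funs M"
  shows "(LINT z|P. cnj (f (fst z)) * (complex_of_real (\<kappa> z) * f (snd z))) = hinner L2 (cls f) (cls (kernel_op f))"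
proof -
  have "(LINT x|M. LINT y|M. cnj (f x) * (complex_of_real (\<kappa> (x, y)) * f y))
      = (LINT z|P. cnj (f (fst z)) * (complex_of_real (\<kappa> z) * f (snd z)))"
    using MM.integral_fst'[OF kernel_prod_integrable[OF assms assms]] by simp
  moreover have "(LINT x|M. LINT y|M. cnj (f x) * (complex_of_real (\<kappa> (x, y)) * f y)) = (LINT x|M. cnj (f x) * kernel_op f x)"
    by (simp add: kernel_op_def kernel_row_def)
  ultimately show ?thesis using assms kernel_op_L2 by (simp add: L2_hinner)
qed

lemma kernel_op_form_le: assumes f: "f \<in> L2_funs M"
  shows "Re (LINT z|P. cnj (f (fst z)) * (complex_of_real (\<kappa> z) * f (snd z)))
    \<le> L2.nrm (cls f) * L2.nrm (cls (kernel_op f))"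
  unfolding kernel_op_form[OF f]
  using L2.Cauchy_Schwarz[OF L2_class_closed[OF f] L2_class_closed[OF kernel_op_L2[OF f]]] complex_Re_le_cmod order_trans by blast

text \<open>Bessel's inequality at each point bounds the Hilbert-Schmidt norm.\<close>

lemma kernel_op_hilbert_schmidt:
  assumes F: "finite F" "F \<subseteq> L2.X" "\<And>e e'. e \<in> F \<Longrightarrow> e' \<in> F \<Longrightarrow> L2.ip e e' = (if e = e' then 1 else 0)"
  shows "(\<Sum>e\<in>F. (L2.nrm (cls (kernel_op (L2_rep e))))\<^sup>2) \<le> B\<^sup>2 * \<mu>\<^sup>2"
proof -
  have r: "L2_rep e \<in> L2_funs M" "cls (L2_rep e) = e" if "e \<in> F" for e
    using L2_rep_closed[of e M] F(2) that by auto
  have "(\<Sum>e\<in>F. (L2.nrm (cls (kernel_op (L2_rep e))))\<^sup>2) = (\<Sum>e\<in>F. LINT x|M. (cmod (kernel_op (L2_rep e) x))\<^sup>2)"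
    using r kernel_op_L2 by (intro sum.cong) (auto simp: L2_hnorm_sq)
  also have "\<dots> = (LINT x|M. (\<Sum>e\<in>F. (cmod (kernel_op (L2_rep e) x))\<^sup>2))"
    using r kernel_op_L2 L2_funsD(2) by (intro Bochner_Integration.integral_sum[symmetric]) blast
  also have "\<dots> \<le> (LINT x|M. B\<^sup>2 * \<mu>)"
  proof (rule integral_mono)
    show "integrable M (\<lambda>x. \<Sum>e\<in>F. (cmod (kernel_op (L2_rep e) x))\<^sup>2)"
      using r kernel_op_L2 L2_funsD(2) by (intro Bochner_Integration.integrable_sum) blast
    fix x
    have "(\<Sum>e\<in>F. (cmod (kernel_op (L2_rep e) x))\<^sup>2) = (\<Sum>e\<in>F. (cmod (L2.ip e (cls (kernel_row x))))\<^sup>2)"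
    proof (intro sum.cong refl)
      fix e assume e: "e \<in> F"
      have "cmod (L2.ip (cls (kernel_row x)) e) = cmod (L2.ip e (cls (kernel_row x)))"
        using L2.inner_commute[of "cls (kernel_row x)" e] L2_class_closed[OF kernel_row_L2[of x]] F e by auto
      then show "(cmod (kernel_op (L2_rep e) x))\<^sup>2 = (cmod (L2.ip e (cls (kernel_row x))))\<^sup>2"
        using r[OF e] by (simp add: kernel_op_inner)
    qed
    also have "\<dots> \<le> (L2.nrm (cls (kernel_row x)))\<^sup>2"
      using F by (intro L2.bessel L2_class_closed kernel_row_L2) auto
    also have "\<dots> \<le> B\<^sup>2 * \<mu>" using kernel_row_norm[of x] kernel_row_L2[of x] by (simp add: L2_hnorm_sq)
    finally show "(\<Sum>e\<in>F. (cmod (kernel_op (L2_rep e) x))\<^sup>2) \<le> B\<^sup>2 * \<mu>" .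
  qed simp
  also have "\<dots> = B\<^sup>2 * \<mu>\<^sup>2" by (simp add: power2_eq_square)
  finally show ?thesis .
qed

text \<open>Since each value of \<open>kernel_op f\<close> is an inner product with a row of the kernel, weak convergence
  gives pointwise convergence, and the uniform bound of the rows dominates it.\<close>

lemma kernel_op_weakly_null:
  assumes w: "\<And>n. w n \<in> L2.X" "\<And>n. L2.nrm (w n) \<le> 1" and weak: "\<And>v. v \<in> L2.X \<Longrightarrow> (\<lambda>n. L2.ip (w n) v) \<longlonglongrightarrow> 0"
  shows "(\<lambda>n. L2.nrm (cls (kernel_op (L2_rep (w n))))) \<longlonglongrightarrow> 0"
proof -
  define f where "f n = L2_rep (w n)" for n
  have f: "f n \<in> L2_funs M" "cls (f n) = w n" for n
    using L2_rep_closed[OF w(1)] by (simp_all add: f_def)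
  have f1: "(LINT y|M. (cmod (f n y))\<^sup>2) \<le> 1" for n
    using L2_hnorm_sq[OF f(1), of n] power_le_one[OF L2.nrm_nonneg[OF w(1)[of n]] w(2)[of n], of 2]
    by (simp add: f(2))
  have "(\<lambda>n. LINT x|M. (cmod (kernel_op (f n) x))\<^sup>2) \<longlonglongrightarrow> (LINT x|M. 0)"
  proof (rule integral_dominated_convergence[where w = "\<lambda>_. B\<^sup>2 * \<mu>"])
    show "AE x in M. (\<lambda>n. (cmod (kernel_op (f n) x))\<^sup>2) \<longlonglongrightarrow> 0"
    proof (rule AE_I2)
      fix x
      have "(\<lambda>n. (cmod (L2.ip (w n) (cls (kernel_row x))))\<^sup>2) \<longlonglongrightarrow> (cmod 0)\<^sup>2"
        by (intro tendsto_intros weak L2_class_closed kernel_row_L2)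
      moreover have "cmod (L2.ip (w n) (cls (kernel_row x))) = cmod (kernel_op (f n) x)" for n
        using L2.inner_commute[of "w n" "cls (kernel_row x)"] L2_class_closed[OF kernel_row_L2[of x]] w(1)[of n]
        by (simp add: kernel_op_inner f)
      ultimately show "(\<lambda>n. (cmod (kernel_op (f n) x))\<^sup>2) \<longlonglongrightarrow> 0" by simp
    qed
    show "AE x in M. norm ((cmod (kernel_op (f n) x))\<^sup>2) \<le> B\<^sup>2 * \<mu>" for n
    proof (rule AE_I2)
      fix x
      have "B\<^sup>2 * \<mu> * (LINT y|M. (cmod (f n y))\<^sup>2) \<le> B\<^sup>2 * \<mu> * 1" by (intro mult_left_mono f1) simp
      then show "norm ((cmod (kernel_op (f n) x))\<^sup>2) \<le> B\<^sup>2 * \<mu>" using kernel_op_bound[OF f(1), of n x] by simp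
    qed
    show "(\<lambda>x. (cmod (kernel_op (f n) x))\<^sup>2) \<in> borel_measurable M" for n using kernel_op_measurable[OF f(1)[of n]] by simp
  qed simp_all
  then have "(\<lambda>n. sqrt (LINT x|M. (cmod (kernel_op (f n) x))\<^sup>2)) \<longlonglongrightarrow> sqrt 0" by (intro tendsto_real_sqrt) simp
  moreover have "L2.nrm (cls (kernel_op (f n))) = sqrt (LINT x|M. (cmod (kernel_op (f n) x))\<^sup>2)" for n
    using L2_hnorm_sq[OF kernel_op_L2[OF f(1)], of n] L2.nrm_nonneg[OF L2_class_closed[OF kernel_op_L2[OF f(1)]], of n]
    by (simp add: real_sqrt_unique)
  ultimately show ?thesis by (simp add: f_def)
qed

end

text \<open>A quantitative form of the growth of eigenvalues.  A bounded kernel is a Hilbert-Schmidt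
  kernel, so at level \<open>L\<close> the form can fail to dominate \<open>L\<close> times the squared norm on boundedly many orthonormal vectors only.  The exponential dependence
  of the bound on \<open>L\<close> becomes the summability of \<open>exp (- t * \<lambda>)\<close>.\<close>

definition kernel_gap :: "real \<Rightarrow> real \<Rightarrow> bool"
  where "kernel_gap A b \<longleftrightarrow> (\<forall>L\<ge>0. \<exists>\<kappa>\<in>borel_measurable P. (\<forall>z. \<bar>\<kappa> z\<bar> \<le> A * exp (b * L)) \<and>
    (\<forall>f\<in>energy_funs. L * (LINT x|M. (cmod (f x))\<^sup>2) \<le> Re (q (cls f) (cls f))
      + Re (LINT z|P. cnj (f (fst z)) * (complex_of_real (\<kappa> z) * f (snd z)))))"

lemma kernel_gap_at:
  assumes "kernel_gap A b" "0 \<le> L"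
  obtains \<kappa> where "\<kappa> \<in> borel_measurable P" "\<And>z. \<bar>\<kappa> z\<bar> \<le> A * exp (b * L)"
    "\<And>u. u \<in> Q \<Longrightarrow> L * (L2.nrm u)\<^sup>2 \<le> Re (q u u) + L2.nrm u * L2.nrm (cls (kernel_op \<kappa> (L2_rep u)))"
proof -
  obtain \<kappa> where \<kappa>: "\<kappa> \<in> borel_measurable P" "\<And>z. \<bar>\<kappa> z\<bar> \<le> A * exp (b * L)"
    and ineq: "\<And>f. f \<in> energy_funs \<Longrightarrow> L * (LINT x|M. (cmod (f x))\<^sup>2) \<le> Re (q (cls f) (cls f))
      + Re (LINT z|P. cnj (f (fst z)) * (complex_of_real (\<kappa> z) * f (snd z)))"
    using assms unfolding kernel_gap_def by blast
  have "L * (L2.nrm u)\<^sup>2 \<le> Re (q u u) + L2.nrm u * L2.nrm (cls (kernel_op \<kappa> (L2_rep u)))" if u: "u \<in> Q" for u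
  proof -
    have r: "L2_rep u \<in> energy_funs" "cls (L2_rep u) = u" "L2_rep u \<in> L2_funs M"
      using u L2_rep_closed[of u M] by (auto simp: Q_iff)
    then have "(L2.nrm u)\<^sup>2 = (LINT x|M. (cmod (L2_rep u x))\<^sup>2)" using L2_hnorm_sq[OF r(3)] by simp
    then show ?thesis using ineq[OF r(1)] kernel_op_form_le[OF \<kappa> r(3)] r(2) by simp
  qed
  then show thesis using that \<kappa> by blast
qed

text \<open>At level \<open>L\<close> the squared norms are at most \<open>1 / L\<close> up to a term which tends to zero, because the
  integral operator improves weak to norm convergence.\<close>

lemma kernel_gap_compact:
  assumes gap: "kernel_gap A b"
    and w: "\<And>n. w n \<in> Q" "\<And>n. L2.nrm (w n) \<le> 1" "\<And>n. Re (q (w n) (w n)) \<le> 1"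
    and weak: "\<And>v. v \<in> L2.X \<Longrightarrow> (\<lambda>n. L2.ip (w n) v) \<longlonglongrightarrow> 0"
  shows "(\<lambda>n. L2.nrm (w n)) \<longlonglongrightarrow> 0"
proof (rule LIMSEQ_I)
  have wX: "w n \<in> L2.X" for n using w(1) by simp
  fix \<epsilon> :: real assume \<epsilon>: "\<epsilon> > 0"
  define L where "L = 2 / \<epsilon>\<^sup>2"
  have L: "L > 0" using \<epsilon> by (simp add: L_def)
  then obtain \<kappa> where \<kappa>: "\<kappa> \<in> borel_measurable P" "\<And>z. \<bar>\<kappa> z\<bar> \<le> A * exp (b * L)"
    and ineq: "\<And>u. u \<in> Q \<Longrightarrow> L * (L2.nrm u)\<^sup>2 \<le> Re (q u u) + L2.nrm u * L2.nrm (cls (kernel_op \<kappa> (L2_rep u)))"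
    using kernel_gap_at[OF gap, of L] by (metis less_imp_le)
  obtain N where N: "\<And>n. n \<ge> N \<Longrightarrow> norm (L2.nrm (cls (kernel_op \<kappa> (L2_rep (w n)))) - 0) < 1"
    using LIMSEQ_D[OF kernel_op_weakly_null[OF \<kappa> wX w(2) weak], of 1] by auto
  have "norm (L2.nrm (w n) - 0) < \<epsilon>" if n: "n \<ge> N" for n
  proof -
    have k: "L2.nrm (cls (kernel_op \<kappa> (L2_rep (w n)))) < 1" using N[OF n] by simp
    moreover have "0 \<le> L2.nrm (cls (kernel_op \<kappa> (L2_rep (w n))))"
      by (intro L2.nrm_nonneg L2_class_closed kernel_op_L2[OF \<kappa>] L2_rep_closed wX)
    ultimately have "L2.nrm (w n) * L2.nrm (cls (kernel_op \<kappa> (L2_rep (w n)))) \<le> L2.nrm (cls (kernel_op \<kappa> (L2_rep (w n))))"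
      using w(2)[of n] wX[of n] by (intro mult_left_le_one_le) auto
    then have "L * (L2.nrm (w n))\<^sup>2 < 2" using ineq[OF w(1)[of n]] w(3)[of n] k by linarith
    then have "(L2.nrm (w n))\<^sup>2 < \<epsilon>\<^sup>2" using \<epsilon> by (simp add: L_def field_simps)
    then have "L2.nrm (w n) < \<epsilon>" by (rule power2_less_imp_less) (use \<epsilon> in simp)
    then show ?thesis using wX[of n] by simp
  qed
  then show "\<exists>N. \<forall>n\<ge>N. norm (L2.nrm (w n) - 0) < \<epsilon>" by blast
qed

text \<open>At level \<open>L + 1\<close> the integral operator maps each vector of \<open>F\<close> to a vector of norm at least one, so
  the cardinality is at most the square of its Hilbert-Schmidt norm.\<close>

lemma kernel_gap_count:
  assumes gap: "kernel_gap A b"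
    and F: "finite F" "F \<subseteq> Q" "\<And>e e'. e \<in> F \<Longrightarrow> e' \<in> F \<Longrightarrow> L2.ip e e' = (if e = e' then 1 else 0)"
    and L: "0 \<le> L" "\<And>e. e \<in> F \<Longrightarrow> Re (q e e) \<le> L"
  shows "real (card F) \<le> (A * \<mu> * exp b)\<^sup>2 * exp (2 * b * L)"
proof -
  have FX: "F \<subseteq> L2.X" using F(2) form.Q_X by blast
  have L1: "0 \<le> L + 1" using L by simp
  obtain \<kappa> where \<kappa>: "\<kappa> \<in> borel_measurable P" "\<And>z. \<bar>\<kappa> z\<bar> \<le> A * exp (b * (L + 1))"
    and ineq: "\<And>u. u \<in> Q \<Longrightarrow> (L + 1) * (L2.nrm u)\<^sup>2 \<le> Re (q u u) + L2.nrm u * L2.nrm (cls (kernel_op \<kappa> (L2_rep u)))"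
    using kernel_gap_at[OF gap L1] by blast
  have "1 \<le> (L2.nrm (cls (kernel_op \<kappa> (L2_rep e))))\<^sup>2" if e: "e \<in> F" for e
  proof -
    have "L2.nrm e = 1" using F(3)[OF e e] by (simp add: hnorm_def)
    then have "1 \<le> L2.nrm (cls (kernel_op \<kappa> (L2_rep e)))" using ineq[of e] L(2)[OF e] F(2) e by auto
    then show ?thesis by (rule one_le_power)
  qed
  then have "(\<Sum>e\<in>F. 1) \<le> (\<Sum>e\<in>F. (L2.nrm (cls (kernel_op \<kappa> (L2_rep e))))\<^sup>2)" by (rule sum_mono)
  also have "\<dots> \<le> (A * exp (b * (L + 1)))\<^sup>2 * \<mu>\<^sup>2" by (rule kernel_op_hilbert_schmidt[OF \<kappa> F(1) FX F(3)])
  also have "\<dots> = (A * \<mu> * exp b)\<^sup>2 * (exp (b * L))\<^sup>2"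
    by (simp add: distrib_left exp_add power_mult_distrib)
  also have "(exp (b * L))\<^sup>2 = exp (2 * b * L)" by (simp add: power2_eq_square flip: exp_add)
  finally show ?thesis by simp
qed

end

section \<open>Dini moduli\<close>

lemma disjoint_indicator_sum_le:
  fixes c :: "nat \<Rightarrow> ennreal"
  assumes "disjoint_family_on A {..<n}" "\<And>j. j < n \<Longrightarrow> t \<in> A j \<Longrightarrow> c j \<le> F"
  shows "(\<Sum>j<n. c j * indicator (A j) t) \<le> F"
proof (cases "\<exists>i<n. t \<in> A i")
  case True
  then obtain i where i: "i < n" "t \<in> A i" by blast
  have "(\<Sum>j<n. c j * indicator (A j) t) = (\<Sum>j<n. if j = i then c i else 0)"
    using assms(1) i by (intro sum.cong) (auto simp: disjoint_family_on_def indicator_def)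
  then show ?thesis using i assms(2) by simp
next
  case False
  then have "(\<Sum>j<n. c j * indicator (A j) t) = (\<Sum>j<n. 0)"
    by (intro sum.cong) (auto simp: indicator_def)
  then show ?thesis by simp
qed

lemma dyadic_scale_exists:
  fixes t :: real assumes "0 < t" "t \<le> 1"
  obtains j where "(1/2) ^ Suc j < t" "t \<le> (1/2) ^ j"
proof -
  obtain n where n: "(1/2) ^ n < t" using real_arch_pow_inv[of t "1/2"] assms by auto
  define m where "m = (LEAST n. (1/2) ^ n < t)"
  have m: "(1/2) ^ m < t" unfolding m_def using n by (rule LeastI)
  then obtain j where j: "m = Suc j" using assms by (cases m) auto
  have "\<not> (1/2) ^ j < t" using not_less_Least[of j "\<lambda>n. (1/2) ^ n < t"] j by (simp add: m_def)
  then show ?thesis using m j that by auto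
qed

lemma dini_set_bdd:
  fixes h :: "'a::metric_space \<Rightarrow> complex"
  assumes "\<And>x. cmod (h x) \<le> K"
  shows "bdd_above {cmod (h x - h y) | x y. dist x y \<le> s}"
proof (rule bdd_aboveI)
  fix r assume "r \<in> {cmod (h x - h y) | x y. dist x y \<le> s}"
  then obtain x y where "r = cmod (h x - h y)" by blast
  then show "r \<le> 2 * K" using norm_triangle_ineq4[of "h x" "h y"] assms[of x] assms[of y] by simp
qed

lemma dini_modulus_ge:
  fixes h :: "'a::metric_space \<Rightarrow> complex"
  assumes "\<And>x. cmod (h x) \<le> K" "dist x y \<le> t * diameter (UNIV :: 'a set)"
  shows "cmod (h x - h y) \<le> dini_modulus h t"
  unfolding dini_modulus_def using assms by (intro cSup_upper dini_set_bdd[of h K]) auto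

lemma dini_modulus_le:
  fixes h :: "'a::metric_space \<Rightarrow> complex"
  assumes "0 \<le> t" "0 \<le> diameter (UNIV :: 'a set)"
    and "\<And>x y. dist x y \<le> t * diameter (UNIV :: 'a set) \<Longrightarrow> cmod (h x - h y) \<le> c"
  shows "dini_modulus h t \<le> c"
proof -
  have "dist x x \<le> t * diameter (UNIV :: 'a set)" for x :: 'a using assms(1,2) by simp
  then have "{cmod (h x - h y) | x y. dist x y \<le> t * diameter (UNIV :: 'a set)} \<noteq> {}" by blast
  then show ?thesis unfolding dini_modulus_def using assms(3) by (intro cSup_least) auto
qed

lemma dini_modulus_nonneg:
  fixes h :: "'a::metric_space \<Rightarrow> complex"
  assumes "\<And>x. cmod (h x) \<le> K" "0 \<le> t" "0 \<le> diameter (UNIV :: 'a set)"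
  shows "0 \<le> dini_modulus h t"
  using dini_modulus_ge[of h K undefined undefined t] assms by simp

lemma dini_modulus_mono:
  fixes h :: "'a::metric_space \<Rightarrow> complex"
  assumes "\<And>x. cmod (h x) \<le> K" "0 \<le> s" "s \<le> t" "0 \<le> diameter (UNIV :: 'a set)"
  shows "dini_modulus h s \<le> dini_modulus h t"
proof (rule dini_modulus_le[OF assms(2,4)])
  fix x y :: 'a assume "dist x y \<le> s * diameter (UNIV :: 'a set)"
  also have "\<dots> \<le> t * diameter (UNIV :: 'a set)" using assms by (intro mult_right_mono) auto
  finally show "cmod (h x - h y) \<le> dini_modulus h t" by (rule dini_modulus_ge[OF assms(1)])
qed

definition dini_integral :: "('a::metric_space \<Rightarrow> complex) \<Rightarrow> ennreal"
  where "dini_integral h = (\<integral>\<^sup>+ t \<in> {0<..1}. ennreal (dini_modulus h t / t) \<partial>lborel)"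

lemma dini_iff: "h \<in> dini \<longleftrightarrow> bounded (range h) \<and> uniformly_continuous_on UNIV h \<and> dini_integral h < \<infinity>"
  by (simp add: dini_def dini_integral_def)

lemma dini_bounded: assumes "h \<in> dini" shows "\<exists>K. \<forall>x. cmod (h x) \<le> K"
  using assms by (auto simp: dini_iff bounded_iff)

lemma dini_integrand_measurable:
  fixes h :: "'a::metric_space \<Rightarrow> complex"
  assumes "\<And>x. cmod (h x) \<le> K" "0 \<le> diameter (UNIV :: 'a set)"
  shows "(\<lambda>t. ennreal (dini_modulus h t / t) * indicator {0<..1} t) \<in> borel_measurable lborel"
proof -
  have "mono_on {0<..1} (dini_modulus h)"
    using dini_modulus_mono[of h K] assms by (intro mono_onI) auto
  then have [measurable]: "dini_modulus h \<in> borel_measurable (restrict_space borel {0<..1})"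
    by (rule borel_measurable_mono_on_fnc)
  have "(\<lambda>t. t) \<in> borel_measurable (restrict_space borel {0<..(1::real)})"
    by (rule measurable_restrict_space1) simp
  then have "(\<lambda>t. ennreal (dini_modulus h t / t)) \<in> borel_measurable (restrict_space borel {0<..1})"
    by (intro measurable_compose[OF _ measurable_ennreal] borel_measurable_divide) auto
  then show ?thesis by (subst (asm) borel_measurable_restrict_space_iff_ennreal) auto
qed

text \<open>Moduli of continuity are monotone and therefore measurable, which makes their integrals
  subadditive.  The closure properties of the algebra of Dini functions follow from this.\<close>

lemma dini_integral_combine:
  fixes f g h :: "'a::metric_space \<Rightarrow> complex"
  assumes d: "0 \<le> diameter (UNIV :: 'a set)"
    and f: "f \<in> dini" and g: "g \<in> dini" and c: "0 \<le> a" "0 \<le> b"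
    and le: "\<And>x y. cmod (h x - h y) \<le> a * cmod (f x - f y) + b * cmod (g x - g y)"
  shows "dini_integral h < \<infinity>"
proof -
  obtain K where K: "\<And>x. cmod (f x) \<le> K" using dini_bounded[OF f] by blast
  obtain K' where K': "\<And>x. cmod (g x) \<le> K'" using dini_bounded[OF g] by blast
  have mod: "dini_modulus h t \<le> a * dini_modulus f t + b * dini_modulus g t" if t: "0 \<le> t" for t
  proof (rule dini_modulus_le[OF t d])
    fix x y :: 'a assume xy: "dist x y \<le> t * diameter (UNIV :: 'a set)"
    have "a * cmod (f x - f y) \<le> a * dini_modulus f t" "b * cmod (g x - g y) \<le> b * dini_modulus g t"
      using dini_modulus_ge[of f K x y t, OF K xy] dini_modulus_ge[of g K' x y t, OF K' xy] c by (auto intro: mult_left_mono)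
    then show "cmod (h x - h y) \<le> a * dini_modulus f t + b * dini_modulus g t" using le[of x y] by linarith
  qed
  note mf = dini_integrand_measurable[OF K d] and mg = dini_integrand_measurable[OF K' d]
  have "dini_integral h \<le> (\<integral>\<^sup>+t. ennreal a * (ennreal (dini_modulus f t / t) * indicator {0<..1} t)
      + ennreal b * (ennreal (dini_modulus g t / t) * indicator {0<..1} t) \<partial>lborel)"
    unfolding dini_integral_def
  proof (rule nn_integral_mono)
    fix t :: real
    show "ennreal (dini_modulus h t / t) * indicator {0<..1} t \<le> ennreal a * (ennreal (dini_modulus f t / t) * indicator {0<..1} t)
      + ennreal b * (ennreal (dini_modulus g t / t) * indicator {0<..1} t)"
    proof (cases "t \<in> {0<..1}")
      case True
      then have t: "0 < t" by simp
      have "dini_modulus h t / t \<le> a * (dini_modulus f t / t) + b * (dini_modulus g t / t)"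
        using mod[of t] t by (simp add: field_simps)
      then have "ennreal (dini_modulus h t / t) \<le> ennreal (a * (dini_modulus f t / t) + b * (dini_modulus g t / t))"
        by (rule ennreal_leI)
      also have "\<dots> = ennreal a * ennreal (dini_modulus f t / t) + ennreal b * ennreal (dini_modulus g t / t)"
        using dini_modulus_nonneg[of f K t, OF K] dini_modulus_nonneg[of g K' t, OF K'] t d c
        by (simp flip: ennreal_mult)
      finally show ?thesis using True by simp
    qed simp
  qed
  also have "\<dots> = ennreal a * dini_integral f + ennreal b * dini_integral g"
    using mf mg by (simp add: nn_integral_add nn_integral_cmult dini_integral_def)
  also have "\<dots> < \<infinity>" using f g by (simp add: dini_iff ennreal_mult_less_top)
  finally show ?thesis .
qed

lemma dini_combine:
  fixes f g h :: "'a::metric_space \<Rightarrow> complex"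
  assumes d: "0 \<le> diameter (UNIV :: 'a set)"
    and f: "f \<in> dini" and g: "g \<in> dini" and c: "0 \<le> a" "0 \<le> b"
    and le: "\<And>x y. cmod (h x - h y) \<le> a * cmod (f x - f y) + b * cmod (g x - g y)"
    and bound: "\<And>x. cmod (h x) \<le> K"
  shows "h \<in> dini"
proof -
  have "uniformly_continuous_on UNIV h"
    unfolding uniformly_continuous_on_def
  proof (intro allI impI)
    fix e :: real assume e: "e > 0"
    have uf: "uniformly_continuous_on UNIV f" and ug: "uniformly_continuous_on UNIV g"
      using f g by (auto simp: dini_iff)
    obtain d1 where d1: "d1 > 0" "\<And>x y. dist y x < d1 \<Longrightarrow> dist (f y) (f x) < e / (2 * (a + 1))"
      using uf[unfolded uniformly_continuous_on_def, rule_format, of "e / (2 * (a + 1))"] e c by auto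
    obtain d2 where d2: "d2 > 0" "\<And>x y. dist y x < d2 \<Longrightarrow> dist (g y) (g x) < e / (2 * (b + 1))"
      using ug[unfolded uniformly_continuous_on_def, rule_format, of "e / (2 * (b + 1))"] e c by auto
    show "\<exists>\<eta>>0. \<forall>x\<in>UNIV. \<forall>x'\<in>UNIV. dist x' x < \<eta> \<longrightarrow> dist (h x') (h x) < e"
    proof (intro exI[of _ "min d1 d2"] conjI ballI impI)
      show "0 < min d1 d2" using d1 d2 by simp
      fix x x' :: 'a assume xx: "dist x' x < min d1 d2"
      have 1: "(a + 1) * cmod (f x' - f x) < e / 2"
        using d1(2)[of x' x] xx c by (simp add: dist_norm field_simps)
      have 2: "(b + 1) * cmod (g x' - g x) < e / 2"
        using d2(2)[of x' x] xx c by (simp add: dist_norm field_simps)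
      have "a * cmod (f x' - f x) \<le> (a + 1) * cmod (f x' - f x)" "b * cmod (g x' - g x) \<le> (b + 1) * cmod (g x' - g x)"
        by (intro mult_right_mono; simp)+
      then show "dist (h x') (h x) < e" using le[of x' x] 1 2 unfolding dist_norm by linarith
    qed
  qed
  moreover have "bounded (range h)" using bound by (auto simp: bounded_iff)
  ultimately show ?thesis using dini_integral_combine[OF d f g c le] by (simp add: dini_iff)
qed

lemma dini_const:
  fixes c :: complex
  assumes d: "0 \<le> diameter (UNIV :: 'a::metric_space set)"
  shows "(\<lambda>x::'a. c) \<in> dini"
proof -
  have "dini_modulus (\<lambda>x::'a. c) t = 0" if "0 < t" for t
  proof (rule antisym)
    show "dini_modulus (\<lambda>x::'a. c) t \<le> 0" using that d by (intro dini_modulus_le) auto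
    show "0 \<le> dini_modulus (\<lambda>x::'a. c) t" using that d by (intro dini_modulus_nonneg[of _ "cmod c"]) auto
  qed
  then have "dini_integral (\<lambda>x::'a. c) = (\<integral>\<^sup>+ t. 0 \<partial>(lborel :: real measure))"
    unfolding dini_integral_def by (intro nn_integral_cong) (auto simp: indicator_def)
  then show ?thesis by (auto simp: dini_iff uniformly_continuous_on_def)
qed

lemma dini_lipschitz:
  fixes h :: "'a::metric_space \<Rightarrow> complex"
  assumes d: "0 \<le> diameter (UNIV :: 'a set)"
    and K: "\<And>x. cmod (h x) \<le> K" and L: "\<And>x y. cmod (h x - h y) \<le> L * dist x y" "0 \<le> L"
  shows "h \<in> dini"
proof -
  have "dini_modulus h t / t \<le> L * diameter (UNIV :: 'a set)" if "0 < t" for t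
  proof -
    have "dini_modulus h t \<le> L * (t * diameter (UNIV :: 'a set))"
    proof (rule dini_modulus_le)
      fix x y :: 'a assume "dist x y \<le> t * diameter (UNIV :: 'a set)"
      then have "L * dist x y \<le> L * (t * diameter (UNIV :: 'a set))" using L(2) by (rule mult_left_mono)
      then show "cmod (h x - h y) \<le> L * (t * diameter (UNIV :: 'a set))" using L(1)[of x y] by simp
    qed (use that d in auto)
    then show ?thesis using that by (simp add: field_simps)
  qed
  then have "dini_integral h \<le> (\<integral>\<^sup>+ t. ennreal (L * diameter (UNIV :: 'a set)) * indicator {0<..1} t \<partial>(lborel :: real measure))"
    unfolding dini_integral_def by (intro nn_integral_mono) (auto simp: indicator_def ennreal_leI)
  also have "\<dots> < \<infinity>" by (simp add: nn_integral_cmult ennreal_mult_less_top)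
  finally have i: "dini_integral h < \<infinity>" .
  have "uniformly_continuous_on UNIV h"
    unfolding uniformly_continuous_on_def
  proof (intro allI impI)
    fix e :: real assume e: "e > 0"
    show "\<exists>\<eta>>0. \<forall>x\<in>UNIV. \<forall>x'\<in>UNIV. dist x' x < \<eta> \<longrightarrow> dist (h x') (h x) < e"
    proof (intro exI[of _ "e / (L + 1)"] conjI ballI impI)
      show "0 < e / (L + 1)" using e L(2) by simp
      fix x x' :: 'a assume "dist x' x < e / (L + 1)"
      then have "(L + 1) * dist x' x < e" using L(2) by (simp add: field_simps)
      moreover have "dist (h x') (h x) \<le> L * dist x' x" using L(1) by (simp add: dist_norm)
      moreover have "(L + 1) * dist x' x = L * dist x' x + dist x' x" by (simp add: distrib_right)
      moreover have "0 \<le> dist x' x" by simp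
      ultimately show "dist (h x') (h x) < e" by linarith
    qed
  qed
  moreover have "bounded (range h)" using K by (auto simp: bounded_iff)
  ultimately show ?thesis using i by (simp add: dini_iff)
qed

lemma dini_algebra:
  fixes f g :: "'a::metric_space \<Rightarrow> complex"
  assumes d: "0 \<le> diameter (UNIV :: 'a set)" and f: "f \<in> dini" and g: "g \<in> dini"
  shows "(\<lambda>x. f x + g x) \<in> dini" "(\<lambda>x. f x * g x) \<in> dini" "(\<lambda>x. c * f x) \<in> dini" "(\<lambda>x. cnj (f x)) \<in> dini"
proof -
  obtain K where K: "\<And>x. cmod (f x) \<le> K" using dini_bounded[OF f] by blast
  obtain K' where K': "\<And>x. cmod (g x) \<le> K'" using dini_bounded[OF g] by blast
  have K0: "0 \<le> K" "0 \<le> K'" using K[of undefined] K'[of undefined] norm_ge_zero order_trans by blast+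
  show "(\<lambda>x. f x + g x) \<in> dini"
  proof (rule dini_combine[OF d f g, of 1 1])
    show "cmod (f x + g x - (f y + g y)) \<le> 1 * cmod (f x - f y) + 1 * cmod (g x - g y)" for x y
      using norm_triangle_ineq[of "f x - f y" "g x - g y"] by (simp add: algebra_simps)
    show "cmod (f x + g x) \<le> K + K'" for x using norm_triangle_ineq[of "f x" "g x"] K[of x] K'[of x] by linarith
  qed simp_all
  show "(\<lambda>x. f x * g x) \<in> dini"
  proof (rule dini_combine[OF d f g K0(2,1)])
    show "cmod (f x * g x) \<le> K * K'" for x
      using K K' K0 by (auto simp: norm_mult intro: mult_mono)
    fix x y
    have "f x * g x - f y * g y = g x * (f x - f y) + f y * (g x - g y)" by (simp add: algebra_simps)
    then have "cmod (f x * g x - f y * g y) \<le> cmod (g x) * cmod (f x - f y) + cmod (f y) * cmod (g x - g y)"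
      by (metis norm_triangle_ineq norm_mult)
    also have "\<dots> \<le> K' * cmod (f x - f y) + K * cmod (g x - g y)"
      using K K' by (intro add_mono mult_right_mono) auto
    finally show "cmod (f x * g x - f y * g y) \<le> K' * cmod (f x - f y) + K * cmod (g x - g y)" .
  qed
  show "(\<lambda>x. c * f x) \<in> dini"
  proof (rule dini_combine[OF d f g, of "cmod c" 0])
    show "cmod (c * f x) \<le> cmod c * K" for x using K by (auto simp: norm_mult intro: mult_left_mono)
    show "cmod (c * f x - c * f y) \<le> cmod c * cmod (f x - f y) + 0 * cmod (g x - g y)" for x y
      by (simp flip: right_diff_distrib norm_mult)
  qed simp_all
  show "(\<lambda>x. cnj (f x)) \<in> dini"
  proof (rule dini_combine[OF d f g, of 1 0])
    show "cmod (cnj (f x)) \<le> K" for x using K by simp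
    show "cmod (cnj (f x) - cnj (f y)) \<le> 1 * cmod (f x - f y) + 0 * cmod (g x - g y)" for x y
      by (simp flip: complex_cnj_diff)
  qed simp_all
qed

text \<open>By monotonicity, the integral of \<open>\<omega>(t) / t\<close> over the dyadic interval above \<open>(1/2) ^ Suc j\<close> is at
  least half of \<open>\<omega>((1/2) ^ Suc j)\<close>.\<close>

lemma dini_dyadic_summable:
  fixes h :: "'a::metric_space \<Rightarrow> complex"
  assumes d: "0 \<le> diameter (UNIV :: 'a set)" and h: "h \<in> dini"
  shows "summable (\<lambda>j. dini_modulus h ((1/2) ^ j))"
proof -
  obtain K where K: "\<And>x. cmod (h x) \<le> K" using dini_bounded[OF h] by blast
  define a where "a j = dini_modulus h ((1/2) ^ Suc j)" for j
  have a0: "0 \<le> a j" for j unfolding a_def by (rule dini_modulus_nonneg[OF K _ d]) simp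
  define A where "A j = {(1/2) ^ Suc j <.. (1/2::real) ^ j}" for j :: nat
  have disj: "disjoint_family_on A {..<n}" for n
  proof -
    have "A i \<inter> A j = {}" if "i < j" for i j
    proof -
      have "(1/2) ^ j \<le> (1/2::real) ^ Suc i" using that by (intro power_decreasing) auto
      then show ?thesis by (auto simp: A_def)
    qed
    then show ?thesis unfolding disjoint_family_on_def by (metis inf_commute linorder_neqE_nat)
  qed
  have part: "(\<Sum>j<n. ennreal (a j / 2)) \<le> dini_integral h" for n
  proof -
    have "(\<Sum>j<n. ennreal (a j / 2)) = (\<Sum>j<n. \<integral>\<^sup>+t. ennreal (a j / (1/2) ^ j) * indicator (A j) t \<partial>lborel)"
    proof (rule sum.cong[OF refl])
      fix j
      have "(\<integral>\<^sup>+t. ennreal (a j / (1/2) ^ j) * indicator (A j) t \<partial>lborel) = ennreal (a j / (1/2) ^ j) * ennreal ((1/2) ^ j - (1/2) ^ Suc j)"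
        by (simp add: nn_integral_cmult A_def)
      also have "\<dots> = ennreal (a j / (1/2) ^ j * ((1/2) ^ j - (1/2) ^ Suc j))"
        using a0 by (intro ennreal_mult[symmetric]) auto
      also have "a j / (1/2) ^ j * ((1/2) ^ j - (1/2) ^ Suc j) = a j / 2" by (simp add: field_simps)
      finally show "ennreal (a j / 2) = (\<integral>\<^sup>+t. ennreal (a j / (1/2) ^ j) * indicator (A j) t \<partial>lborel)" by simp
    qed
    also have "\<dots> = (\<integral>\<^sup>+t. (\<Sum>j<n. ennreal (a j / (1/2) ^ j) * indicator (A j) t) \<partial>lborel)"
      by (rule nn_integral_sum[symmetric]) (simp add: A_def)
    also have "\<dots> \<le> dini_integral h"
      unfolding dini_integral_def
    proof (intro nn_integral_mono disjoint_indicator_sum_le disj)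
      fix t j assume "t \<in> A j"
      then have t: "(1/2) ^ Suc j < t" "t \<le> (1/2) ^ j" by (auto simp: A_def)
      have t0: "0 < t" using t(1) by (rule less_trans[rotated]) simp
      have "t \<le> 1" using t(2) power_le_one[of "1/2::real" j] by simp
      have "a j \<le> dini_modulus h t" unfolding a_def using t by (intro dini_modulus_mono[OF K _ _ d]) auto
      then have "a j / (1/2) ^ j \<le> dini_modulus h t / t"
        using t t0 a0[of j] by (intro frac_le) auto
      then show "ennreal (a j / (1/2) ^ j) \<le> ennreal (dini_modulus h t / t) * indicator {0<..1} t"
        using t0 \<open>t \<le> 1\<close> by (simp add: ennreal_leI)
    qed
    finally show ?thesis .
  qed
  have fin: "dini_integral h < \<infinity>" using h by (simp add: dini_iff)
  have "summable (\<lambda>j. a j / 2)"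
  proof (rule bounded_imp_summable)
    show "0 \<le> a j / 2" for j using a0 by simp
    fix n
    have "ennreal (\<Sum>j\<le>n. a j / 2) \<le> dini_integral h"
      using part[of "Suc n"] a0 by (simp add: sum_ennreal lessThan_Suc_atMost)
    then have "enn2real (ennreal (\<Sum>j\<le>n. a j / 2)) \<le> enn2real (dini_integral h)"
      using fin by (intro enn2real_mono) auto
    then show "(\<Sum>j\<le>n. a j / 2) \<le> enn2real (dini_integral h)" using a0 by (simp add: sum_nonneg)
  qed
  then have "summable a" using summable_mult[of "\<lambda>j. a j / 2" 2] by simp
  then show ?thesis unfolding a_def by (rule iffD1[OF summable_Suc_iff[of "\<lambda>j. dini_modulus h ((1/2) ^ j)"]])
qed

section \<open>Kernel estimates on Ahlfors regular spaces\<close>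

locale ahlfors_space = borel_metric_measure +
  assumes \<delta>_pos: "\<delta> > 0" and ahlfors: "ahlfors_regular M \<delta>"
begin

definition "diam = diameter (UNIV :: 'a set)"

text \<open>Balls of arbitrarily large radius would have arbitrarily large mass.\<close>

lemma bounded_UNIV: "bounded (UNIV :: 'a set)"
proof (rule ccontr)
  assume unb: "\<not> bounded (UNIV :: 'a set)"
  obtain C where C: "C \<ge> 1" and reg: "\<And>(x::'a) r. 0 \<le> r \<Longrightarrow>
      ereal r < (SUP (y, z) \<in> (UNIV :: ('a \<times> 'a) set). ereal (dist y z)) \<Longrightarrow> r powr \<delta> / C \<le> measure M (cball x r)"
    using ahlfors unfolding ahlfors_regular_def by blast
  define r where "r = (C * \<mu> + 1) powr (1 / \<delta>)"
  have r: "r powr \<delta> = C * \<mu> + 1" using \<delta>_pos C by (simp add: r_def powr_powr add_nonneg_pos order_less_imp_le)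
  have "\<exists>y z :: 'a. r < dist y z"
  proof (rule ccontr)
    assume "\<not> ?thesis"
    then have "bounded (UNIV :: 'a set)"
      unfolding bounded_def by (intro exI[of _ undefined] exI[of _ r]) (auto simp: not_less)
    then show False using unb by blast
  qed
  then obtain y z :: 'a where yz: "r < dist y z" by blast
  then have "ereal r < (SUP (y, z) \<in> (UNIV :: ('a \<times> 'a) set). ereal (dist y z))"
    by (intro less_SUP_iff[THEN iffD2] bexI[of _ "(y, z)"]) auto
  from reg[OF _ this, of y] have "r powr \<delta> / C \<le> measure M (cball y r)" by (simp add: r_def)
  also have "\<dots> \<le> \<mu>" using finite_measure_mono[of "cball y r" UNIV] sets_M by simp
  finally show False using r C by (simp add: field_simps)
qed

lemma dist_le_diam: "dist x y \<le> diam" for x y :: 'a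
  unfolding diam_def using diameter_bounded_bound[OF bounded_UNIV] by blast

lemma diam_nonneg: "0 \<le> diam" using dist_le_diam[of undefined undefined] by simp

lemma ball_bounds: "\<exists>C\<ge>1. \<forall>(x::'a) r. 0 \<le> r \<longrightarrow> r < diam \<longrightarrow> r powr \<delta> / C \<le> measure M (cball x r) \<and> measure M (cball x r) \<le> C * r powr \<delta>"
proof -
  have "ereal r < (SUP (y, z) \<in> (UNIV :: ('a \<times> 'a) set). ereal (dist y z))" if r: "0 \<le> r" "r < diam" for r
  proof -
    define s where "s = (r + diam) / 2"
    have s: "0 < s" "r < s" "s < diam" using r by (auto simp: s_def)
    then obtain y z :: 'a where "s < dist y z"
      using diameter_lower_bounded[OF bounded_UNIV, of s] unfolding diam_def by auto
    then show ?thesis using s by (intro less_SUP_iff[THEN iffD2] bexI[of _ "(y, z)"]) auto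
  qed
  then show ?thesis using ahlfors unfolding ahlfors_regular_def by meson
qed

lemma ball_measurable [measurable]: "cball x r \<in> sets M" for x :: 'a using sets_M by simp

text \<open>Regularity bounds the mass only for radii below the diameter.  At the diameter itself the total
  mass enters the constant.\<close>

lemma ball_upper: "\<exists>C0\<ge>0. \<forall>(x::'a) r. 0 < r \<longrightarrow> r \<le> diam \<longrightarrow> measure M (cball x r) \<le> C0 * r powr \<delta>"
proof -
  obtain C where C: "C \<ge> 1" and up: "\<And>(x::'a) r. 0 \<le> r \<Longrightarrow> r < diam \<Longrightarrow> measure M (cball x r) \<le> C * r powr \<delta>"
    using ball_bounds by blast
  define C0 where "C0 = max C (\<mu> / diam powr \<delta>)"
  have "measure M (cball x r) \<le> C0 * r powr \<delta>" if r: "0 < r" "r \<le> diam" for x :: 'a and r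
  proof (cases "r = diam")
    case True
    have "measure M (cball x r) \<le> \<mu>" using finite_measure_mono[of "cball x r" UNIV] sets_M by simp
    also have "\<dots> = \<mu> / diam powr \<delta> * diam powr \<delta>" using True r by simp
    also have "\<dots> \<le> C0 * diam powr \<delta>" unfolding C0_def by (intro mult_right_mono) auto
    finally show ?thesis using True by simp
  next
    case False
    then have "measure M (cball x r) \<le> C * r powr \<delta>" using r by (intro up) auto
    also have "\<dots> \<le> C0 * r powr \<delta>" unfolding C0_def by (intro mult_right_mono) auto
    finally show ?thesis .
  qed
  moreover have "0 \<le> C0" using C by (simp add: C0_def)
  ultimately show ?thesis by blast
qed

text \<open>A ball of radius \<open>r\<close> has mass at most a multiple of \<open>r powr \<delta>\<close>, which cancels the
  singularity of the kernel on each dyadic shell; what remains is the dyadic sum of the modulus of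
  continuity.\<close>

lemma dini_schur: assumes h: "h \<in> dini" shows "\<exists>K S. schur_multiplier M \<delta> h K S"
proof -
  obtain K where K: "\<And>x. cmod (h x) \<le> K" using dini_bounded[OF h] by blast
  have hm: "h \<in> borel_measurable M"
  proof -
    have "continuous_on UNIV h" using h by (auto simp: dini_iff intro: uniformly_continuous_imp_continuous)
    then have "h \<in> borel_measurable borel" by (rule borel_measurable_continuous_onI)
    then show ?thesis by (simp add: measurable_cong_sets[OF sets_M refl])
  qed
  obtain C0 where C0: "0 \<le> C0" and up: "\<And>(x::'a) r. 0 < r \<Longrightarrow> r \<le> diam \<Longrightarrow> measure M (cball x r) \<le> C0 * r powr \<delta>"
    using ball_upper by blast
  define a where "a j = dini_modulus h ((1/2) ^ j)" for j
  have a0: "0 \<le> a j" for j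
    unfolding a_def using diam_nonneg by (intro dini_modulus_nonneg[OF K]) (auto simp: diam_def)
  have a_sum: "summable a" unfolding a_def using dini_dyadic_summable[OF _ h] diam_nonneg by (simp add: diam_def)
  define S where "S = (\<Sum>j. a j * (C0 * 2 powr \<delta>))"
  have S0: "0 \<le> S" unfolding S_def using a0 C0 a_sum by (intro suminf_nonneg summable_mult2) auto
  have "(\<integral>\<^sup>+y. ennreal (cmod (h x - h y) / dist x y powr \<delta>) \<partial>M) \<le> ennreal S" for x
  proof (cases "diam = 0")
    case True
    then have dz: "dist x y = 0" for y using dist_le_diam[of x y] zero_le_dist[of x y] by linarith
    show ?thesis unfolding dz by simp
  next
    case False
    then have diam: "0 < diam" using diam_nonneg by simp
    define c where "c j = a j / ((1/2) ^ Suc j * diam) powr \<delta>" for j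
    have c0: "0 \<le> c j" for j using a0 by (simp add: c_def)
    define Bl where "Bl j = cball x ((1/2) ^ j * diam)" for j
    have pt: "ennreal (cmod (h x - h y) / dist x y powr \<delta>) \<le> (\<Sum>j. ennreal (c j) * indicator (Bl j) y)" for y
    proof (cases "y = x")
      case False
      then have "0 < dist x y / diam" "dist x y / diam \<le> 1" using diam dist_le_diam[of x y] by auto
      then obtain j where j: "(1/2) ^ Suc j < dist x y / diam" "dist x y / diam \<le> (1/2) ^ j"
        using dyadic_scale_exists by blast
      have le: "dist x y \<le> (1/2) ^ j * diam" and ge: "(1/2) ^ Suc j * diam < dist x y"
        using j diam by (simp_all add: field_simps)
      have "cmod (h x - h y) \<le> a j"
        unfolding a_def using le by (intro dini_modulus_ge[OF K]) (simp add: diam_def)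
      moreover have "((1/2) ^ Suc j * diam) powr \<delta> \<le> dist x y powr \<delta>"
        using ge diam \<delta>_pos by (intro powr_mono2) auto
      ultimately have "cmod (h x - h y) / dist x y powr \<delta> \<le> c j"
        unfolding c_def using diam by (intro frac_le a0) auto
      then have "ennreal (cmod (h x - h y) / dist x y powr \<delta>) \<le> ennreal (c j) * indicator (Bl j) y"
        using le by (simp add: Bl_def ennreal_leI)
      also have "\<dots> \<le> (\<Sum>i. ennreal (c i) * indicator (Bl i) y)"
      proof -
        define g where "g i = ennreal (c i) * indicator (Bl i) y" for i
        have "sum g {j} \<le> suminf g" by (intro sum_le_suminf) auto
        then have "g j \<le> suminf g" by simp
        then show ?thesis unfolding g_def .
      qed
      finally show ?thesis .
    qed simp
    have "(\<integral>\<^sup>+y. ennreal (cmod (h x - h y) / dist x y powr \<delta>) \<partial>M) \<le> (\<integral>\<^sup>+y. (\<Sum>j. ennreal (c j) * indicator (Bl j) y) \<partial>M)"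
      by (intro nn_integral_mono pt)
    also have "\<dots> = (\<Sum>j. \<integral>\<^sup>+y. ennreal (c j) * indicator (Bl j) y \<partial>M)"
      by (intro nn_integral_suminf) (auto simp: Bl_def)
    also have "\<dots> \<le> (\<Sum>j. ennreal (a j * (C0 * 2 powr \<delta>)))"
    proof (rule suminf_le)
      fix j
      have r: "0 < (1/2) ^ j * diam" "(1/2) ^ j * diam \<le> diam"
        using diam by (auto simp: mult_le_cancel_right1 power_le_one)
      have "(\<integral>\<^sup>+y. ennreal (c j) * indicator (Bl j) y \<partial>M) = ennreal (c j) * ennreal (measure M (Bl j))"
        by (simp add: nn_integral_cmult Bl_def emeasure_eq_measure)
      also have "\<dots> = ennreal (c j * measure M (Bl j))" using c0 by (simp add: ennreal_mult)
      also have "\<dots> \<le> ennreal (a j * (C0 * 2 powr \<delta>))"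
      proof (rule ennreal_leI)
        have "c j * measure M (Bl j) \<le> c j * (C0 * ((1/2) ^ j * diam) powr \<delta>)"
          unfolding Bl_def using r by (intro mult_left_mono up c0) auto
        also have "((1/2) ^ j * diam) powr \<delta> = (2 * ((1/2) ^ Suc j * diam)) powr \<delta>" by simp
        also have "\<dots> = 2 powr \<delta> * ((1/2) ^ Suc j * diam) powr \<delta>" using diam by (subst powr_mult) auto
        also have "c j * (C0 * (2 powr \<delta> * ((1/2) ^ Suc j * diam) powr \<delta>)) = a j * (C0 * 2 powr \<delta>)"
          using diam by (simp add: c_def)
        finally show "c j * measure M (Bl j) \<le> a j * (C0 * 2 powr \<delta>)" .
      qed
      finally show "(\<integral>\<^sup>+y. ennreal (c j) * indicator (Bl j) y \<partial>M) \<le> ennreal (a j * (C0 * 2 powr \<delta>))" .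
    qed auto
    also have "\<dots> = ennreal S" unfolding S_def using a0 C0 a_sum by (intro suminf_ennreal2 summable_mult2) auto
    finally show ?thesis .
  qed
  then have "schur_multiplier M \<delta> h K S" using hm K S0 by unfold_locales
  then show ?thesis by blast
qed

lemma dini_energy: assumes h: "h \<in> dini" shows "h \<in> energy_funs"
proof -
  obtain K S where "schur_multiplier M \<delta> h K S" using dini_schur[OF h] by blast
  then interpret schur_multiplier M \<delta> h K S .
  have "diff_quot (\<lambda>x. 1) = (\<lambda>z. 0)" by (simp add: diff_quot_def fun_eq_iff)
  moreover have "(\<lambda>x. 1) \<in> L2_funs M" by (rule bounded_L2[of _ 1]) auto
  ultimately have "(\<lambda>x. 1) \<in> energy_funs" by (simp add: energy_funs_def L2_zero)
  from multiplier_energy[OF this] show ?thesis by simp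
qed

text \<open>A square-integrable function orthogonal to all Lipschitz functions has vanishing integral over
  every closed set, hence over every Borel set.\<close>

lemma dini_orthogonal_zero:
  assumes f: "f \<in> L2_funs M" and orth: "\<And>h. h \<in> dini \<Longrightarrow> (LINT x|M. cnj (f x) * h x) = 0"
  shows "AE x in M. f x = 0"
proof -
  have fm [measurable]: "f \<in> borel_measurable M" using f L2_funsD by blast
  have one: "(\<lambda>x::'a. 1) \<in> dini" using dini_const[of 1] diam_nonneg by (simp add: diam_def)
  have int: "integrable M (\<lambda>x. cnj (f x))"
    using L2_prod_integrable[OF f energy_funsD(1)[OF dini_energy[OF one]]] by simp
  have closed0: "(LINT x|M. indicator F x *\<^sub>R cnj (f x)) = 0" if F: "closed F" for F
  proof (cases "F = {}")
    case False
    \<comment> \<open>Lipschitz functions decreasing to the indicator function of \<open>F\<close>.\<close>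
    define \<phi> where "\<phi> n x = complex_of_real (max 0 (1 - real n * infdist x F))" for n x
    have lip: "\<bar>max 0 (1 - real n * infdist x F) - max 0 (1 - real n * infdist y F)\<bar> \<le> real n * dist x y" for n and x y :: 'a
    proof -
      have "\<bar>infdist x F - infdist y F\<bar> \<le> dist x y"
        using infdist_triangle[of x F y] infdist_triangle[of y F x] by (auto simp: dist_commute)
      then have "\<bar>real n * infdist x F - real n * infdist y F\<bar> \<le> real n * dist x y"
        by (simp add: mult_left_mono flip: right_diff_distrib abs_mult_pos')
      then show ?thesis by linarith
    qed
    have "\<phi> n \<in> dini" for n
    proof (rule dini_lipschitz)
      show "0 \<le> diameter (UNIV :: 'a set)" using diam_nonneg by (simp add: diam_def)
      show "cmod (\<phi> n x) \<le> 1" for x using infdist_nonneg[of x F] by (simp add: \<phi>_def)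
      show "cmod (\<phi> n x - \<phi> n y) \<le> real n * dist x y" for x y
        unfolding \<phi>_def of_real_diff[symmetric] norm_of_real by (rule lip)
    qed simp
    then have z: "(LINT x|M. cnj (f x) * \<phi> n x) = 0" for n by (rule orth)
    have \<phi>m [measurable]: "\<phi> n \<in> borel_measurable M" for n
      using \<open>\<phi> n \<in> dini\<close> dini_energy energy_funsD(3) by blast
    have "(\<lambda>n. LINT x|M. cnj (f x) * \<phi> n x) \<longlonglongrightarrow> (LINT x|M. indicator F x *\<^sub>R cnj (f x))"
    proof (rule integral_dominated_convergence[where w = "\<lambda>x. cmod (f x)"])
      show "(\<lambda>x. indicator F x *\<^sub>R cnj (f x)) \<in> borel_measurable M"
      proof -
        have [measurable]: "F \<in> sets M" using F sets_M by simp
        show ?thesis by measurable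
      qed
      show "integrable M (\<lambda>x. cmod (f x))" using integrable_norm[OF int] by simp
      show "AE x in M. (\<lambda>n. cnj (f x) * \<phi> n x) \<longlonglongrightarrow> indicator F x *\<^sub>R cnj (f x)"
      proof (rule AE_I2)
        fix x
        show "(\<lambda>n. cnj (f x) * \<phi> n x) \<longlonglongrightarrow> indicator F x *\<^sub>R cnj (f x)"
        proof (cases "x \<in> F")
          case True
          then show ?thesis by (simp add: \<phi>_def)
        next
          case False
          then have pos: "0 < infdist x F" using infdist_pos_not_in_closed[OF F \<open>F \<noteq> {}\<close>] by blast
          obtain N :: nat where N: "1 / infdist x F < real N" using reals_Archimedean2 by blast
          have "\<phi> n x = 0" if "n \<ge> N" for n
          proof -
            have "1 / infdist x F < real n" using N that by linarith
            then have "1 < real n * infdist x F" using pos by (simp add: field_simps)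
            then show ?thesis by (simp add: \<phi>_def)
          qed
          then have "eventually (\<lambda>n. cnj (f x) * \<phi> n x = 0) sequentially"
            unfolding eventually_sequentially by (intro exI[of _ N]) simp
          then have "(\<lambda>n. cnj (f x) * \<phi> n x) \<longlonglongrightarrow> 0" by (rule tendsto_eventually)
          then show ?thesis using False by simp
        qed
      qed
      show "AE x in M. norm (cnj (f x) * \<phi> n x) \<le> cmod (f x)" for n
      proof (rule AE_I2)
        fix x
        have "cmod (\<phi> n x) \<le> 1" using infdist_nonneg[of x F] by (simp add: \<phi>_def)
        then show "norm (cnj (f x) * \<phi> n x) \<le> cmod (f x)" by (simp add: norm_mult mult_left_le)
      qed
    qed measurable
    then show ?thesis unfolding z using LIMSEQ_unique tendsto_const by blast
  qed simp
  define I where "I A = (LINT x|M. indicator A x *\<^sub>R cnj (f x))" for A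
  have intA: "integrable M (\<lambda>x. indicator A x *\<^sub>R cnj (f x))" if "A \<in> sets M" for A
    using that int by (rule integrable_mult_indicator)
  have sets: "sets M = sigma_sets UNIV (Collect closed)"
    using sets_M by (simp add: borel_eq_closed)
  have "I A = 0" if "A \<in> sets M" for A
  proof -
    have "Int_stable (Collect (closed :: 'a set \<Rightarrow> bool))" by (auto simp: Int_stable_def)
    moreover have "Collect (closed :: 'a set \<Rightarrow> bool) \<subseteq> Pow UNIV" by simp
    moreover have "A \<in> sigma_sets UNIV (Collect closed)" using that sets by simp
    ultimately show ?thesis
    proof (induction rule: sigma_sets_induct_disjoint)
      show "I {} = 0" by (simp add: I_def)
      show "I A = 0" if "A \<in> Collect closed" for A using closed0 that by (simp add: I_def)
    next
      case (compl A)
      have A: "A \<in> sets M" using compl sets by simp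
      have "I (UNIV - A) = (LINT x|M. indicator UNIV x *\<^sub>R cnj (f x) - indicator A x *\<^sub>R cnj (f x))"
        unfolding I_def by (intro Bochner_Integration.integral_cong) (auto simp: indicator_def)
      also have "\<dots> = I UNIV - I A"
        unfolding I_def using A sets.top[of M] by (intro Bochner_Integration.integral_diff intA) auto
      finally have "I (UNIV - A) = I UNIV - I A" .
      then show ?case using closed0[of UNIV] compl by (simp add: I_def)
    next
      case (union A)
      have A: "A n \<in> sets M" for n using union(2) sets by auto
      have "I (\<Union>n. A n) = (\<Sum>n. I (A n))"
        unfolding I_def set_lebesgue_integral_def[symmetric]
      proof (rule lebesgue_integral_countable_add)
        show "A i \<inter> A j = {}" if "i \<noteq> j" for i j using union(1) that by (auto simp: disjoint_family_on_def)
        show "set_integrable M (\<Union>n. A n) (\<lambda>x. cnj (f x))"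
          unfolding set_integrable_def using A by (intro intA) auto
      qed (rule A)
      then show ?case using union by simp
    qed
  qed
  then have "AE x in M. cnj (f x) = 0"
    using int by (intro density_zero) (auto simp: set_lebesgue_integral_def I_def)
  then show ?thesis by simp
qed

lemma Q_dense: assumes z: "z \<in> L2.X" and orth: "\<And>g. g \<in> Q \<Longrightarrow> L2.ip z g = 0" shows "z = hzero L2"
proof -
  obtain f where f: "f \<in> L2_funs M" and zf: "z = cls f" by (rule L2_class_cases[OF z])
  have "AE x in M. f x = 0"
  proof (rule dini_orthogonal_zero[OF f])
    fix h :: "'a \<Rightarrow> complex" assume "h \<in> dini"
    then have h: "h \<in> energy_funs" by (rule dini_energy)
    show "(LINT x|M. cnj (f x) * h x) = 0"
      using orth[OF cls_Q[OF h]] f energy_funsD(1)[OF h] by (simp add: zf L2_hinner)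
  qed
  then show ?thesis using f by (simp add: zf L2_hzero L2_class_eq_iff L2_zero)
qed

sublocale cf: closed_form L2 Q q
  by unfold_locales (fact Q_dense form_norm_complete)+

text \<open>On each annulus whose radii have a fixed large ratio the two-sided regularity leaves a definite
  part of the kernel integral; hence the integral over \<open>dist x y > r\<close> grows like the number of
  scales above \<open>r\<close>, while the kernel there grows only exponentially in that number.\<close>

lemma truncated_kernel:
  assumes diam: "0 < diam"
  shows "\<exists>c>0. \<exists>a>1. \<forall>n x. ennreal (real n * c) \<le>
    (\<integral>\<^sup>+y. ennreal (1 / dist x y powr \<delta>) * indicator {y. diam / 2 / a ^ n < dist x y} y \<partial>M)"
proof -
  obtain C where C: "C \<ge> 1" and lo: "\<And>(x::'a) r. 0 \<le> r \<Longrightarrow> r < diam \<Longrightarrow> r powr \<delta> / C \<le> measure M (cball x r)"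
    and up: "\<And>(x::'a) r. 0 \<le> r \<Longrightarrow> r < diam \<Longrightarrow> measure M (cball x r) \<le> C * r powr \<delta>"
    using ball_bounds by blast
  \<comment> \<open>For radii in this ratio, the lower bound of the mass of the larger ball is twice the upper bound for the smaller ball.\<close>
  define a where "a = (2 * C\<^sup>2) powr (1 / \<delta>)"
  have C2: "1 \<le> C\<^sup>2" using C by simp
  have ad: "a powr \<delta> = 2 * C\<^sup>2" using \<delta>_pos C by (simp add: a_def powr_powr)
  have a: "1 < a" unfolding a_def using C2 \<delta>_pos by (intro gr_one_powr) auto
  define c where "c = 1 / (2 * C)"
  have c: "0 < c" using C by (simp add: c_def)
  define r where "r j = diam / 2 / a ^ j" for j :: nat
  have r: "0 < r j" "r j < diam" "r j = a * r (Suc j)" for j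
  proof -
    show "0 < r j" "r j = a * r (Suc j)" using diam a by (simp_all add: r_def)
    have "diam / 2 / a ^ j \<le> diam / 2" using diam a by (simp add: divide_le_eq mult_le_cancel_left1 one_le_power)
    then show "r j < diam" using diam by (simp add: r_def)
  qed
  have r_mono: "r j \<le> r i" if "i \<le> j" for i j
    unfolding r_def using that diam a by (intro divide_left_mono power_increasing) auto
  have "ennreal (real n * c) \<le> (\<integral>\<^sup>+y. ennreal (1 / dist x y powr \<delta>) * indicator {y. r n < dist x y} y \<partial>M)" for n x
  proof -
    define An where "An j = cball x (r j) - cball x (r (Suc j))" for j
    have Am [measurable]: "An j \<in> sets M" for j by (simp add: An_def)
    have disj: "disjoint_family_on An {..<n}"
    proof -
      have "An i \<inter> An j = {}" if "i < j" for i j using r_mono[of "Suc i" j] that by (auto simp: An_def)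
      then show ?thesis unfolding disjoint_family_on_def by (metis inf_commute linorder_neqE_nat)
    qed
    have one: "c \<le> 1 / r j powr \<delta> * measure M (An j)" for j
    proof -
      have sub: "cball x (r (Suc j)) \<subseteq> cball x (r j)" using r_mono[of j "Suc j"] by auto
      have "measure M (An j) = measure M (cball x (r j)) - measure M (cball x (r (Suc j)))"
        unfolding An_def using sub by (intro finite_measure_Diff) auto
      moreover have "r j powr \<delta> / C \<le> measure M (cball x (r j))" using r[of j] by (intro lo) auto
      moreover have "measure M (cball x (r (Suc j))) \<le> C * r (Suc j) powr \<delta>" using r[of "Suc j"] by (intro up) auto
      moreover have "C * r (Suc j) powr \<delta> = r j powr \<delta> / (2 * C)"
      proof -
        have "r j powr \<delta> = 2 * C\<^sup>2 * r (Suc j) powr \<delta>"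
          using r[of j] r[of "Suc j"] a by (simp add: powr_mult ad)
        then show ?thesis using C by (simp add: power2_eq_square)
      qed
      moreover have "r j powr \<delta> / C = 2 * (r j powr \<delta> / (2 * C))" using C by simp
      ultimately have "r j powr \<delta> / (2 * C) \<le> measure M (An j)" by linarith
      then have "1 / r j powr \<delta> * (r j powr \<delta> / (2 * C)) \<le> 1 / r j powr \<delta> * measure M (An j)" by (intro mult_left_mono) auto
      then show ?thesis using r(1)[of j] by (simp add: c_def)
    qed
    have "ennreal (real n * c) = (\<Sum>j<n. ennreal c)" using c by (simp add: ennreal_mult ennreal_of_nat_eq_real_of_nat)
    also have "\<dots> \<le> (\<Sum>j<n. ennreal (1 / r j powr \<delta> * measure M (An j)))" by (intro sum_mono ennreal_leI one)
    also have "\<dots> = (\<Sum>j<n. \<integral>\<^sup>+y. ennreal (1 / r j powr \<delta>) * indicator (An j) y \<partial>M)"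
      by (intro sum.cong refl) (simp add: nn_integral_cmult emeasure_eq_measure flip: ennreal_mult)
    also have "\<dots> = (\<integral>\<^sup>+y. (\<Sum>j<n. ennreal (1 / r j powr \<delta>) * indicator (An j) y) \<partial>M)"
      by (rule nn_integral_sum[symmetric]) simp
    also have "\<dots> \<le> (\<integral>\<^sup>+y. ennreal (1 / dist x y powr \<delta>) * indicator {y. r n < dist x y} y \<partial>M)"
    proof (intro nn_integral_mono disjoint_indicator_sum_le disj)
      fix y j assume j: "j < n" "y \<in> An j"
      then have d: "dist x y \<le> r j" "r (Suc j) < dist x y" by (auto simp: An_def)
      have "r n < dist x y" using r_mono[of "Suc j" n] j d by simp
      moreover have "1 / r j powr \<delta> \<le> 1 / dist x y powr \<delta>"
      proof (rule frac_le)
        show "0 < dist x y powr \<delta>" using d r(1)[of "Suc j"] by auto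
        show "dist x y powr \<delta> \<le> r j powr \<delta>" using d \<delta>_pos by (intro powr_mono2) auto
      qed simp_all
      ultimately show "ennreal (1 / r j powr \<delta>) \<le> ennreal (1 / dist x y powr \<delta>) * indicator {y. r n < dist x y} y"
        by (simp add: ennreal_leI)
    qed
    finally show ?thesis .
  qed
  then show ?thesis using c a unfolding r_def by blast
qed

end

section \<open>Growth of the logarithmic form\<close>

context ahlfors_space
begin

text \<open>On a space with a single point the form vanishes, and a constant kernel reproduces the norm.\<close>

lemma kernel_gap_point: assumes diam: "diam = 0" shows "kernel_gap (1 / \<mu>) 1"
  unfolding kernel_gap_def
proof (intro allI impI)
  fix L :: real assume L: "0 \<le> L"
  have eq: "x = undefined" for x :: 'a
    using dist_le_diam[of x undefined] diam zero_le_dist[of x undefined] by simp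
  show "\<exists>\<kappa>\<in>borel_measurable P. (\<forall>z. \<bar>\<kappa> z\<bar> \<le> 1 / \<mu> * exp (1 * L)) \<and>
    (\<forall>f\<in>energy_funs. L * (LINT x|M. (cmod (f x))\<^sup>2) \<le> Re (q (cls f) (cls f))
      + Re (LINT z|P. cnj (f (fst z)) * (complex_of_real (\<kappa> z) * f (snd z))))"
  proof (intro bexI[of _ "\<lambda>z. L / \<mu>"] conjI ballI allI)
    have "L \<le> exp L" using exp_ge_add_one_self[of L] by linarith
    then show "\<bar>L / \<mu>\<bar> \<le> 1 / \<mu> * exp (1 * L)" using L by (simp add: divide_right_mono)
    fix f assume f: "f \<in> energy_funs"
    define v where "v = f undefined"
    have fv: "f x = v" for x unfolding v_def using eq[of x] by simp
    have q0: "0 \<le> Re (q (cls f) (cls f))" using cls_Q[OF f] by (rule form.q_nonneg)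
    have vv: "cnj v * (complex_of_real (L / \<mu>) * v) = complex_of_real (L / \<mu> * (cmod v)\<^sup>2)"
      using complex_norm_square[of v] by (simp add: mult_ac)
    have "(LINT z|P. complex_of_real (L / \<mu> * (cmod v)\<^sup>2)) = (LINT x|M. LINT y|M. complex_of_real (L / \<mu> * (cmod v)\<^sup>2))"
      by (rule MM.integral_fst'[symmetric]) simp
    then have "(LINT z|P. complex_of_real (L / \<mu> * (cmod v)\<^sup>2)) = complex_of_real (\<mu> * (\<mu> * (L / \<mu> * (cmod v)\<^sup>2)))"
      by (simp add: scaleR_conv_of_real)
    then have "Re (LINT z|P. cnj (f (fst z)) * (complex_of_real (L / \<mu>) * f (snd z))) = \<mu> * (\<mu> * (L / \<mu> * (cmod v)\<^sup>2))"
      unfolding fv vv by (simp only: Re_complex_of_real)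
    moreover have "L * (LINT x|M. (cmod (f x))\<^sup>2) = \<mu> * (\<mu> * (L / \<mu> * (cmod v)\<^sup>2))"
      unfolding fv by (cases "\<mu> = 0") simp_all
    ultimately show "L * (LINT x|M. (cmod (f x))\<^sup>2) \<le> Re (q (cls f) (cls f))
      + Re (LINT z|P. cnj (f (fst z)) * (complex_of_real (L / \<mu>) * f (snd z)))" using q0 by linarith
  qed simp
qed

text \<open>Discard the part of the form not covered by \<open>\<kappa>\<close> and expand the square.  By symmetry the two
  diagonal terms agree, and each is at least \<open>m\<close> times the squared norm.\<close>

lemma form_ge_truncated:
  assumes \<kappa>_m: "\<kappa> \<in> borel_measurable P" and \<kappa>0: "\<And>z. 0 \<le> \<kappa> z" and \<kappa>_b: "\<And>z. \<kappa> z \<le> B"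
    and \<kappa>_le: "\<And>z. \<kappa> z \<le> 1 / dist (fst z) (snd z) powr \<delta>" and sym: "\<And>x y. \<kappa> (x, y) = \<kappa> (y, x)"
    and mass: "\<And>x. ennreal m \<le> (\<integral>\<^sup>+y. ennreal (\<kappa> (x, y)) \<partial>M)" and m: "0 \<le> m"
    and f: "f \<in> energy_funs"
  shows "m * (LINT x|M. (cmod (f x))\<^sup>2) \<le> Re (q (cls f) (cls f))
      + Re (LINT z|P. cnj (f (fst z)) * (complex_of_real (\<kappa> z) * f (snd z)))"
proof -
  have fL: "f \<in> L2_funs M" and fP: "diff_quot f \<in> L2_funs P" and fm: "f \<in> borel_measurable M" using energy_funsD[OF f] by blast+
  define F1 where "F1 z = \<kappa> z * (cmod (f (fst z)))\<^sup>2" for z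
  define F2 where "F2 z = \<kappa> z * (cmod (f (snd z)))\<^sup>2" for z
  define G where "G z = cnj (f (fst z)) * (complex_of_real (\<kappa> z) * f (snd z))" for z
  have G: "integrable P G" unfolding G_def
    by (rule kernel_prod_integrable[OF \<kappa>_m _ fL fL, of B]) (use \<kappa>0 \<kappa>_b in simp)
  have Fint: "integrable P (\<lambda>z. \<kappa> z * (cmod (g z))\<^sup>2)" if g: "g \<in> L2_funs P" for g
  proof (rule Bochner_Integration.integrable_bound)
    show "integrable P (\<lambda>z. B * (cmod (g z))\<^sup>2)" using L2_funsD(2)[OF g] by simp
    show "(\<lambda>z. \<kappa> z * (cmod (g z))\<^sup>2) \<in> borel_measurable P"
      using \<kappa>_m L2_funsD(1)[OF g] by (intro borel_measurable_times borel_measurable_power) auto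
    show "AE z in P. norm (\<kappa> z * (cmod (g z))\<^sup>2) \<le> norm (B * (cmod (g z))\<^sup>2)"
    proof (rule AE_I2)
      fix z
      have "0 \<le> B" using \<kappa>0[of z] \<kappa>_b[of z] by linarith
      then show "norm (\<kappa> z * (cmod (g z))\<^sup>2) \<le> norm (B * (cmod (g z))\<^sup>2)"
        using \<kappa>0[of z] \<kappa>_b[of z] by (simp add: mult_right_mono)
    qed
  qed
  have F1: "integrable P F1" and F2: "integrable P F2"
    unfolding F1_def F2_def using Fint[OF L2_fst_P(1)[OF fL]] Fint[OF L2_fst_P(2)[OF fL]] by simp_all
  have pt: "F1 z + F2 z - 2 * Re (G z) \<le> (cmod (diff_quot f z))\<^sup>2" for z
  proof -
    have e: "(cmod (f (fst z) - f (snd z)))\<^sup>2 = (cmod (f (fst z)))\<^sup>2 + (cmod (f (snd z)))\<^sup>2 - 2 * Re (cnj (f (fst z)) * f (snd z))"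
      by (simp add: cmod_power2 power2_diff algebra_simps)
    have "Re (G z) = \<kappa> z * Re (cnj (f (fst z)) * f (snd z))" by (simp add: G_def algebra_simps)
    then have "F1 z + F2 z - 2 * Re (G z) = \<kappa> z * (cmod (f (fst z) - f (snd z)))\<^sup>2"
      unfolding F1_def F2_def e by algebra
    also have "\<dots> \<le> 1 / dist (fst z) (snd z) powr \<delta> * (cmod (f (fst z) - f (snd z)))\<^sup>2"
      by (intro mult_right_mono \<kappa>_le) simp
    finally show ?thesis by (simp add: diff_quot_sq)
  qed
  have "(LINT z|P. F1 z + F2 z - 2 * Re (G z)) \<le> (LINT z|P. (cmod (diff_quot f z))\<^sup>2)"
    using F1 F2 G L2_funsD(2)[OF fP] by (intro integral_mono pt) auto
  also have "(LINT z|P. F1 z + F2 z - 2 * Re (G z)) = (LINT z|P. F1 z) + (LINT z|P. F2 z) - 2 * Re (LINT z|P. G z)"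
    using F1 F2 G by simp
  also have "(LINT z|P. F2 z) = (LINT z|P. F1 z)"
  proof -
    have "F1 = (\<lambda>(x, y). F2 (y, x))" using sym by (auto simp: F1_def F2_def fun_eq_iff)
    then show ?thesis using MM.integral_product_swap[of F2] F2 by simp
  qed
  finally have main: "(LINT z|P. F1 z) - Re (LINT z|P. G z) \<le> Re (q (cls f) (cls f))"
    by (simp add: q_cls_self[OF f])
  have "ennreal (m * (LINT x|M. (cmod (f x))\<^sup>2)) = (\<integral>\<^sup>+x. ennreal ((cmod (f x))\<^sup>2) * ennreal m \<partial>M)"
    using L2_funsD(2)[OF fL] fm m by (simp add: nn_integral_multc nn_integral_eq_integral ennreal_mult mult.commute[of m])
  also have "\<dots> \<le> (\<integral>\<^sup>+x. ennreal ((cmod (f x))\<^sup>2) * (\<integral>\<^sup>+y. ennreal (\<kappa> (x, y)) \<partial>M) \<partial>M)"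
    by (intro nn_integral_mono mult_left_mono mass) simp
  also have "\<dots> = (\<integral>\<^sup>+x. \<integral>\<^sup>+y. ennreal (F1 (x, y)) \<partial>M \<partial>M)"
  proof (intro nn_integral_cong)
    fix x
    have "(\<lambda>y. ennreal (\<kappa> (x, y))) \<in> borel_measurable M"
      using measurable_compose[OF measurable_Pair1'[of x M M] \<kappa>_m] by simp
    then show "ennreal ((cmod (f x))\<^sup>2) * (\<integral>\<^sup>+y. ennreal (\<kappa> (x, y)) \<partial>M) = (\<integral>\<^sup>+y. ennreal (F1 (x, y)) \<partial>M)"
      using \<kappa>0 by (simp add: F1_def ennreal_mult mult.commute nn_integral_multc)
  qed
  also have "\<dots> = (\<integral>\<^sup>+z. ennreal (F1 z) \<partial>P)" using F1 by (intro nn_integral_fst) auto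
  also have "\<dots> = ennreal (LINT z|P. F1 z)"
    by (intro nn_integral_eq_integral F1) (use \<kappa>0 in \<open>auto simp: F1_def\<close>)
  finally have le: "ennreal (m * (LINT x|M. (cmod (f x))\<^sup>2)) \<le> ennreal (LINT z|P. F1 z)" .
  have "0 \<le> (LINT z|P. F1 z)" by (rule Bochner_Integration.integral_nonneg) (use \<kappa>0 in \<open>simp add: F1_def\<close>)
  with le have "m * (LINT x|M. (cmod (f x))\<^sup>2) \<le> (LINT z|P. F1 z)" by (simp add: ennreal_le_iff)
  then show ?thesis using main unfolding G_def by linarith
qed

text \<open>To reach level \<open>L\<close>, about \<open>L / c\<close> annuli suffice.  The kernel cut off at the innermost radius
  \<open>r\<close> is at most \<open>1 / r powr \<delta>\<close>, which is exponential in the number of annuli.\<close>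

lemma kernel_gap_exists: "\<exists>A b. 0 \<le> A \<and> 0 \<le> b \<and> kernel_gap A b"
proof (cases "diam = 0")
  case True
  then show ?thesis using kernel_gap_point by (intro exI[of _ "1 / \<mu>"] exI[of _ 1]) simp
next
  case False
  then have diam: "0 < diam" using diam_nonneg by simp
  obtain c a where c: "0 < c" and a: "1 < a" and mass: "\<And>n x. ennreal (real n * c) \<le>
    (\<integral>\<^sup>+y. ennreal (1 / dist x y powr \<delta>) * indicator {y. diam / 2 / a ^ n < dist x y} y \<partial>M)"
    using truncated_kernel[OF diam] by blast
  define \<alpha> where "\<alpha> = a powr \<delta>"
  have \<alpha>: "1 < \<alpha>" unfolding \<alpha>_def using a \<delta>_pos by (rule gr_one_powr)
  define A where "A = (2 / diam) powr \<delta> * \<alpha>"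
  define b where "b = ln \<alpha> / c"
  have "kernel_gap A b"
    unfolding kernel_gap_def
  proof (intro allI impI)
    fix L :: real assume L: "0 \<le> L"
    define n where "n = nat \<lceil>L / c\<rceil>"
    have n: "L / c \<le> real n" "real n \<le> L / c + 1"
      using L c by (simp_all add: n_def)
    define r where "r = diam / 2 / a ^ n"
    have r: "0 < r" using diam a by (simp add: r_def)
    define \<kappa> where "\<kappa> z = 1 / dist (fst z) (snd z) powr \<delta> * indicator {z. r < dist (fst z) (snd z)} z" for z :: "'a \<times> 'a"
    have \<kappa>_m: "\<kappa> \<in> borel_measurable P"
    proof -
      have "{z \<in> space P. r < dist (fst z) (snd z)} \<in> sets P" by measurable
      then have [measurable]: "{z. r < dist (fst z) (snd z)} \<in> sets P" by (simp add: space_pair_measure)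
      show ?thesis unfolding \<kappa>_def by measurable
    qed
    have \<kappa>0: "0 \<le> \<kappa> z" for z by (simp add: \<kappa>_def)
    have \<kappa>_le: "\<kappa> z \<le> 1 / dist (fst z) (snd z) powr \<delta>" for z by (simp add: \<kappa>_def indicator_def)
    have \<kappa>_b: "\<kappa> z \<le> A * exp (b * L)" for z
    proof -
      have "\<kappa> z \<le> 1 / r powr \<delta>"
      proof (cases "r < dist (fst z) (snd z)")
        case True
        have "1 / dist (fst z) (snd z) powr \<delta> \<le> 1 / r powr \<delta>"
          using r \<delta>_pos True by (intro frac_le powr_mono2) auto
        then show ?thesis using \<kappa>_le[of z] by linarith
      qed (simp add: \<kappa>_def)
      also have "\<dots> = (1 / r) powr \<delta>" using r by (simp add: powr_divide)
      also have "\<dots> = (2 / diam * a ^ n) powr \<delta>" using diam a by (simp add: r_def)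
      also have "\<dots> = (2 / diam) powr \<delta> * (a ^ n) powr \<delta>" using diam a by (intro powr_mult)
      also have "(a ^ n) powr \<delta> = \<alpha> powr real n"
        using a by (simp add: \<alpha>_def powr_powr mult.commute flip: powr_realpow)
      also have "\<alpha> powr real n \<le> \<alpha> powr (L / c + 1)" using \<alpha> n by (intro powr_mono) auto
      also have "\<alpha> powr (L / c + 1) = \<alpha> * exp (b * L)"
        using \<alpha> by (simp add: powr_def b_def algebra_simps exp_add)
      finally show ?thesis using diam by (simp add: A_def mult.assoc mult_left_mono)
    qed
    have mass': "ennreal (real n * c) \<le> (\<integral>\<^sup>+y. ennreal (\<kappa> (x, y)) \<partial>M)" for x
    proof -
      have "ennreal (\<kappa> (x, y)) = ennreal (1 / dist x y powr \<delta>) * indicator {y. diam / 2 / a ^ n < dist x y} y" for y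
        by (simp add: \<kappa>_def r_def indicator_def)
      then show ?thesis using mass[of n x] by simp
    qed
    show "\<exists>\<kappa>\<in>borel_measurable P. (\<forall>z. \<bar>\<kappa> z\<bar> \<le> A * exp (b * L)) \<and>
      (\<forall>f\<in>energy_funs. L * (LINT x|M. (cmod (f x))\<^sup>2) \<le> Re (q (cls f) (cls f))
        + Re (LINT z|P. cnj (f (fst z)) * (complex_of_real (\<kappa> z) * f (snd z))))"
    proof (intro bexI[OF _ \<kappa>_m] conjI allI ballI)
      show "\<bar>\<kappa> z\<bar> \<le> A * exp (b * L)" for z using \<kappa>0[of z] \<kappa>_b[of z] by simp
      fix f assume f: "f \<in> energy_funs"
      have "L \<le> real n * c" using n(1) c by (simp add: field_simps)
      then have "L * (LINT x|M. (cmod (f x))\<^sup>2) \<le> real n * c * (LINT x|M. (cmod (f x))\<^sup>2)"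
        by (rule mult_right_mono) simp
      also have "\<dots> \<le> Re (q (cls f) (cls f)) + Re (LINT z|P. cnj (f (fst z)) * (complex_of_real (\<kappa> z) * f (snd z)))"
        by (rule form_ge_truncated[OF \<kappa>_m \<kappa>0 \<kappa>_b \<kappa>_le _ mass' _ f])
           (use c in \<open>auto simp: \<kappa>_def dist_commute indicator_def\<close>)
      finally show "L * (LINT x|M. (cmod (f x))\<^sup>2) \<le> Re (q (cls f) (cls f))
        + Re (LINT z|P. cnj (f (fst z)) * (complex_of_real (\<kappa> z) * f (snd z)))" .
    qed
  qed
  moreover have "0 \<le> A" "0 \<le> b" using \<alpha> c by (simp_all add: A_def b_def)
  ultimately show ?thesis by blast
qed

end

section \<open>The spectral triple\<close>

context ahlfors_space
begin

lemma laplacian_eigenbasis: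
  "\<exists>B t. exp_summable_operator L2 B (\<lambda>e. Re (q e e)) (log_laplacian M \<delta>) t"
proof -
  obtain A b where A: "0 \<le> A" and b: "0 \<le> b" and gap: "kernel_gap A b" using kernel_gap_exists by blast
  obtain B where B: "orthonormal_basis L2 B" and ev: "\<forall>e\<in>B. \<exists>\<rho>. cf.R e = hscale L2 \<rho> e"
    using cf.eigenbasis_exists[OF kernel_gap_compact[OF gap]] by blast
  have BQ: "B \<subseteq> Q" and diag: "diagonal_operator L2 B (\<lambda>e. Re (q e e)) (log_laplacian M \<delta>)"
    unfolding log_laplacian_def using cf.form_operator_diagonal[OF B] ev by blast+
  interpret diagonal_operator L2 B "\<lambda>e. Re (q e e)" "log_laplacian M \<delta>" by (rule diag)
  have "(\<lambda>e. exp (- (2 * b + 1) * Re (q e e))) summable_on B"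
  proof (rule exponential_counting_summable)
    show "real (card F) \<le> (A * \<mu> * exp b)\<^sup>2 * exp (2 * b * L)"
      if F: "finite F" "F \<subseteq> B" and L: "0 \<le> L" "\<And>e. e \<in> F \<Longrightarrow> Re (q e e) \<le> L" for F L
      using F BQ B_orth by (intro kernel_gap_count[OF gap F(1) _ _ L]) blast+
  qed (use lam_nonneg b in auto)
  then have "exp_summable_operator L2 B (\<lambda>e. Re (q e e)) (log_laplacian M \<delta>) (2 * b + 1)"
    using b by unfold_locales auto
  then show ?thesis by blast
qed

lemma dini_mult: assumes h: "h \<in> dini"
  shows "mult_op M h \<in> bounded_ops L2" "f \<in> L2_funs M \<Longrightarrow> mult_op M h (cls f) = cls (\<lambda>x. h x * f x)"
    "f \<in> L2_funs M \<Longrightarrow> (\<lambda>x. h x * f x) \<in> L2_funs M"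
proof -
  obtain K S where "schur_multiplier M \<delta> h K S" using dini_schur[OF h] by blast
  then interpret s: schur_multiplier M \<delta> h K S .
  show "mult_op M h \<in> bounded_ops L2" by (rule mult_op_bounded[OF s.h_meas s.h_bound])
  show "f \<in> L2_funs M \<Longrightarrow> mult_op M h (cls f) = cls (\<lambda>x. h x * f x)" by (rule s.mult_cls)
  show "f \<in> L2_funs M \<Longrightarrow> (\<lambda>x. h x * f x) \<in> L2_funs M" by (rule L2_bounded_mult[OF _ s.h_meas s.h_bound])
qed

text \<open>In the weak sense \<open>\<Delta> (h u) = h \<Delta> u + T u\<close>, where \<open>T\<close> is the integral operator with the kernel of
  the commutator.\<close>

lemma dini_commutator:
  assumes h: "h \<in> dini"
  shows "mult_op M h ` dom cf.\<Delta> \<subseteq> dom cf.\<Delta>"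
    "\<exists>T\<in>bounded_ops L2. \<forall>u\<in>dom cf.\<Delta>. T u = hminus L2 (the (cf.\<Delta> (mult_op M h u))) (mult_op M h (the (cf.\<Delta> u)))"
proof -
  obtain K S where "schur_multiplier M \<delta> h K S" using dini_schur[OF h] by blast
  then interpret s: schur_multiplier M \<delta> h K S .
  interpret c: schur_multiplier M \<delta> "\<lambda>x. cnj (h x)" K S by (rule s.schur_cnj)
  obtain T where T: "T \<in> bounded_ops L2"
    and Tb: "\<And>f g. f \<in> L2_funs M \<Longrightarrow> g \<in> L2_funs M \<Longrightarrow> L2.ip (T (cls f)) (cls g) = s.comm_form f g"
    using s.commutator_operator_exists by blast
  have TX: "T u \<in> L2.X" if "u \<in> L2.X" for u using T that by (auto simp: bounded_ops_def)
  have main: "cf.\<Delta> (mult_op M h u) = Some (hadd L2 (mult_op M h w) (T u))" if uw: "cf.\<Delta> u = Some w" for u w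
  proof -
    have u: "u \<in> Q" and w: "w \<in> L2.X" and rep: "\<And>G. G \<in> Q \<Longrightarrow> q u G = L2.ip w G"
      using uw cf.form_operator_iff by auto
    obtain f where f: "f \<in> energy_funs" and uf: "u = cls f" using Q_cases[OF u] .
    obtain v where v: "v \<in> L2_funs M" and wv: "w = cls v" using L2_class_cases[OF w] .
    have fL: "f \<in> L2_funs M" by (rule energy_funsD(1)[OF f])
    have hu: "mult_op M h u = cls (\<lambda>x. h x * f x)" unfolding uf by (rule s.mult_cls[OF fL])
    have hw: "mult_op M h w = cls (\<lambda>x. h x * v x)" unfolding wv by (rule s.mult_cls[OF v])
    have hv: "(\<lambda>x. h x * v x) \<in> L2_funs M" by (rule dini_mult(3)[OF h v])
    have "q (mult_op M h u) G = L2.ip (hadd L2 (mult_op M h w) (T u)) G" if G: "G \<in> Q" for G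
    proof -
      obtain g where g: "g \<in> energy_funs" and Gg: "G = cls g" using Q_cases[OF G] .
      have gL: "g \<in> L2_funs M" by (rule energy_funsD(1)[OF g])
      note hg = c.multiplier_energy[OF g]
      have "q (mult_op M h u) G = q (cls f) (cls (\<lambda>x. cnj (h x) * g x)) + s.comm_form f g"
        unfolding hu Gg by (rule s.form_commutator[OF f g])
      also have "q (cls f) (cls (\<lambda>x. cnj (h x) * g x)) = L2.ip (cls v) (cls (\<lambda>x. cnj (h x) * g x))"
        using rep[OF cls_Q[OF hg]] uf wv by simp
      also have "\<dots> = L2.ip (mult_op M h w) G"
        unfolding hw Gg L2_hinner[OF v energy_funsD(1)[OF hg]] L2_hinner[OF hv gL] by (simp add: mult_ac)
      also have "s.comm_form f g = L2.ip (T u) G" unfolding uf Gg by (rule Tb[OF fL gL, symmetric])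
      finally show ?thesis
        using hw L2_class_closed[OF hv] TX u G by simp
    qed
    moreover have "mult_op M h u \<in> Q" unfolding hu by (rule cls_Q[OF s.multiplier_energy[OF f]])
    ultimately show ?thesis
      unfolding cf.form_operator_iff using hw L2_class_closed[OF hv] TX u by simp
  qed
  show "mult_op M h ` dom cf.\<Delta> \<subseteq> dom cf.\<Delta>" using main by blast
  have "T u = hminus L2 (the (cf.\<Delta> (mult_op M h u))) (mult_op M h (the (cf.\<Delta> u)))" if u: "u \<in> dom cf.\<Delta>" for u
  proof -
    obtain w where w: "cf.\<Delta> u = Some w" using u by blast
    then have X: "u \<in> L2.X" "w \<in> L2.X" using cf.form_operator_iff[of u w] by auto
    have "mult_op M h w \<in> L2.X" using dini_mult(1)[OF h] X by (auto simp: bounded_ops_def)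
    then have "T u = hminus L2 (hadd L2 (mult_op M h w) (T u)) (mult_op M h w)"
      using X TX by (intro L2.inner_ext) simp_all
    then show ?thesis using main[OF w] w by simp
  qed
  then show "\<exists>T\<in>bounded_ops L2. \<forall>u\<in>dom cf.\<Delta>. T u = hminus L2 (the (cf.\<Delta> (mult_op M h u))) (mult_op M h (the (cf.\<Delta> u)))"
    using T by blast
qed

lemma dini_representation: "unital_star_representation dini L2 (mult_op M)"
  unfolding unital_star_representation_def
proof (intro conjI ballI allI)
  have d: "0 \<le> diameter (UNIV :: 'a set)" using diam_nonneg by (simp add: diam_def)
  have ext: "S = T" if S: "S \<in> extensional L2.X" and T: "T \<in> extensional L2.X"
    and eq: "\<And>f. f \<in> L2_funs M \<Longrightarrow> S (cls f) = T (cls f)" for S T :: "('a \<Rightarrow> complex) set \<Rightarrow> ('a \<Rightarrow> complex) set"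
  proof (rule extensionalityI[OF S T])
    show "S u = T u" if u: "u \<in> L2.X" for u using L2_class_cases[OF u] eq by metis
  qed
  have me [simp]: "mult_op M h \<in> extensional L2.X" for h by (simp add: mult_op_def)
  have oe [simp]: "op_id L2 \<in> extensional L2.X" "op_add L2 S T \<in> extensional L2.X" "op_scale L2 c S \<in> extensional L2.X" for S T c
    by (simp_all add: op_id_def op_add_def op_scale_def)
  show one: "(\<lambda>x::'a. 1) \<in> dini" by (rule dini_const[OF d])
  show "mult_op M (\<lambda>x. 1) = op_id L2"
    by (rule ext) (simp_all add: dini_mult(2)[OF one] op_id_def L2_class_closed)
  fix f :: "'a \<Rightarrow> complex" assume f: "f \<in> dini"
  show "mult_op M f \<in> bounded_ops L2" by (rule dini_mult(1)[OF f])
  show cf: "(\<lambda>x. c * f x) \<in> dini" for c by (rule dini_algebra(3)[OF d f f])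
  show "mult_op M (\<lambda>x. c * f x) = op_scale L2 c (mult_op M f)" for c
    by (rule ext) (simp_all add: dini_mult(2)[OF cf] dini_mult(2,3)[OF f] op_scale_def L2_class_closed L2_hscale mult.assoc)
  show cnjf: "(\<lambda>x. cnj (f x)) \<in> dini" by (rule dini_algebra(4)[OF d f f])
  show "is_op_adjoint L2 (mult_op M f) (mult_op M (\<lambda>x. cnj (f x)))"
    unfolding is_op_adjoint_def
  proof (intro ballI)
    fix u v assume "u \<in> L2.X" "v \<in> L2.X"
    then obtain a b where a: "a \<in> L2_funs M" "u = cls a" and b: "b \<in> L2_funs M" "v = cls b"
      by (metis L2_class_cases)
    show "L2.ip (mult_op M f u) v = L2.ip u (mult_op M (\<lambda>x. cnj (f x)) v)"
      unfolding a(2) b(2) dini_mult(2)[OF f a(1)] dini_mult(2)[OF cnjf b(1)]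
        L2_hinner[OF dini_mult(3)[OF f a(1)] b(1)] L2_hinner[OF a(1) dini_mult(3)[OF cnjf b(1)]]
      by (simp add: mult_ac)
  qed
  fix g :: "'a \<Rightarrow> complex" assume g: "g \<in> dini"
  show add: "(\<lambda>x. f x + g x) \<in> dini" by (rule dini_algebra(1)[OF d f g])
  show "mult_op M (\<lambda>x. f x + g x) = op_add L2 (mult_op M f) (mult_op M g)"
    by (rule ext) (simp_all add: dini_mult(2)[OF add] dini_mult(2,3)[OF f] dini_mult(2,3)[OF g] op_add_def
        L2_class_closed L2_hadd distrib_right)
  show mul: "(\<lambda>x. f x * g x) \<in> dini" by (rule dini_algebra(2)[OF d f g])
  show "mult_op M (\<lambda>x. f x * g x) = compose L2.X (mult_op M f) (mult_op M g)"
    by (rule ext) (simp_all add: dini_mult(2)[OF mul] dini_mult(2,3)[OF f] dini_mult(2,3)[OF g] compose_def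
        L2_class_closed mult.assoc)
qed

lemma cball_pos: assumes pos: "emeasure M UNIV \<noteq> 0" and r: "0 < r" shows "0 < measure M (cball (x::'a) r)"
proof (cases "diam = 0")
  case True
  have "y \<in> cball x r" for y using dist_le_diam[of x y] True r by simp
  then have "cball x r = UNIV" by blast
  then show ?thesis using pos by (simp add: emeasure_eq_measure zero_less_measure_iff)
next
  case False
  obtain C where C: "C \<ge> 1" and lo: "\<And>(x::'a) r. 0 \<le> r \<Longrightarrow> r < diam \<Longrightarrow> r powr \<delta> / C \<le> measure M (cball x r)"
    using ball_bounds by blast
  define s where "s = min r (diam / 2)"
  have s: "0 < s" "s < diam" "s \<le> r" using r False diam_nonneg by (auto simp: s_def)
  have "0 < s powr \<delta> / C" using s C by simp
  also have "\<dots> \<le> measure M (cball x s)" using s by (intro lo) auto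
  also have "\<dots> \<le> measure M (cball x r)" using s by (intro finite_measure_mono) auto
  finally show ?thesis .
qed

text \<open>A function is recovered from its multiplication operator almost everywhere, by applying the operator
  to the constant one.  Balls have positive mass, so continuous functions agreeing almost everywhere
  are equal.\<close>

lemma dini_faithful: assumes pos: "emeasure M UNIV \<noteq> 0" shows "inj_on (mult_op M) dini"
proof (rule inj_onI)
  fix f g :: "'a \<Rightarrow> complex" assume f: "f \<in> dini" and g: "g \<in> dini" and eq: "mult_op M f = mult_op M g"
  have one: "(\<lambda>x. 1) \<in> L2_funs M" by (rule bounded_L2[of _ 1]) auto
  have "cls f = cls g"
    using dini_mult(2)[OF f one] dini_mult(2)[OF g one] eq by simp
  then have ae: "AE x in M. f x = g x"
    using L2_class_eq_iff[OF energy_funsD(1)[OF dini_energy[OF f]] energy_funsD(1)[OF dini_energy[OF g]]] by simp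
  show "f = g"
  proof (rule ccontr)
    assume "f \<noteq> g"
    then obtain x where x: "f x \<noteq> g x" by blast
    have "continuous_on UNIV f" "continuous_on UNIV g"
      using f g by (auto simp: dini_iff intro: uniformly_continuous_imp_continuous)
    then have "open {y. f y \<noteq> g y}" by (intro open_Collect_neq)
    then obtain r where r: "0 < r" "cball x r \<subseteq> {y. f y \<noteq> g y}" using x open_contains_cball by blast
    have "AE y in M. y \<notin> cball x r" using ae r(2) by (auto elim!: eventually_mono)
    then have "cball x r \<in> null_sets M" by (simp add: AE_iff_null_sets)
    then show False using cball_pos[OF pos r(1), of x] by (simp add: null_sets_def measure_def)
  qed
qed

end

lemma representation_image_subalgebra:
  assumes "unital_star_representation A H \<pi>"
  shows "unital_star_subalgebra H (\<pi> ` A)"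
  unfolding unital_star_subalgebra_def
proof (intro conjI ballI allI)
  note r = assms[unfolded unital_star_representation_def]
  show "\<pi> ` A \<subseteq> bounded_ops H" using r by blast
  show "op_id H \<in> \<pi> ` A" using r by (metis imageI)
  fix T assume "T \<in> \<pi> ` A"
  then obtain f where f: "f \<in> A" and T: "T = \<pi> f" by blast
  show "op_scale H a T \<in> \<pi> ` A" for a
    by (rule image_eqI[of _ _ "\<lambda>x. a * f x"]) (use r f T in auto)
  show "\<exists>S\<in>\<pi> ` A. is_op_adjoint H T S"
    by (rule bexI[of _ "\<pi> (\<lambda>x. cnj (f x))"]) (use r f T in auto)
  fix S assume "S \<in> \<pi> ` A"
  then obtain g where g: "g \<in> A" and S: "S = \<pi> g" by blast
  show "op_add H T S \<in> \<pi> ` A"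
    by (rule image_eqI[of _ _ "\<lambda>x. f x + g x"]) (use r f g T S in auto)
  show "compose (hcarrier H) T S \<in> \<pi> ` A"
    by (rule image_eqI[of _ _ "\<lambda>x. f x * g x"]) (use r f g T S in auto)
qed

theorem proposition5p3:
  fixes M :: "'a::{metric_space, second_countable_topology} measure" and \<delta> :: real
  assumes "\<delta> > 0"
    and "metric_measure_space M"
    and "ahlfors_regular M \<delta>"
  shows "spectral_triple (mult_op M ` dini) (L2_space M) (log_laplacian M \<delta>)
    \<and> Li_summable (L2_space M) (log_laplacian M \<delta>)
    \<and> unital_star_representation dini (L2_space M) (mult_op M)
    \<and> (emeasure M UNIV \<noteq> 0 \<longrightarrow> inj_on (mult_op M) dini)"
proof -
  interpret finite_measure M using assms(2) by (simp add: metric_measure_space_def)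
  interpret ahlfors_space M \<delta>
    by unfold_locales (use assms in \<open>auto simp: metric_measure_space_def\<close>)
  obtain B t where "exp_summable_operator L2 B (\<lambda>e. Re (q e e)) (log_laplacian M \<delta>) t"
    using laplacian_eigenbasis by blast
  then interpret E: exp_summable_operator L2 B "\<lambda>e. Re (q e e)" "log_laplacian M \<delta>" t .
  have "spectral_triple (mult_op M ` dini) L2 (log_laplacian M \<delta>)"
    unfolding spectral_triple_def
  proof (intro conjI ballI)
    show "complex_hilbert_space L2" by (rule complex_hilbert_L2)
    show "unital_star_subalgebra L2 (mult_op M ` dini)"
      by (rule representation_image_subalgebra[OF dini_representation])
    show "self_adjoint L2 (log_laplacian M \<delta>)" by (rule E.self_adjoint_D)
    show "compact_resolvent L2 (log_laplacian M \<delta>)" by (rule E.compact_resolvent_D)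
    fix a assume "a \<in> mult_op M ` dini"
    then obtain h where h: "h \<in> dini" and a: "a = mult_op M h" by blast
    show "a ` dom (log_laplacian M \<delta>) \<subseteq> dom (log_laplacian M \<delta>)"
      unfolding a log_laplacian_def by (rule dini_commutator(1)[OF h])
    show "\<exists>T\<in>bounded_ops L2. \<forall>u\<in>dom (log_laplacian M \<delta>).
        T u = hminus L2 (the (log_laplacian M \<delta> (a u))) (a (the (log_laplacian M \<delta> u)))"
      unfolding a log_laplacian_def by (rule dini_commutator(2)[OF h])
  qed
  then show ?thesis using E.Li_summable_D dini_representation dini_faithful by blast
qed

end
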